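(* Let $\mathcal S=\{i_1,\dots,i_M\}$, $i_1<\dots<i_M$, let $\underline p=(p_1,\dots,p_M)\in\mathbb S^M$, let $\underline b=(b_2,\dots,b_{M-1})$ satisfy $-\frac{1}{i_{j+1}-i_j}<b_j<\frac{1}{i_j-i_{j-1}}$ for $j=2,\dots,M-1$, and let $\underline k=(k_2,\dots,k_{M-1})\in\mathbb R_+^{M-2}$. For a given (deterministic) $t>0$ there exist a vector $\underline\lambda=(\lambda_2,\dots,\lambda_{M-1})\in\mathbb R_+^{M-2}$, an $$\alpha\in\big[\exp\{-t(k\lambda)^*\},1\big],\qquad (k\lambda)^*=\max_{j\in\{2,\dots,M-1\}}\lambda_j\widetilde k_j,$$ an $l\in\{2,\dots,M\}$ and a $\beta\in(0,1]$ such that $\Theta(\underline k,\underline\lambda)$ is the intensity matrix of a time homogeneous continuous time Markov chain $X$ on $\mathcal S\cup\{D\}$ satisfying $$\beta\,\mathbb P(X_t=i_j\mid X_0=i_l)+(1-\beta)\,\mathbb P(X_t=i_j\mid X_0=i_{l-1})=\alpha p_j,\qquad j=1,\dots,M.$$ With $a(i_j)=\lambda_j(i_{j+1}-i_j)(i_j-i_{j-1})$ for $2\le j\le M-1$ and $a(i_1)=a(i_M)=0$, the infinitesimal generator of $X$ is $a\left(\frac12\Delta+b\nabla-k\right)$.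
   Context: Conventions: $\mathbb R_+=[0,\infty)$, $M\ge3$, $\mathbb S^M=\{(p_1,\dots,p_M):0<p_j<1,\ \sum_jp_j=1\}$. $D$ is an absorbing cemetery state, identified with index $M+1$; state $i_j$ is identified with index $j$. Set $\widetilde k_j=(i_{j+1}-i_j)(i_j-i_{j-1})k_j$ for $2\le j\le M-1$, $\widetilde k_1=\widetilde k_M=0$. For $2\le j\le M-1$ set $$q_{j,j+1}=\tfrac{i_j-i_{j-1}}{i_{j+1}-i_{j-1}}\big(1+(i_{j+1}-i_j)b_j\big),\qquad q_{j,j-1}=\tfrac{i_{j+1}-i_j}{i_{j+1}-i_{j-1}}\big(1-(i_j-i_{j-1})b_j\big).$$ Intensity matrix: $\Theta=\Theta(\underline k,\underline\lambda)$ is the $(M+1)\times(M+1)$ matrix whose rows $1$, $M$, $M+1$ are zero and, for $2\le j\le M-1$, $\Theta_{j,j+1}=\lambda_jq_{j,j+1}$ and $\Theta_{j,j-1}=\lambda_jq_{j,j-1}$ (neighbours in $\{1,\dots,M\}$), $\Theta_{jj}=-\lambda_j(1+\widetilde k_j)$, $\Theta_{j,M+1}=\lambda_j\widetilde k_j$, all other entries $0$. Discrete operators on $f:\mathcal S\to\mathbb R$: $\Delta f(i_1)=\Delta f(i_M)=\nabla f(i_1)=\nabla f(i_M)=0$ and, for $2\le j\le M-1$, $\Delta f(i_j)=\frac{2}{(i_{j+1}-i_j)(i_j-i_{j-1})}\Big(\frac{i_j-i_{j-1}}{i_{j+1}-i_{j-1}}f(i_{j+1})-f(i_j)+\frac{i_{j+1}-i_j}{i_{j+1}-i_{j-1}}f(i_{j-1})\Big)$,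 $\nabla f(i_j)=\frac{f(i_{j+1})-f(i_{j-1})}{i_{j+1}-i_{j-1}}$. Here $b(i_j)=b_j$, $k(i_j)=k_j$; functions on $\mathcal S$ are extended by $0$ at $D$ when speaking of the generator of the killed chain. *)

theory Defs
  imports "HOL-Probability.Probability"
begin

section \<open>Time homogeneous continuous time Markov chains\<close>

definition trans_prob ::
  "'w measure \<Rightarrow> (real \<Rightarrow> 'w \<Rightarrow> 's) \<Rightarrow> real \<Rightarrow> 's \<Rightarrow> 's \<Rightarrow> real" where
  "trans_prob \<Omega> X t x y = \<P>(\<omega> in \<Omega>. X t \<omega> = y \<bar> X 0 \<omega> = x)"

definition markov_property ::
  "'w measure \<Rightarrow> (real \<Rightarrow> 'w \<Rightarrow> 's) \<Rightarrow> bool" where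
  "markov_property \<Omega> X \<longleftrightarrow>
    (\<forall>(n::nat) (s::nat \<Rightarrow> real) (x::nat \<Rightarrow> 's) y.
      0 \<le> s 0 \<and> (\<forall>m\<le>n. s m < s (Suc m)) \<and>
      \<P>(\<omega> in \<Omega>. \<forall>m\<le>n. X (s m) \<omega> = x m) > 0 \<longrightarrow>
      \<P>(\<omega> in \<Omega>. X (s (Suc n)) \<omega> = y \<bar> \<forall>m\<le>n. X (s m) \<omega> = x m) =
      \<P>(\<omega> in \<Omega>. X (s (Suc n)) \<omega> = y \<bar> X (s n) \<omega> = x n))"

definition time_homogeneous ::
  "'w measure \<Rightarrow> (real \<Rightarrow> 'w \<Rightarrow> 's) \<Rightarrow> bool" where
  "time_homogeneous \<Omega> X \<longleftrightarrow>
    (\<forall>s\<ge>0. \<forall>t\<ge>0. \<forall>x y. \<P>(\<omega> in \<Omega>. X s \<omega> = x) > 0 \<longrightarrow>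
      \<P>(\<omega> in \<Omega>. X (s + t) \<omega> = y \<bar> X s \<omega> = x) = trans_prob \<Omega> X t x y)"

text \<open>
  The chain has right-continuous paths for the discrete topology on the state space.
  Every state is charged by the initial law, so that the elementary conditional
  probabilities given the initial state are meaningful for all states (division by zero
  never occurs); the law of the chain started at \<open>x\<close> is the conditional law given \<open>X 0 = x\<close>.
\<close>

definition markov_chain ::
  "'w measure \<Rightarrow> (real \<Rightarrow> 'w \<Rightarrow> 's) \<Rightarrow> 's set \<Rightarrow> bool" where
  "markov_chain \<Omega> X E \<longleftrightarrow>
    prob_space \<Omega> \<and>
    (\<forall>t\<ge>0. X t \<in> measurable \<Omega> (count_space E)) \<and>
    (\<forall>\<omega>\<in>space \<Omega>. \<forall>t\<ge>0. \<exists>\<epsilon>>0. \<forall>s\<in>{t..<t + \<epsilon>}. X s \<omega> = X t \<omega>) \<and>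
    (\<forall>x\<in>E. \<P>(\<omega> in \<Omega>. X 0 \<omega> = x) > 0) \<and>
    markov_property \<Omega> X \<and> time_homogeneous \<Omega> X"

text \<open>
  \<open>e\<close> enumerates the state space by \<open>{1..n}\<close>; the value at time 0 of the differentiated
  function is the Kronecker delta.
\<close>

definition is_intensity_matrix ::
  "'w measure \<Rightarrow> (real \<Rightarrow> 'w \<Rightarrow> 's) \<Rightarrow> nat \<Rightarrow> (nat \<Rightarrow> 's) \<Rightarrow> (nat \<Rightarrow> nat \<Rightarrow> real) \<Rightarrow> bool" where
  "is_intensity_matrix \<Omega> X n e Q \<longleftrightarrow>
    (\<forall>r\<in>{1..n}. \<forall>c\<in>{1..n}.
      ((\<lambda>h. trans_prob \<Omega> X h (e r) (e c)) has_real_derivative Q r c) (at_right 0))"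

definition transition_semigroup ::
  "'w measure \<Rightarrow> (real \<Rightarrow> 'w \<Rightarrow> 's) \<Rightarrow> 's set \<Rightarrow> real \<Rightarrow> ('s \<Rightarrow> real) \<Rightarrow> 's \<Rightarrow> real" where
  "transition_semigroup \<Omega> X E h f x = (\<Sum>y\<in>E. trans_prob \<Omega> X h x y * f y)"

definition has_generator_at ::
  "'w measure \<Rightarrow> (real \<Rightarrow> 'w \<Rightarrow> 's) \<Rightarrow> 's set \<Rightarrow> ('s \<Rightarrow> real) \<Rightarrow> 's \<Rightarrow> real \<Rightarrow> bool" where
  "has_generator_at \<Omega> X E f x g \<longleftrightarrow>
    ((\<lambda>h. (transition_semigroup \<Omega> X E h f x - f x) / h) \<longlongrightarrow> g) (at_right 0)"


section \<open>The killed chain on a finite grid\<close>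

text \<open>
  The grid is \<open>i 1 < \<dots> < i M\<close>. Its points are the states \<open>Some (i j)\<close>, and the
  cemetery is \<open>None\<close>, which carries the index \<open>M + 1\<close>. The entries \<open>b j\<close>, \<open>k j\<close>,
  \<open>lam j\<close> are relevant for \<open>2 \<le> j \<le> M - 1\<close> only.
\<close>

definition state :: "nat \<Rightarrow> (nat \<Rightarrow> real) \<Rightarrow> nat \<Rightarrow> real option" where
  "state M i j = (if j = M + 1 then None else Some (i j))"

definition states :: "nat \<Rightarrow> (nat \<Rightarrow> real) \<Rightarrow> real option set" where
  "states M i = insert None (Some ` i ` {1..M})"

definition ktilde :: "nat \<Rightarrow> (nat \<Rightarrow> real) \<Rightarrow> (nat \<Rightarrow> real) \<Rightarrow> nat \<Rightarrow> real" where
  "ktilde M i k j =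
    (if j \<in> {2..M - 1} then (i (j + 1) - i j) * (i j - i (j - 1)) * k j else 0)"

definition q_up :: "(nat \<Rightarrow> real) \<Rightarrow> (nat \<Rightarrow> real) \<Rightarrow> nat \<Rightarrow> real" where
  "q_up i b j =
    (i j - i (j - 1)) / (i (j + 1) - i (j - 1)) * (1 + (i (j + 1) - i j) * b j)"

definition q_down :: "(nat \<Rightarrow> real) \<Rightarrow> (nat \<Rightarrow> real) \<Rightarrow> nat \<Rightarrow> real" where
  "q_down i b j =
    (i (j + 1) - i j) / (i (j + 1) - i (j - 1)) * (1 - (i j - i (j - 1)) * b j)"

definition Theta ::
  "nat \<Rightarrow> (nat \<Rightarrow> real) \<Rightarrow> (nat \<Rightarrow> real) \<Rightarrow> (nat \<Rightarrow> real) \<Rightarrow> (nat \<Rightarrow> real) \<Rightarrow> nat \<Rightarrow> nat \<Rightarrow> real" where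
  "Theta M i b k lam r c =
    (if r \<in> {2..M - 1} then
       (if c = r + 1 then lam r * q_up i b r
        else if c = r - 1 then lam r * q_down i b r
        else if c = r then - lam r * (1 + ktilde M i k r)
        else if c = M + 1 then lam r * ktilde M i k r
        else 0)
     else 0)"

text \<open>
  The operators below map a function \<open>f\<close> on the grid to their value at \<open>i j\<close>.
\<close>

definition Laplace :: "nat \<Rightarrow> (nat \<Rightarrow> real) \<Rightarrow> (real \<Rightarrow> real) \<Rightarrow> nat \<Rightarrow> real" where
  "Laplace M i f j =
    (if j \<in> {2..M - 1} then
       2 / ((i (j + 1) - i j) * (i j - i (j - 1))) *
       ((i j - i (j - 1)) / (i (j + 1) - i (j - 1)) * f (i (j + 1)) - f (i j)
        + (i (j + 1) - i j) / (i (j + 1) - i (j - 1)) * f (i (j - 1)))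
     else 0)"

definition Nabla :: "nat \<Rightarrow> (nat \<Rightarrow> real) \<Rightarrow> (real \<Rightarrow> real) \<Rightarrow> nat \<Rightarrow> real" where
  "Nabla M i f j =
    (if j \<in> {2..M - 1} then (f (i (j + 1)) - f (i (j - 1))) / (i (j + 1) - i (j - 1)) else 0)"

definition a_coeff :: "nat \<Rightarrow> (nat \<Rightarrow> real) \<Rightarrow> (nat \<Rightarrow> real) \<Rightarrow> nat \<Rightarrow> real" where
  "a_coeff M i lam j =
    (if j \<in> {2..M - 1} then lam j * (i (j + 1) - i j) * (i j - i (j - 1)) else 0)"

definition extend_zero :: "(real \<Rightarrow> real) \<Rightarrow> real option \<Rightarrow> real" where
  "extend_zero f = case_option 0 f"

end

theory Submission
  imports Defs
begin

text \<open>
  Row \<open>j\<close> of the intensity matrix is \<open>\<lambda>\<^sub>j\<close> times a row that does not depend on the rates, so the two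
  harmonic functions \<open>\<psi>\<close> (increasing) and \<open>\<phi>\<close> (decreasing) of the killed walk give two conservation
  laws that hold for all rates. They determine the starting mixture and \<open>\<alpha>\<close> in terms of \<open>p\<close>, and they
  reduce the problem to matching the law at time \<open>t\<close> in the interior states.

  On a box \<open>[0, R]\<close> in every rate, Kuhn's lemma gives rates with law at least \<open>\<alpha> p\<^sub>j\<close> where \<open>\<lambda>\<^sub>j > 0\<close> and at
  most \<open>\<alpha> p\<^sub>j\<close> where \<open>\<lambda>\<^sub>j < R\<close>. If \<open>\<lambda>\<^sub>j = R\<close>, the mass at \<open>j\<close> cannot have built up just before \<open>t\<close>, because its
  derivative is bounded by \<open>1 / t\<close> times a bound on the expected number of jumps; then too many jumps
  leave \<open>j\<close> when \<open>R\<close> is large. If \<open>\<lambda>\<^sub>j = 0\<close>, the Green function of \<open>j\<close> has constant mean, which contradicts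
  the strict Jensen inequality for the target law.

  The chain itself comes from Kolmogorov's extension theorem. The expected number of changes along
  dyadic grids is bounded, so right limits along the dyadic times exist and define a
  right-continuous version.
\<close>

section \<open>Right-continuous chains from transition kernels\<close>

text \<open>The two conserved means are matched by two parameters, the position of the start and
  \<alpha>; this is why the start is a mixture over neighbouring points. What remains are M - 2
  rates for M - 2 interior equations. Once these hold, \<psi> vanishes at 1 and so fixes the mass at
  M, and \<phi> vanishes at M and so fixes the mass at 1.

  The obstacle is existence: the rates fill an unbounded orthant, and one rate can influence the
  mass at every site, so the equations cannot be solved one by one. A box restores compactness at
  the price of solutions on its faces, and the order in which faces are excluded matters. Without
  the upper faces, the law at time t is at most \<open>\<alpha> * p j\<close> at every interior
  site; only with this bound does a vanishing rate contradict Jensen's inequality.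

  The bound R is fixed before the rates are known. This works because the operator \<open>Q\<close>
  contains no rates, so the harmonic functions, the Green functions and the bound on the number of
  jumps are the same for the whole box. One uniformization constant for the box makes the law
  continuous in the rates.\<close>

text \<open>States are coded as reals because Kolmogorov's theorem is stated for Polish types.\<close>

locale jump_semigroup =
  fixes K :: "real \<Rightarrow> real \<Rightarrow> real pmf" and \<nu> :: "real pmf" and E :: "real set" and C :: real
  assumes K_zero: "K 0 x = return_pmf x"
    and K_add: "0 \<le> s \<Longrightarrow> 0 \<le> t \<Longrightarrow> bind_pmf (K s x) (K t) = K (s + t) x"
    and K_rate: "0 \<le> t \<Longrightarrow> measure (K t x) (- {x}) \<le> C * t"
    and K_closed: "0 \<le> t \<Longrightarrow> x \<in> E \<Longrightarrow> set_pmf (K t x) \<subseteq> E"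
    and init: "set_pmf \<nu> = E"
begin

text \<open>Coordinates off the list are \<open>undefined\<close>, so that a law at fewer times is
  recovered from one at more times by resetting a coordinate, as in
  \<open>path_pmf_drop\<close>.\<close>

primrec path_pmf :: "real \<Rightarrow> real \<Rightarrow> real list \<Rightarrow> (real \<Rightarrow> real) pmf" where
  "path_pmf s x [] = return_pmf (\<lambda>_. undefined)"
| "path_pmf s x (t # ts) =
    bind_pmf (K (t - s) x) (\<lambda>y. map_pmf (\<lambda>f. f(t := y)) (path_pmf t y ts))"

definition fdd :: "real list \<Rightarrow> (real \<Rightarrow> real) pmf" where
  "fdd ts = bind_pmf \<nu> (\<lambda>x. path_pmf 0 x ts)"

lemma countable_E: "countable E"
  using init by (metis countable_set_pmf)

lemma path_pmf_undefined: "f \<in> set_pmf (path_pmf s x ts) \<Longrightarrow> t \<notin> set ts \<Longrightarrow> f t = undefined"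
  by (induction ts arbitrary: s x f) auto

text \<open>Chapman-Kolmogorov at the inserted time: if a later time follows, the two kernels around
  t merge by \<open>K_add\<close>; if t comes last, its kernel integrates to one.\<close>

lemma path_pmf_drop:
  assumes "sorted (s # ts)" "s \<le> t" "t \<notin> set ts"
  shows "map_pmf (\<lambda>f. f(t := undefined)) (path_pmf s x (insort t ts)) = path_pmf s x ts"
  using assms
proof (induction ts arbitrary: s x)
  case Nil
  have eq: "(\<lambda>a. if a = t then undefined else ((\<lambda>_. undefined)(t := y)) a) = (\<lambda>_. undefined)" for y :: real
    by auto
  show ?case
    by (simp add: map_bind_pmf map_pmf_comp fun_upd_def[of _ t undefined] eq)
next
  case (Cons u ts)
  show ?case
  proof (cases "t \<le> u")
    case True
    have "map_pmf (\<lambda>f. f(t := undefined)) (path_pmf s x (insort t (u # ts))) =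
      bind_pmf (K (t - s) x) (\<lambda>y. bind_pmf (K (u - t) y) (\<lambda>z.
        map_pmf (\<lambda>f. f(u := z, t := undefined)) (path_pmf u z ts)))"
      using True by (simp add: map_bind_pmf map_pmf_comp)
    also have "\<dots> = bind_pmf (K (t - s) x) (\<lambda>y. bind_pmf (K (u - t) y) (\<lambda>z.
        map_pmf (\<lambda>f. f(u := z)) (path_pmf u z ts)))"
      using Cons.prems
      by (intro bind_pmf_cong refl map_pmf_cong) (auto simp: fun_eq_iff path_pmf_undefined)
    also have "\<dots> = bind_pmf (K (u - s) x) (\<lambda>z. map_pmf (\<lambda>f. f(u := z)) (path_pmf u z ts))"
      using True Cons.prems K_add[of "t - s" "u - t" x]
      by (simp flip: bind_assoc_pmf)
    finally show ?thesis by (simp only: path_pmf.simps)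
  next
    case False
    have "map_pmf (\<lambda>f. f(t := undefined)) (path_pmf s x (insort t (u # ts))) =
      bind_pmf (K (u - s) x) (\<lambda>y. map_pmf (\<lambda>f. f(u := y))
        (map_pmf (\<lambda>f. f(t := undefined)) (path_pmf u y (insort t ts))))"
      using False Cons.prems
      by (simp add: map_bind_pmf map_pmf_comp fun_upd_twist[of t u])
    also have "\<dots> = path_pmf s x (u # ts)"
      using False Cons.prems by (subst Cons.IH) auto
    finally show ?thesis .
  qed
qed

lemma fdd_drop:
  assumes "sorted ts" "\<forall>u\<in>set ts. 0 \<le> u" "0 \<le> t" "t \<notin> set ts"
  shows "map_pmf (\<lambda>f. f(t := undefined)) (fdd (insort t ts)) = fdd ts"
  unfolding fdd_def map_bind_pmf
  using assms by (intro bind_pmf_cong refl path_pmf_drop) auto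

definition fdd_measure :: "real set \<Rightarrow> (real \<Rightarrow> real) measure" where
  "fdd_measure J = distr (measure_pmf (fdd (sorted_list_of_set J))) (\<Pi>\<^sub>M i\<in>J. borel) (\<lambda>f. restrict f J)"

lemma fdd_restrict:
  assumes "finite D" "finite J" "J \<inter> D = {}" "J \<union> D \<subseteq> {0..}"
  shows "map_pmf (\<lambda>f. restrict f J) (fdd (sorted_list_of_set (J \<union> D))) =
    map_pmf (\<lambda>f. restrict f J) (fdd (sorted_list_of_set J))"
  using assms
proof (induction D rule: finite_induct)
  case (insert t D)
  have "map_pmf (\<lambda>f. restrict f J) (fdd (sorted_list_of_set (J \<union> insert t D))) =
    map_pmf (\<lambda>f. restrict f J) (map_pmf (\<lambda>f. f(t := undefined)) (fdd (insort t (sorted_list_of_set (J \<union> D)))))"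
    using insert by (auto simp: map_pmf_comp restrict_def fun_eq_iff intro!: map_pmf_cong)
  also have "\<dots> = map_pmf (\<lambda>f. restrict f J) (fdd (sorted_list_of_set (J \<union> D)))"
    using insert by (subst fdd_drop) auto
  also have "\<dots> = map_pmf (\<lambda>f. restrict f J) (fdd (sorted_list_of_set J))"
    by (rule insert.IH) (use insert.prems in auto)
  finally show ?case .
qed auto

lemma polish_projective_fdd: "polish_projective {0..} fdd_measure"
proof (intro polish_projective.intro projective_family.intro, goal_cases)
  case (1 J H)
  have fin: "finite J" using 1 finite_subset by blast
  \<comment> \<open>The sigma-algebra of a pmf contains all sets, so only the target space has to be
    checked.\<close>
  have meas: "(\<lambda>f. restrict f J) \<in> measurable (measure_pmf q) (\<Pi>\<^sub>M i\<in>J. borel)"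
    for q :: "(real \<Rightarrow> real) pmf" and J :: "real set"
    by (simp add: measurable_def space_PiM)
  have *: "distr (measure_pmf q) (\<Pi>\<^sub>M i\<in>J. borel) (\<lambda>f. restrict f J) =
    distr (measure_pmf (map_pmf (\<lambda>f. restrict f J) q)) (\<Pi>\<^sub>M i\<in>J. borel) (\<lambda>f. restrict f J)"
    for q :: "(real \<Rightarrow> real) pmf"
    unfolding map_pmf_rep_eq by (subst distr_distr) (auto simp: comp_def meas space_PiM)
  have "distr (fdd_measure H) (\<Pi>\<^sub>M i\<in>J. borel) (\<lambda>f. restrict f J) =
    distr (measure_pmf (fdd (sorted_list_of_set H))) (\<Pi>\<^sub>M i\<in>J. borel) (\<lambda>f. restrict f J)"
    unfolding fdd_measure_def using 1
    by (subst distr_distr) (auto simp: comp_def meas measurable_restrict_subset Int_absorb1 space_PiM)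
  also have "\<dots> = distr (measure_pmf (fdd (sorted_list_of_set J))) (\<Pi>\<^sub>M i\<in>J. borel) (\<lambda>f. restrict f J)"
    by (subst (1 2) *) (use 1 fin fdd_restrict[of "H - J" J] in \<open>simp add: Un_absorb1\<close>)
  finally show ?case
    unfolding fdd_measure_def by simp
next
  case (2 J)
  show ?case
    unfolding fdd_measure_def
    by (rule measure_pmf.prob_space_distr) (auto simp: measurable_def space_PiM)
qed

sublocale kol: polish_projective "{0..}" fdd_measure
  by (rule polish_projective_fdd)

abbreviation "\<L> \<equiv> kol.lim"

lemma measurable_eval [measurable]: "0 \<le> t \<Longrightarrow> (\<lambda>\<omega>. \<omega> t) \<in> borel_measurable \<L>"
  by (subst measurable_cong_sets[OF kol.sets_lim refl]) (rule measurable_component_singleton, simp)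

text \<open>Reduces an event on the limit space to a computation with a pmf; \<open>loc\<close> says
  that the event looks only at the listed times.\<close>

lemma measure_lim_cylinder:
  assumes ts: "sorted ts" "distinct ts" "\<forall>t\<in>set ts. 0 \<le> t"
    and "Measurable.pred (\<Pi>\<^sub>M i\<in>set ts. borel) R"
    and loc: "\<And>f. R (restrict f (set ts)) = R f"
  shows "measure \<L> {\<omega>\<in>space \<L>. R \<omega>} = measure (fdd ts) {f. R f}"
proof -
  let ?J = "set ts" and ?S = "\<Pi>\<^sub>M i\<in>set ts. (borel :: real measure)"
  have X: "{f\<in>space ?S. R f} \<in> sets ?S"
    using assms(4) by (simp add: pred_def)
  have "{\<omega>\<in>space \<L>. R \<omega>} = prod_emb {0..} (\<lambda>_. borel) ?J {f\<in>space ?S. R f}"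
    by (auto simp: prod_emb_def space_PiM loc)
  then have "measure \<L> {\<omega>\<in>space \<L>. R \<omega>} = measure (fdd_measure ?J) {f\<in>space ?S. R f}"
    using ts X by (simp add: kol.measure_lim_emb subset_iff)
  also have "\<dots> = measure (fdd ts) {f. R f}"
    unfolding fdd_measure_def
    by (subst measure_distr)
       (use X ts in \<open>auto simp: measurable_def space_PiM loc vimage_def sorted_list_of_set.idem_if_sorted_distinct\<close>)
  finally show ?thesis .
qed

lemma measure_bind_pmf_singleton:
  assumes "\<And>x. x \<noteq> a \<Longrightarrow> measure (measure_pmf (f x)) A = 0"
  shows "measure (measure_pmf (bind_pmf q f)) A = pmf q a * measure (measure_pmf (f a)) A"
proof -
  have "emeasure (measure_pmf (bind_pmf q f)) A = (\<integral>\<^sup>+x. emeasure (measure_pmf (f x)) A \<partial>measure_pmf q)"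
    by simp
  also have "\<dots> = (\<integral>\<^sup>+x. emeasure (measure_pmf (f a)) A * indicator {a} x \<partial>measure_pmf q)"
    using assms by (intro nn_integral_cong) (auto simp: measure_pmf.emeasure_eq_measure split: split_indicator)
  also have "\<dots> = emeasure (measure_pmf (f a)) A * pmf q a"
    by (simp add: nn_integral_cmult_indicator emeasure_pmf_single)
  finally show ?thesis
    by (simp add: measure_pmf.emeasure_eq_measure ennreal_mult'[symmetric] mult.commute)
qed

lemma path_pmf_Cons:
  assumes "t \<notin> set ts"
  shows "measure (path_pmf s x (t # ts)) {f. map f (t # ts) = y # ys} =
    pmf (K (t - s) x) y * measure (path_pmf t y ts) {f. map f ts = ys}"
proof -
  have eq: "(\<lambda>f. f(t := z)) -` {f. map f (t # ts) = y # ys} = (if z = y then {f. map f ts = ys} else {})" for z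
    using assms by (auto simp: map_fun_upd)
  have vimage: "measure (map_pmf h q) A = measure q (h -` A)" for h :: "(real \<Rightarrow> real) \<Rightarrow> real \<Rightarrow> real" and q A
    by simp
  show ?thesis
    unfolding path_pmf.simps
    by (subst measure_bind_pmf_singleton[of y]) (simp_all only: vimage eq if_True if_False measure_empty refl)
qed

text \<open>\<open>path_pmf\<close> unfolds at the earliest time, whereas the Markov property needs
  the latest one split off; the induction runs through the history to reach it.\<close>

lemma path_pmf_snoc:
  assumes "distinct (ts @ [t, u])" "length ys = length ts"
  shows "measure (path_pmf s x (ts @ [t, u])) {f. map f (ts @ [t, u]) = ys @ [y, z]} =
    measure (path_pmf s x (ts @ [t])) {f. map f (ts @ [t]) = ys @ [y]} * pmf (K (u - t) y) z"
  using assms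
proof (induction ts arbitrary: s x ys)
  case Nil
  have 1: "measure (path_pmf s x [t, u]) {f. map f [t, u] = [y, z]} =
     pmf (K (t - s) x) y * (pmf (K (u - t) y) z * measure (path_pmf u z []) {f. map f [] = []})"
    using Nil by (subst path_pmf_Cons, simp, subst path_pmf_Cons) simp_all
  have 2: "measure (path_pmf s x [t]) {f. map f [t] = [y]} =
     pmf (K (t - s) x) y * measure (path_pmf t y []) {f. map f [] = []}"
    by (subst path_pmf_Cons) simp_all
  show ?case using Nil 1 2 by (simp del: path_pmf.simps)
next
  case (Cons a ts)
  then obtain b bs where ys: "ys = b # bs" by (cases ys) auto
  show ?case
    using Cons.IH[of bs a b] Cons.prems path_pmf_Cons[of a "ts @ [t, u]" s x b "bs @ [y, z]"]
      path_pmf_Cons[of a "ts @ [t]" s x b "bs @ [y]"]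
    by (simp add: ys del: path_pmf.simps)
qed

lemma fdd_snoc:
  assumes "distinct (ts @ [t, u])" "length ys = length ts"
  shows "measure (fdd (ts @ [t, u])) {f. map f (ts @ [t, u]) = ys @ [y, z]} =
    measure (fdd (ts @ [t])) {f. map f (ts @ [t]) = ys @ [y]} * pmf (K (u - t) y) z"
proof -
  have "emeasure (fdd (ts @ [t, u])) {f. map f (ts @ [t, u]) = ys @ [y, z]} =
    (\<integral>\<^sup>+x. emeasure (path_pmf 0 x (ts @ [t])) {f. map f (ts @ [t]) = ys @ [y]} * ennreal (pmf (K (u - t) y) z) \<partial>\<nu>)"
    unfolding fdd_def emeasure_bind_pmf
    by (intro nn_integral_cong)
       (simp only: measure_pmf.emeasure_eq_measure path_pmf_snoc[OF assms] ennreal_mult' measure_nonneg pmf_nonneg)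
  also have "\<dots> = emeasure (fdd (ts @ [t])) {f. map f (ts @ [t]) = ys @ [y]} * ennreal (pmf (K (u - t) y) z)"
    unfolding fdd_def emeasure_bind_pmf by (simp add: nn_integral_multc)
  finally show ?thesis
    by (simp add: measure_pmf.emeasure_eq_measure ennreal_mult'[symmetric] del: list.map map_append append.simps)
qed

lemma pred_map_eq:
  "set ts \<subseteq> J \<Longrightarrow> Measurable.pred (\<Pi>\<^sub>M i\<in>J. (borel :: real measure)) (\<lambda>f. map f ts = ys)"
proof (induction ts arbitrary: ys)
  case (Cons t ts)
  have [measurable]: "(\<lambda>f. f t) \<in> borel_measurable (\<Pi>\<^sub>M i\<in>J. (borel :: real measure))"
    using Cons.prems by (intro measurable_component_singleton) auto
  have [measurable]: "Measurable.pred (\<Pi>\<^sub>M i\<in>J. (borel :: real measure)) (\<lambda>f. map f ts = zs)" for zs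
    using Cons by auto
  show ?case
  proof (cases ys)
    case (Cons z zs)
    then show ?thesis by simp
  qed simp
qed simp

text \<open>The Markov property as a product formula without conditioning: the last factor sees only
  the last state and the elapsed time.\<close>

lemma lim_snoc:
  assumes ts: "sorted (ts @ [t, u])" "distinct (ts @ [t, u])" "\<forall>v\<in>set (ts @ [t, u]). 0 \<le> v"
    and len: "length ys = length ts"
  shows "measure \<L> {\<omega>\<in>space \<L>. map \<omega> (ts @ [t, u]) = ys @ [y, z]} =
    measure \<L> {\<omega>\<in>space \<L>. map \<omega> (ts @ [t]) = ys @ [y]} * pmf (K (u - t) y) z"
proof -
  have loc: "(map (restrict f (set ws)) ws = zs) = (map f ws = zs)" for f :: "real \<Rightarrow> real" and ws zs
    by (intro arg_cong2[where f = "(=)"] refl map_cong) auto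
  show ?thesis
    using assms fdd_snoc[OF ts(2) len, of y z]
      measure_lim_cylinder[of "ts @ [t, u]" "\<lambda>f. map f (ts @ [t, u]) = ys @ [y, z]", OF _ _ _ pred_map_eq loc]
      measure_lim_cylinder[of "ts @ [t]" "\<lambda>f. map f (ts @ [t]) = ys @ [y]", OF _ _ _ pred_map_eq loc]
    by (simp only: sorted_append distinct_append) auto
qed


section \<open>Changes along dyadic grids\<close>

lemma measure_bind_pmf_le:
  assumes "\<And>x. measure (measure_pmf (f x)) A \<le> c"
  shows "measure (measure_pmf (bind_pmf q f)) A \<le> c"
proof -
  have c: "0 \<le> c" by (rule order_trans[OF measure_nonneg assms])
  have "emeasure (measure_pmf (bind_pmf q f)) A \<le> (\<integral>\<^sup>+x. ennreal c \<partial>measure_pmf q)"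
    unfolding emeasure_bind_pmf
    using assms by (intro nn_integral_mono) (simp add: measure_pmf.emeasure_eq_measure ennreal_leI)
  then show ?thesis
    using c by (simp add: measure_pmf.emeasure_eq_measure)
qed

lemma C_nonneg: "0 \<le> C"
  using K_rate[of 1 0] measure_nonneg[of "measure_pmf (K 1 0)" "- {0}"] by linarith

lemma sets_change: "0 \<le> s \<Longrightarrow> 0 \<le> u \<Longrightarrow> {\<omega>\<in>space \<L>. \<omega> s \<noteq> \<omega> u} \<in> sets \<L>"
  by (intro borel_measurable_neq measurable_eval)

lemma sets_E: "E \<in> sets borel"
  by (rule sets.countable[OF _ countable_E]) simp

lemma prob_change:
  assumes "0 \<le> s" "s < u"
  shows "measure \<L> {\<omega>\<in>space \<L>. \<omega> s \<noteq> \<omega> u} \<le> C * (u - s)"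
proof -
  have "Measurable.pred (\<Pi>\<^sub>M i\<in>set [s, u]. (borel :: real measure)) (\<lambda>f. f s \<noteq> f u)"
    unfolding pred_def by (intro borel_measurable_neq measurable_component_singleton) auto
  then have "measure \<L> {\<omega>\<in>space \<L>. \<omega> s \<noteq> \<omega> u} = measure (fdd [s, u]) {f. f s \<noteq> f u}"
    using assms by (intro measure_lim_cylinder) auto
  also have "\<dots> \<le> C * (u - s)"
    unfolding fdd_def
  proof (rule measure_bind_pmf_le)
    fix x
    have vimage: "(\<lambda>f. f(s := y)) -` {f. f s \<noteq> f u} = {f. f u \<noteq> y}" for y
      using assms by auto
    have "measure (path_pmf s y [u]) {f. f u \<noteq> y} = measure (K (u - s) y) (- {y})" for y
    proof -
      have "path_pmf s y [u] = map_pmf (\<lambda>z. (\<lambda>_. undefined)(u := z)) (K (u - s) y)"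
        by (simp add: map_pmf_def bind_return_pmf)
      then have "measure (path_pmf s y [u]) {f. f u \<noteq> y} =
        measure (K (u - s) y) ((\<lambda>z. (\<lambda>_. undefined)(u := z)) -` {f. f u \<noteq> y})"
        by (simp only: measure_map_pmf)
      also have "(\<lambda>z. (\<lambda>_. undefined)(u := z)) -` {f. f u \<noteq> y} = - {y}"
        by auto
      finally show ?thesis .
    qed
    then have "measure (map_pmf (\<lambda>f. f(s := y)) (path_pmf s y [u])) {f. f s \<noteq> f u} = measure (K (u - s) y) (- {y})" for y
      by (simp only: measure_map_pmf vimage)
    then show "measure (path_pmf 0 x [s, u]) {f. f s \<noteq> f u} \<le> C * (u - s)"
      using assms K_rate[of "u - s"] unfolding path_pmf.simps(2)[of 0 x s]
      by (intro measure_bind_pmf_le) (simp del: path_pmf.simps)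
  qed
  finally show ?thesis .
qed

lemma AE_in_E: "0 \<le> t \<Longrightarrow> AE \<omega> in \<L>. \<omega> t \<in> E"
proof -
  assume t: "0 \<le> t"
  have "(\<lambda>f. f t) \<in> borel_measurable (\<Pi>\<^sub>M i\<in>set [t]. (borel :: real measure))"
    by (intro measurable_component_singleton) auto
  then have "Measurable.pred (\<Pi>\<^sub>M i\<in>set [t]. (borel :: real measure)) (\<lambda>f. f t \<in> E)"
    by (rule pred_sets2[OF sets_E])
  then have "measure \<L> {\<omega>\<in>space \<L>. \<omega> t \<in> E} = measure (fdd [t]) {f. f t \<in> E}"
    using t by (intro measure_lim_cylinder) auto
  also have "\<dots> = 1"
    using K_closed[OF t] init
    by (intro measure_pmf.prob_eq_1[THEN iffD2] AE_pmfI) (simp, fastforce simp: fdd_def)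
  finally show ?thesis
    using pred_sets2[OF sets_E measurable_eval[OF t]]
    by (subst (asm) kol.P.prob_Collect_eq_1) (simp_all add: pred_def)
qed

definition changes :: "(real \<Rightarrow> real) \<Rightarrow> nat \<Rightarrow> nat \<Rightarrow> nat" where
  "changes \<omega> N n = card {k\<in>{..<N * 2 ^ n}. \<omega> (real k / 2 ^ n) \<noteq> \<omega> (real (Suc k) / 2 ^ n)}"

lemma changes_eq_sum:
  "ennreal (real (changes \<omega> N n)) =
    (\<Sum>k<N * 2 ^ n. indicator {\<omega>. \<omega> (real k / 2 ^ n) \<noteq> \<omega> (real (Suc k) / 2 ^ n)} \<omega>)"
proof -
  have "(\<Sum>k<N * 2 ^ n. indicator {\<omega>. \<omega> (real k / 2 ^ n) \<noteq> \<omega> (real (Suc k) / 2 ^ n)} \<omega>) =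
    (\<Sum>k\<in>{k\<in>{..<N * 2 ^ n}. \<omega> (real k / 2 ^ n) \<noteq> \<omega> (real (Suc k) / 2 ^ n)}. (1::ennreal))"
    by (intro sum.mono_neutral_cong_right) (auto simp: indicator_def)
  then show ?thesis
    by (simp add: changes_def ennreal_of_nat_eq_real_of_nat)
qed

lemma measurable_changes [measurable]:
  "(\<lambda>\<omega>. ennreal (real (changes \<omega> N n))) \<in> borel_measurable \<L>"
proof -
  have "(\<lambda>\<omega>. indicator {\<omega>. \<omega> (real k / 2 ^ n) \<noteq> \<omega> (real (Suc k) / 2 ^ n)} \<omega> :: ennreal) \<in> borel_measurable \<L>" for k
    by (rule borel_measurable_indicator') (use sets_change[of "real k / 2 ^ n" "real (Suc k) / 2 ^ n"] in simp)
  then show ?thesis unfolding changes_eq_sum by measurable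
qed

text \<open>There are N * 2 ^ n steps and each is a change with probability at most C / 2 ^ n, so
  the mesh cancels.\<close>

lemma expected_changes: "(\<integral>\<^sup>+\<omega>. ennreal (real (changes \<omega> N n)) \<partial>\<L>) \<le> ennreal (C * N)"
proof -
  let ?A = "\<lambda>k. {\<omega>\<in>space \<L>. \<omega> (real k / 2 ^ n) \<noteq> \<omega> (real (Suc k) / 2 ^ n)}"
  have meas: "?A k \<in> sets \<L>" for k
    by (rule sets_change) auto
  have "(\<integral>\<^sup>+\<omega>. ennreal (real (changes \<omega> N n)) \<partial>\<L>) =
    (\<integral>\<^sup>+\<omega>. (\<Sum>k<N * 2 ^ n. indicator (?A k) \<omega>) \<partial>\<L>)"
    unfolding changes_eq_sum by (intro nn_integral_cong sum.cong) (auto simp: indicator_def)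
  also have "\<dots> = (\<Sum>k<N * 2 ^ n. emeasure \<L> (?A k))"
    by (subst nn_integral_sum) (rule borel_measurable_indicator[OF meas], simp only: nn_integral_indicator[OF meas])
  also have "\<dots> \<le> (\<Sum>k<N * 2 ^ n. ennreal (C / 2 ^ n))"
  proof (rule sum_mono)
    fix k
    have "real k / 2 ^ n < real (Suc k) / 2 ^ n"
      by (simp add: divide_strict_right_mono)
    then have "measure \<L> (?A k) \<le> C * (real (Suc k) / 2 ^ n - real k / 2 ^ n)"
      by (intro prob_change) auto
    also have "\<dots> = C / 2 ^ n"
      by (simp add: field_simps)
    finally show "emeasure \<L> (?A k) \<le> ennreal (C / 2 ^ n)"
      by (simp add: kol.P.emeasure_eq_measure ennreal_leI)
  qed
  also have "\<dots> = ennreal (C * N)"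
    using C_nonneg by (simp add: ennreal_of_nat_eq_real_of_nat ennreal_mult'[symmetric])
  finally show ?thesis .
qed

text \<open>Fatou's lemma. A finite liminf is enough, because oscillation makes the counts large on
  every sufficiently fine grid (\<open>many_changes\<close>).\<close>

lemma AE_finite_changes: "AE \<omega> in \<L>. liminf (\<lambda>n. ennreal (real (changes \<omega> N n))) < \<infinity>"
proof -
  have "(\<integral>\<^sup>+\<omega>. liminf (\<lambda>n. ennreal (real (changes \<omega> N n))) \<partial>\<L>) \<le>
    liminf (\<lambda>n. \<integral>\<^sup>+\<omega>. ennreal (real (changes \<omega> N n)) \<partial>\<L>)"
    by (intro nn_integral_liminf) measurable
  also have "\<dots> \<le> liminf (\<lambda>n. ennreal (C * N))"
    by (intro Liminf_mono always_eventually allI expected_changes)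
  also have "\<dots> < \<infinity>"
    by (simp add: Liminf_const)
  finally have "AE \<omega> in \<L>. liminf (\<lambda>n. ennreal (real (changes \<omega> N n))) \<noteq> \<infinity>"
    by (intro nn_integral_PInf_AE) (simp_all add: less_top)
  then show ?thesis
    by (simp add: less_top)
qed

section \<open>Right limits along dyadic times and the version they define\<close>

definition dyadic :: "real set" where
  "dyadic = {real k / 2 ^ n | k n. True}"

lemma dyadic_refine:
  assumes "d \<in> dyadic"
  shows "\<exists>n0. \<forall>n\<ge>n0. \<exists>k. d = real k / 2 ^ n"
proof -
  obtain a p where d: "d = real a / 2 ^ p" using assms by (auto simp: dyadic_def)
  have "d = real (a * 2 ^ (n - p)) / 2 ^ n" if "p \<le> n" for n
  proof -
    have "(2::real) ^ n = 2 ^ p * 2 ^ (n - p)" using that by (simp flip: power_add)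
    then show ?thesis by (simp add: d)
  qed
  then show ?thesis by blast
qed

text \<open>Induction towards t: a pair d < d' with different values yields a change between them as
  soon as the grid contains both, and the induction hypothesis finds m more changes between t and
  d.\<close>

lemma many_changes:
  assumes osc: "\<And>\<epsilon>. 0 < \<epsilon> \<Longrightarrow> \<exists>d\<in>dyadic. \<exists>d'\<in>dyadic. t < d \<and> d < d' \<and> d' < t + \<epsilon> \<and> \<omega> d \<noteq> \<omega> d'"
    and "0 < \<epsilon>"
  shows "\<exists>n0. \<forall>n\<ge>n0. m \<le> card {k. t < real k / 2 ^ n \<and> real (Suc k) / 2 ^ n < t + \<epsilon> \<and>
    \<omega> (real k / 2 ^ n) \<noteq> \<omega> (real (Suc k) / 2 ^ n)}"
  using \<open>0 < \<epsilon>\<close>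
proof (induction m arbitrary: \<epsilon>)
  case (Suc m)
  let ?S = "\<lambda>n \<epsilon>. {k. t < real k / 2 ^ n \<and> real (Suc k) / 2 ^ n < t + \<epsilon> \<and>
    \<omega> (real k / 2 ^ n) \<noteq> \<omega> (real (Suc k) / 2 ^ n)}"
  obtain d d' where d: "d \<in> dyadic" "d' \<in> dyadic" "t < d" "d < d'" "d' < t + \<epsilon>" "\<omega> d \<noteq> \<omega> d'"
    using osc[OF \<open>0 < \<epsilon>\<close>] by blast
  obtain n1 where n1: "\<And>n. n1 \<le> n \<Longrightarrow> \<exists>k. d = real k / 2 ^ n"
    using dyadic_refine[OF d(1)] by blast
  obtain n2 where n2: "\<And>n. n2 \<le> n \<Longrightarrow> \<exists>k. d' = real k / 2 ^ n"
    using dyadic_refine[OF d(2)] by blast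
  obtain n3 where n3: "\<And>n. n3 \<le> n \<Longrightarrow> m \<le> card (?S n (d - t))"
    using Suc.IH[of "d - t"] d by auto
  have "Suc m \<le> card (?S n \<epsilon>)" if n: "max n1 (max n2 n3) \<le> n" for n
  proof -
    obtain a where a: "d = real a / 2 ^ n" using n1[of n] n by auto
    obtain a' where a': "d' = real a' / 2 ^ n" using n2[of n] n by auto
    have "a \<le> a'" using d a a' by (simp add: divide_less_cancel)
    have "\<exists>k. a \<le> k \<and> k < a' \<and> \<omega> (real k / 2 ^ n) \<noteq> \<omega> (real (Suc k) / 2 ^ n)"
    proof (rule ccontr)
      assume "\<not> ?thesis"
      then have *: "\<omega> (real k / 2 ^ n) = \<omega> (real (Suc k) / 2 ^ n)" if "a \<le> k" "k < a'" for k
        using that by blast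
      have "\<omega> (real a / 2 ^ n) = \<omega> (real a' / 2 ^ n)"
        using \<open>a \<le> a'\<close> by (rule dec_induct) (auto simp: *)
      then show False using d a a' by simp
    qed
    then obtain k where k: "a \<le> k" "k < a'" "\<omega> (real k / 2 ^ n) \<noteq> \<omega> (real (Suc k) / 2 ^ n)"
      by blast
    have dk: "d \<le> real k / 2 ^ n" "real (Suc k) / 2 ^ n \<le> d'"
      using k by (auto simp: a a' intro!: divide_right_mono)
    have fin: "finite (?S n \<delta>)" for \<delta>
    proof (rule finite_subset)
      show "?S n \<delta> \<subseteq> {..nat \<lceil>(t + \<delta>) * 2 ^ n\<rceil>}"
        by (auto simp: field_simps) linarith
    qed simp
    \<comment> \<open>The change at k starts at d or later, while the m others end before d, so it
      is a new one.\<close>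
    have "insert k (?S n (d - t)) \<subseteq> ?S n \<epsilon>"
      using d dk k by auto
    moreover have "k \<notin> ?S n (d - t)"
    proof -
      have "real k / 2 ^ n < real (Suc k) / 2 ^ n" by (simp add: divide_strict_right_mono)
      then show ?thesis using dk by auto
    qed
    ultimately have "Suc (card (?S n (d - t))) \<le> card (?S n \<epsilon>)"
      using card_mono[OF fin, of "insert k (?S n (d - t))" \<epsilon>] fin[of "d - t"] by simp
    then show ?thesis using n3[of n] n by auto
  qed
  then show ?case by blast
qed simp

text \<open>The second condition keeps the right limits inside E.\<close>

definition good :: "(real \<Rightarrow> real) set" where
  "good = {\<omega>\<in>space \<L>. (\<forall>N. liminf (\<lambda>n. ennreal (real (changes \<omega> N n))) < \<infinity>) \<and> (\<forall>n k. \<omega> (real k / 2 ^ n) \<in> E)}"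

text \<open>The first grid point after t. The \<open>+ 1\<close> keeps it strictly after t when t is
  itself a grid point, as a right limit requires.\<close>

definition approx_time :: "real \<Rightarrow> nat \<Rightarrow> real" where
  "approx_time t n = real (nat (\<lfloor>t * 2 ^ n\<rfloor> + 1)) / 2 ^ n"

lemma approx_time_bounds:
  assumes "0 \<le> t"
  shows "t < approx_time t n" "approx_time t n \<le> t + 1 / 2 ^ n" "approx_time t n \<in> dyadic"
proof -
  have eq: "real (nat (\<lfloor>t * 2 ^ n\<rfloor> + 1)) = of_int \<lfloor>t * 2 ^ n\<rfloor> + 1"
    using assms by simp
  show "t < approx_time t n" "approx_time t n \<le> t + 1 / 2 ^ n"
    unfolding approx_time_def eq by (simp_all add: field_simps) linarith+
  show "approx_time t n \<in> dyadic"
    unfolding approx_time_def dyadic_def by blast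
qed

lemma approx_time_eventually:
  assumes "0 \<le> t" "0 < \<epsilon>"
  shows "\<forall>\<^sub>F n in sequentially. approx_time t n < t + \<epsilon>"
proof -
  have "(\<lambda>n. 1 / 2 ^ n :: real) \<longlonglongrightarrow> 0"
    by (simp add: LIMSEQ_divide_realpow_zero)
  then have "\<forall>\<^sub>F n in sequentially. 1 / 2 ^ n < \<epsilon>"
    using assms by (simp add: order_tendsto_iff)
  then show ?thesis
    by eventually_elim (use approx_time_bounds(2)[OF assms(1)] in \<open>smt (verit)\<close>)
qed

text \<open>Otherwise the values oscillate arbitrarily close to t on its right, and
  \<open>many_changes\<close> drives the counts on [0, N] with N \<ge> t + 1 to infinity.\<close>

lemma good_right_constant:
  assumes "\<omega> \<in> good" "0 \<le> t"
  shows "\<exists>\<epsilon>>0. \<exists>y. \<forall>d\<in>dyadic. t < d \<and> d < t + \<epsilon> \<longrightarrow> \<omega> d = y"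
proof (rule ccontr)
  assume neg: "\<not> ?thesis"
  have osc: "\<exists>d\<in>dyadic. \<exists>d'\<in>dyadic. t < d \<and> d < d' \<and> d' < t + \<epsilon> \<and> \<omega> d \<noteq> \<omega> d'" if "0 < \<epsilon>" for \<epsilon>
  proof -
    obtain n where n: "approx_time t n < t + \<epsilon>"
      using approx_time_eventually[OF assms(2) \<open>0 < \<epsilon>\<close>] eventually_happens'[OF sequentially_bot] by blast
    define d where "d = approx_time t n"
    have d: "t < d" "d < t + \<epsilon>" "d \<in> dyadic"
      using approx_time_bounds[OF assms(2), of n] n by (auto simp: d_def)
    obtain d' where "d' \<in> dyadic" "t < d'" "d' < t + \<epsilon>" "\<omega> d' \<noteq> \<omega> d"
      using neg \<open>0 < \<epsilon>\<close> by blast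
    with d show ?thesis by (cases d d' rule: linorder_cases) force+
  qed
  define N where "N = nat \<lceil>t + 1\<rceil>"
  have "ennreal (real m) \<le> liminf (\<lambda>n. ennreal (real (changes \<omega> N n)))" for m
  proof -
    obtain n0 where n0: "\<And>n. n0 \<le> n \<Longrightarrow> m \<le> card {k. t < real k / 2 ^ n \<and> real (Suc k) / 2 ^ n < t + 1 \<and>
        \<omega> (real k / 2 ^ n) \<noteq> \<omega> (real (Suc k) / 2 ^ n)}"
      using many_changes[of t \<omega> 1 m, OF osc] by auto
    have "m \<le> changes \<omega> N n" if "n0 \<le> n" for n
    proof -
      have "card {k. t < real k / 2 ^ n \<and> real (Suc k) / 2 ^ n < t + 1 \<and>
        \<omega> (real k / 2 ^ n) \<noteq> \<omega> (real (Suc k) / 2 ^ n)} \<le> changes \<omega> N n"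
        unfolding changes_def
      proof (rule card_mono)
        have "k < N * 2 ^ n" if "real (Suc k) / 2 ^ n < t + 1" for k
        proof -
          have "real (Suc k) < (t + 1) * 2 ^ n" using that by (simp add: field_simps)
          also have "\<dots> \<le> real N * 2 ^ n"
            unfolding N_def by (intro mult_right_mono real_nat_ceiling_ge) simp
          finally have "real k < real (N * 2 ^ n)" by simp
          then show ?thesis by (simp only: of_nat_less_iff)
        qed
        then show "{k. t < real k / 2 ^ n \<and> real (Suc k) / 2 ^ n < t + 1 \<and>
          \<omega> (real k / 2 ^ n) \<noteq> \<omega> (real (Suc k) / 2 ^ n)} \<subseteq>
          {k \<in> {..<N * 2 ^ n}. \<omega> (real k / 2 ^ n) \<noteq> \<omega> (real (Suc k) / 2 ^ n)}"
          by auto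
      qed simp
      with n0[OF that] show ?thesis by linarith
    qed
    then show ?thesis
      by (intro Liminf_bounded) (auto simp: eventually_sequentially intro!: exI[of _ n0] ennreal_leI)
  qed
  moreover have "liminf (\<lambda>n. ennreal (real (changes \<omega> N n))) < \<infinity>"
    using assms by (auto simp: good_def)
  then obtain r where "0 \<le> r" "liminf (\<lambda>n. ennreal (real (changes \<omega> N n))) = ennreal r"
    by (cases "liminf (\<lambda>n. ennreal (real (changes \<omega> N n)))") auto
  ultimately have "real m \<le> r" for m
    by (metis ennreal_le_iff)
  then show False
    using reals_Archimedean2[of r] by (metis linorder_not_less)
qed

text \<open>\<open>markov_chain\<close> asks for right-continuity of every path. On the null set
  where \<open>good\<close> fails the version is therefore frozen at an arbitrary state of
  E.\<close>

definition version :: "real \<Rightarrow> (real \<Rightarrow> real) \<Rightarrow> real" where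
  "version t \<omega> = (if \<omega> \<in> good then (THE y. \<forall>\<^sub>F n in sequentially. \<omega> (approx_time t n) = y) else (SOME x. x \<in> E))"

lemma version_eqI:
  assumes "\<omega> \<in> good" "\<forall>\<^sub>F n in sequentially. \<omega> (approx_time t n) = y"
  shows "version t \<omega> = y"
proof -
  have "y' = y" if "\<forall>\<^sub>F n in sequentially. \<omega> (approx_time t n) = y'" for y'
    using eventually_conj[OF assms(2) that] eventually_happens'[OF sequentially_bot] by force
  with assms(2) have "(THE y. \<forall>\<^sub>F n in sequentially. \<omega> (approx_time t n) = y) = y"
    by (rule the_equality)
  with assms(1) show ?thesis by (simp add: version_def)
qed

lemma version_right_limit:
  assumes "\<omega> \<in> good" "0 \<le> t"
  obtains \<epsilon> where "0 < \<epsilon>" "\<And>d. d \<in> dyadic \<Longrightarrow> t < d \<Longrightarrow> d < t + \<epsilon> \<Longrightarrow> \<omega> d = version t \<omega>"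
proof -
  obtain \<epsilon> y where y: "0 < \<epsilon>" "\<forall>d\<in>dyadic. t < d \<and> d < t + \<epsilon> \<longrightarrow> \<omega> d = y"
    using good_right_constant[OF assms] by blast
  have "\<forall>\<^sub>F n in sequentially. \<omega> (approx_time t n) = y"
    using approx_time_eventually[OF assms(2) y(1)]
  proof eventually_elim
    case (elim n)
    with approx_time_bounds(1,3)[OF assms(2), of n] y(2) show ?case by blast
  qed
  then have "version t \<omega> = y" using assms by (intro version_eqI)
  with y that show ?thesis by blast
qed

lemma version_eventually:
  assumes "\<omega> \<in> good" "0 \<le> t"
  shows "\<forall>\<^sub>F n in sequentially. \<omega> (approx_time t n) = version t \<omega>"
proof -
  obtain \<epsilon> where e: "0 < \<epsilon>" "\<And>d. d \<in> dyadic \<Longrightarrow> t < d \<Longrightarrow> d < t + \<epsilon> \<Longrightarrow> \<omega> d = version t \<omega>"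
    using version_right_limit[OF assms] by blast
  show ?thesis
    using approx_time_eventually[OF assms(2) e(1)]
  proof eventually_elim
    case (elim n)
    with approx_time_bounds(1,3)[OF assms(2), of n] show ?case by (intro e(2))
  qed
qed

text \<open>One window of constancy after t serves every s in it, since
  \<open>approx_time s n\<close> eventually lies in that window too.\<close>

lemma version_right_continuous:
  assumes "0 \<le> t"
  shows "\<exists>\<epsilon>>0. \<forall>s\<in>{t..<t + \<epsilon>}. version s \<omega> = version t \<omega>"
proof (cases "\<omega> \<in> good")
  case True
  obtain \<epsilon> where e: "0 < \<epsilon>" "\<And>d. d \<in> dyadic \<Longrightarrow> t < d \<Longrightarrow> d < t + \<epsilon> \<Longrightarrow> \<omega> d = version t \<omega>"
    using version_right_limit[OF True assms] by blast
  have "version s \<omega> = version t \<omega>" if s: "s \<in> {t..<t + \<epsilon>}" for s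
  proof -
    have "0 \<le> s" "0 < t + \<epsilon> - s" using s assms by auto
    from approx_time_eventually[OF this]
    have "\<forall>\<^sub>F n in sequentially. \<omega> (approx_time s n) = version t \<omega>"
    proof eventually_elim
      case (elim n)
      with approx_time_bounds(1,3)[OF \<open>0 \<le> s\<close>, of n] s show ?case
        by (intro e(2)) auto
    qed
    then show ?thesis using True by (intro version_eqI)
  qed
  then show ?thesis using e by blast
next
  case False
  then show ?thesis by (auto simp: version_def intro: exI[of _ 1])
qed

lemma version_in_E: "0 \<le> t \<Longrightarrow> version t \<omega> \<in> E"
proof (cases "\<omega> \<in> good")
  case True
  assume t: "0 \<le> t"
  obtain n where "\<omega> (approx_time t n) = version t \<omega>"
    using version_eventually[OF True t] eventually_happens'[OF sequentially_bot] by blast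
  moreover have "\<omega> (approx_time t n) \<in> E"
    using True unfolding good_def approx_time_def by blast
  ultimately show ?thesis by simp
next
  case False
  have "E \<noteq> {}" using init set_pmf_not_empty by metis
  then show ?thesis using False by (auto simp: version_def some_in_eq)
qed

lemma sets_good: "good \<in> sets \<L>"
proof -
  define A where "A N = {\<omega>\<in>space \<L>. liminf (\<lambda>n. ennreal (real (changes \<omega> N n))) < \<infinity>}" for N
  define B where "B n k = {\<omega>\<in>space \<L>. \<omega> (real k / 2 ^ n) \<in> E}" for n k :: nat
  have A: "A N \<in> sets \<L>" for N
    unfolding A_def
    by (rule borel_measurable_less, rule borel_measurable_liminf, rule measurable_changes, rule borel_measurable_const)
  have B: "B n k \<in> sets \<L>" for n k
    using pred_sets2[OF sets_E measurable_eval[of "real k / 2 ^ n"]] by (simp add: B_def pred_def)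
  have "good = (\<Inter>N. A N) \<inter> (\<Inter>n. \<Inter>k. B n k)"
    unfolding good_def A_def B_def by blast
  also have "\<dots> \<in> sets \<L>"
    using A B by (intro sets.Int sets.countable_INT') (simp_all only: image_subset_iff sets.countable_INT' countableI_type UNIV_not_empty simp_thms ball_UNIV)
  finally show ?thesis .
qed

lemma AE_good: "AE \<omega> in \<L>. \<omega> \<in> good"
proof -
  have 1: "AE \<omega> in \<L>. \<forall>N. liminf (\<lambda>n. ennreal (real (changes \<omega> N n))) < \<infinity>"
    unfolding AE_all_countable using AE_finite_changes by blast
  have 2: "AE \<omega> in \<L>. \<forall>n k. \<omega> (real k / 2 ^ n) \<in> E"
    unfolding AE_all_countable by (intro allI AE_in_E) simp
  from AE_space 1 2 show ?thesis
    by eventually_elim (simp add: good_def)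
qed


text \<open>Borel-Cantelli: a change between t and \<open>approx_time t n\<close> has probability at
  most C / 2 ^ n, which is summable.\<close>

lemma AE_version: "0 \<le> t \<Longrightarrow> AE \<omega> in \<L>. version t \<omega> = \<omega> t"
proof -
  assume t: "0 \<le> t"
  let ?A = "\<lambda>n. {\<omega>\<in>space \<L>. \<omega> t \<noteq> \<omega> (approx_time t n)}"
  have meas: "?A n \<in> sets \<L>" for n
    using t approx_time_bounds(1)[OF t, of n] by (intro sets_change) auto
  have bound: "measure \<L> (?A n) \<le> C * (1 / 2) ^ n" for n
  proof -
    have "measure \<L> (?A n) \<le> C * (approx_time t n - t)"
      using t approx_time_bounds(1)[OF t, of n] by (intro prob_change)
    also have "\<dots> \<le> C * (1 / 2 ^ n)"
      using approx_time_bounds(2)[OF t, of n] C_nonneg by (intro mult_left_mono) auto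
    finally show ?thesis by (simp add: power_one_over)
  qed
  have geom: "summable (\<lambda>n. C * (1 / 2) ^ n)"
    by (intro summable_mult summable_geometric) simp
  have "summable (\<lambda>n. measure \<L> (?A n))"
    by (rule summable_comparison_test'[OF geom, of 0])
       (simp only: real_norm_def abs_of_nonneg[OF measure_nonneg] bound)
  then have "AE \<omega> in \<L>. \<forall>\<^sub>F n in sequentially. \<omega> \<in> space \<L> - ?A n"
    using meas by (intro borel_cantelli_AE1) (simp_all only: kol.P.emeasure_eq_measure ennreal_less_top infinity_ennreal_def)
  with AE_good show ?thesis
  proof eventually_elim
    case (elim \<omega>)
    from elim(2) have "\<forall>\<^sub>F n in sequentially. \<omega> (approx_time t n) = \<omega> t"
      by (rule eventually_mono) simp
    with elim(1) show ?case by (rule version_eqI)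
  qed
qed

lemma measurable_version [measurable]: "0 \<le> t \<Longrightarrow> version t \<in> measurable \<L> (count_space E)"
proof (subst measurable_count_space_eq_countable[OF countable_E], intro conjI ballI)
  assume t: "0 \<le> t"
  then show "version t \<in> space \<L> \<rightarrow> E" using version_in_E by auto
  fix y
  define A where "A n = {\<omega>\<in>space \<L>. \<omega> (approx_time t n) = y}" for n
  have A: "A n \<in> sets \<L>" for n
    using t approx_time_bounds(1)[OF t, of n]
    unfolding A_def by (intro borel_measurable_eq measurable_eval borel_measurable_const) auto
  have iff: "version t \<omega> = y \<longleftrightarrow> (if \<omega> \<in> good then (\<forall>\<^sub>F n in sequentially. \<omega> (approx_time t n) = y) else (SOME x. x \<in> E) = y)" for \<omega>
  proof (cases "\<omega> \<in> good")
    case True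
    show ?thesis
      unfolding if_P[OF True]
      using version_eventually[OF True t] version_eqI[OF True, of t y] by blast
  qed (simp add: version_def)
  \<comment> \<open>Values are discrete, so convergence means eventual equality, and the level set
    is a lower limit of the sets \<open>A n\<close>.\<close>
  have "version t -` {y} \<inter> space \<L> =
    (good \<inter> (\<Union>N. \<Inter>n\<in>{N..}. A n)) \<union> ((if (SOME x. x \<in> E) = y then space \<L> else {}) - good)"
  proof (intro set_eqI)
    fix \<omega>
    have "\<omega> \<in> (\<Union>N. \<Inter>n\<in>{N..}. A n) \<longleftrightarrow>
        \<omega> \<in> space \<L> \<and> (\<forall>\<^sub>F n in sequentially. \<omega> (approx_time t n) = y)"
      unfolding A_def eventually_sequentially by fastforce
    then show "\<omega> \<in> version t -` {y} \<inter> space \<L> \<longleftrightarrow>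
        \<omega> \<in> (good \<inter> (\<Union>N. \<Inter>n\<in>{N..}. A n)) \<union> ((if (SOME x. x \<in> E) = y then space \<L> else {}) - good)"
      using iff[of \<omega>] by (cases "\<omega> \<in> good") auto
  qed
  also have "\<dots> \<in> sets \<L>"
    using A by (intro sets.Un sets.Int sets_good sets.Diff sets.countable_UN' sets.countable_INT') auto
  finally show "version t -` {y} \<inter> space \<L> \<in> sets \<L>" .
qed


lemma initial_prob: "measure \<L> {\<omega>\<in>space \<L>. map \<omega> [0] = [x]} = pmf \<nu> x"
proof -
  have loc: "(map (restrict f (set [0])) [0] = [x]) = (map f [0] = [x])" for f :: "real \<Rightarrow> real"
    by simp
  have step: "measure (path_pmf 0 y [0]) {f. map f [0] = [x]} = pmf (return_pmf y) x" for y
    by (subst path_pmf_Cons) (simp_all add: K_zero)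
  have "measure \<L> {\<omega>\<in>space \<L>. map \<omega> [0] = [x]} = measure (fdd [0]) {f. map f [0] = [x]}"
    by (rule measure_lim_cylinder[OF _ _ _ pred_map_eq loc]) simp_all
  also have "\<dots> = pmf \<nu> x"
    unfolding fdd_def
    by (subst measure_bind_pmf_singleton[of x]) (simp_all only: step pmf_return, simp_all)
  finally show ?thesis .
qed

section \<open>The law on the space of right-continuous paths\<close>

context
  fixes e :: "real \<Rightarrow> 's"
  assumes inj: "inj_on e E"
begin

definition paths :: "(real \<Rightarrow> 's) set" where
  "paths = {f. range f \<subseteq> e ` E \<and> (\<forall>t\<ge>0. \<exists>\<epsilon>>0. \<forall>s\<in>{t..<t + \<epsilon>}. f s = f t)}"

text \<open>Paths are indexed by all reals; before time 0 they rest at the initial state.\<close>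

definition path_of :: "(real \<Rightarrow> real) \<Rightarrow> real \<Rightarrow> 's" where
  "path_of \<omega> t = e (version (max 0 t) \<omega>)"

text \<open>In general \<open>paths\<close> is not measurable in the uncountable product, hence the
  trace sigma-algebra. Removing the other functions makes the coordinate process right-continuous at
  every sample point.\<close>

definition path_law :: "(real \<Rightarrow> 's) measure" where
  "path_law = distr \<L> (restrict_space (\<Pi>\<^sub>M t\<in>UNIV. count_space (e ` E)) paths) path_of"

lemma path_of_in_paths: "path_of \<omega> \<in> paths"
proof -
  have "\<exists>\<epsilon>>0. \<forall>s\<in>{t..<t + \<epsilon>}. path_of \<omega> s = path_of \<omega> t" if "0 \<le> t" for t
  proof -
    obtain \<epsilon> where e: "0 < \<epsilon>" "\<forall>s\<in>{t..<t + \<epsilon>}. version s \<omega> = version t \<omega>"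
      using version_right_continuous[OF \<open>0 \<le> t\<close>] by blast
    have "path_of \<omega> s = path_of \<omega> t" if "s \<in> {t..<t + \<epsilon>}" for s
    proof -
      have "max 0 s = s" "max 0 t = t" using that \<open>0 \<le> t\<close> by auto
      moreover have "version s \<omega> = version t \<omega>" using that e(2) by blast
      ultimately show ?thesis by (simp only: path_of_def)
    qed
    then show ?thesis using e(1) by blast
  qed
  moreover have "path_of \<omega> t \<in> e ` E" for t
    unfolding path_of_def by (intro imageI version_in_E) simp
  ultimately show ?thesis unfolding paths_def by blast
qed

lemma measurable_path_of:
  "path_of \<in> measurable \<L> (restrict_space (\<Pi>\<^sub>M t\<in>UNIV. count_space (e ` E)) paths)"
proof (intro measurable_restrict_space2 measurable_PiM_single')
  show "path_of \<in> space \<L> \<rightarrow> paths" using path_of_in_paths by blast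
  show "(\<lambda>\<omega>. path_of \<omega> t) \<in> measurable \<L> (count_space (e ` E))" for t
    unfolding path_of_def
    by (rule measurable_compose[OF measurable_version, of "max 0 t" e]) simp_all
  show "(\<lambda>\<omega> t. path_of \<omega> t) \<in> space \<L> \<rightarrow> (\<Pi>\<^sub>E t\<in>UNIV. space (count_space (e ` E)))"
    using path_of_in_paths unfolding paths_def by fastforce
qed

lemma space_path_law: "space path_law = paths"
  by (auto simp: path_law_def space_restrict_space space_PiM paths_def)

lemma measurable_path_law_eval [measurable]: "(\<lambda>f. f t) \<in> measurable path_law (count_space (e ` E))"
  unfolding path_law_def measurable_distr_eq1
  by (rule measurable_restrict_space1, rule measurable_component_singleton) simp

lemma prob_space_path_law: "prob_space path_law"
  unfolding path_law_def by (rule kol.P.prob_space_distr[OF measurable_path_of])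

lemma sets_path_law_map: "{f\<in>space path_law. map f ts = zs} \<in> sets path_law"
proof (induction ts arbitrary: zs)
  case Nil
  then show ?case by (cases zs) auto
next
  case (Cons t ts)
  show ?case
  proof (cases zs)
    case (Cons w ws)
    have "{f\<in>space path_law. map f (t # ts) = zs} =
      {f\<in>space path_law. map f ts = ws} \<inter> ((\<lambda>f. f t) -` ({w} \<inter> e ` E) \<inter> space path_law)"
      unfolding Cons by (auto simp: space_path_law paths_def image_subset_iff)
    then show ?thesis
      using Cons.IH[of ws] measurable_sets[OF measurable_path_law_eval[of t], of "{w} \<inter> e ` E"]
      by simp
  qed simp
qed

text \<open>Injectivity of e turns conditions on states into conditions on codes, and
  \<open>AE_version\<close> replaces the version by the original process at finitely many
  times.\<close>

lemma path_law_cylinder: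
  assumes "\<forall>t\<in>set ts. 0 \<le> t" "set ys \<subseteq> E"
  shows "measure path_law {f\<in>space path_law. map f ts = map e ys} =
    measure \<L> {\<omega>\<in>space \<L>. map \<omega> ts = ys}"
proof -
  let ?N = "restrict_space (\<Pi>\<^sub>M t\<in>UNIV. count_space (e ` E)) paths"
  have sets: "{f\<in>space path_law. map f ts = map e ys} \<in> sets ?N"
    using sets_path_law_map[of ts "map e ys"] by (simp add: path_law_def)
  have iff: "map (path_of \<omega>) ts = map e ys \<longleftrightarrow> map (\<lambda>t. version t \<omega>) ts = ys" for \<omega>
  proof -
    have "map (path_of \<omega>) ts = map e (map (\<lambda>t. version t \<omega>) ts)"
      using assms(1) by (auto simp: path_of_def max_absorb2)
    moreover have "set (map (\<lambda>t. version t \<omega>) ts) \<subseteq> E"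
      using assms(1) version_in_E by auto
    ultimately show ?thesis
      using inj_on_map_eq_map[of e "map (\<lambda>t. version t \<omega>) ts" ys] inj_on_subset[OF inj] assms(2)
      by (metis Un_subset_iff)
  qed
  have "measure path_law {f\<in>space path_law. map f ts = map e ys} =
    measure \<L> {\<omega>\<in>space \<L>. map (\<lambda>t. version t \<omega>) ts = ys}"
    unfolding path_law_def
    by (subst measure_distr[OF measurable_path_of sets[unfolded path_law_def]])
       (intro arg_cong[where f = "measure \<L>"], use path_of_in_paths in \<open>auto simp: iff space_restrict_space space_PiM paths_def\<close>)
  also have "\<dots> = measure \<L> {\<omega>\<in>space \<L>. map \<omega> ts = ys}"
  proof (rule kol.P.finite_measure_eq_AE)
    have "AE \<omega> in \<L>. \<forall>t\<in>set ts. version t \<omega> = \<omega> t"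
      using assms(1) by (intro AE_finite_allI) (auto intro: AE_version)
    then show "AE \<omega> in \<L>. \<omega> \<in> {\<omega>\<in>space \<L>. map (\<lambda>t. version t \<omega>) ts = ys} \<longleftrightarrow>
        \<omega> \<in> {\<omega>\<in>space \<L>. map \<omega> ts = ys}"
    proof eventually_elim
      case (elim \<omega>)
      then have "map (\<lambda>t. version t \<omega>) ts = map \<omega> ts" by simp
      then show ?case by (simp only: mem_Collect_eq)
    qed
    have "{\<omega>\<in>space \<L>. map (\<lambda>t. version t \<omega>) ts = ys} = path_of -` {f\<in>space path_law. map f ts = map e ys} \<inter> space \<L>"
      using path_of_in_paths by (auto simp: iff space_path_law)
    then show "{\<omega>\<in>space \<L>. map (\<lambda>t. version t \<omega>) ts = ys} \<in> sets \<L>"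
      using measurable_sets[OF measurable_path_of sets] by simp
    have "set ts \<subseteq> {0..}" using assms(1) by auto
    from pred_map_eq[OF this, of ys] show "{\<omega>\<in>space \<L>. map \<omega> ts = ys} \<in> sets \<L>"
      by (simp add: pred_def)
  qed
  finally show ?thesis .
qed

text \<open>An event of positive probability contains a path, and paths take their values in the
  image of E under e.\<close>

lemma path_law_positive:
  assumes "0 < measure path_law {f\<in>space path_law. map f ts = zs}"
  obtains ys where "zs = map e ys" "set ys \<subseteq> E"
proof -
  have "{f\<in>space path_law. map f ts = zs} \<noteq> {}"
    using assms by (metis less_irrefl measure_empty)
  then obtain f where f: "f \<in> paths" "map f ts = zs" by (auto simp: space_path_law)
  have fin: "f t \<in> e ` E" for t using f(1) by (auto simp: paths_def)
  have "zs = map e (map (\<lambda>t. inv_into E e (f t)) ts)"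
    using f(2) f_inv_into_f[OF fin] by (auto simp: comp_def)
  moreover have "set (map (\<lambda>t. inv_into E e (f t)) ts) \<subseteq> E"
    using inv_into_into[OF fin] by auto
  ultimately show ?thesis using that by blast
qed

text \<open>The right-hand side forgets \<open>ts\<close> and \<open>zs\<close> and depends on the
  times only through u - t. Both the Markov property and time homogeneity are read off from
  it.\<close>

lemma path_law_cond:
  assumes ts: "sorted (ts @ [t, u])" "distinct (ts @ [t, u])" "\<forall>v\<in>set (ts @ [t, u]). 0 \<le> v"
    and len: "length zs = length ts"
    and pos: "0 < measure path_law {f\<in>space path_law. map f (ts @ [t]) = zs @ [w]}"
  shows "\<P>(f in path_law. f u = z \<bar> map f (ts @ [t]) = zs @ [w]) =
    (if z \<in> e ` E then pmf (K (u - t) (inv_into E e w)) (inv_into E e z) else 0)"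
proof (cases "z \<in> e ` E")
  case False
  then have "{f\<in>space path_law. f u = z \<and> map f (ts @ [t]) = zs @ [w]} = {}"
    by (auto simp: space_path_law paths_def)
  then show ?thesis using False unfolding cond_prob_def by (simp only: measure_empty if_False div_0)
next
  case True
  then obtain z' where z': "z' \<in> E" "z = e z'" by auto
  obtain ys' where ys': "zs @ [w] = map e ys'" "set ys' \<subseteq> E"
    using path_law_positive[OF pos] by blast
  then obtain ys y where ys: "ys' = ys @ [y]" "zs = map e ys" "w = e y"
    by (cases ys' rule: rev_cases) auto
  have in_E: "set ys \<subseteq> E" "y \<in> E" using ys' ys by auto
  have inv: "inv_into E e w = y" "inv_into E e z = z'"
    using inj in_E z' ys by (simp_all add: inv_into_f_f)
  have eq: "{f\<in>space path_law. f u = z \<and> map f (ts @ [t]) = zs @ [w]} =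
    {f\<in>space path_law. map f (ts @ [t, u]) = map e (ys @ [y, z'])}"
    using z' ys by auto
  have "measure path_law {f\<in>space path_law. map f (ts @ [t, u]) = map e (ys @ [y, z'])} =
    measure path_law {f\<in>space path_law. map f (ts @ [t]) = map e (ys @ [y])} * pmf (K (u - t) y) z'"
    using ts in_E z' len ys lim_snoc[OF ts, of ys y z']
    by (subst (1 2) path_law_cylinder) auto
  moreover have "map e (ys @ [y]) = zs @ [w]" using ys by simp
  ultimately show ?thesis
    using pos True unfolding cond_prob_def eq inv by (simp del: map_append)
qed

lemma markov_property_path_law: "markov_property path_law (\<lambda>t f. f t)"
  unfolding markov_property_def
proof (intro allI impI, elim conjE)
  fix n :: nat and s :: "nat \<Rightarrow> real" and x :: "nat \<Rightarrow> 's" and y :: 's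
  assume s0: "0 \<le> s 0" and inc: "\<forall>m\<le>n. s m < s (Suc m)"
    and pos: "0 < \<P>(f in path_law. \<forall>m\<le>n. f (s m) = x m)"
  have mono: "s i < s j" if "i < j" "j \<le> Suc n" for i j
    using that inc
  proof (induction j)
    case (Suc j)
    then show ?case by (cases "i = j") (auto intro: less_trans[of _ "s j"])
  qed simp
  have upt: "map s [0..<n] @ [s n, s (Suc n)] = map s [0..<Suc (Suc n)]"
    by simp
  have "sorted_wrt (<) (map s [0..<Suc (Suc n)])"
    unfolding sorted_wrt_iff_nth_less using mono by (simp del: upt_Suc)
  then have sd: "sorted (map s [0..<n] @ [s n, s (Suc n)])" "distinct (map s [0..<n] @ [s n, s (Suc n)])"
    unfolding upt by (simp_all only: strict_sorted_iff)
  have nonneg: "0 \<le> s m" if "m \<le> Suc n" for m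
    using mono[of 0 m] that s0 by (cases "m = 0") auto
  have iff: "(\<forall>m\<le>n. f (s m) = x m) \<longleftrightarrow> map f (map s [0..<n] @ [s n]) = map x [0..<n] @ [x n]"
    for f :: "real \<Rightarrow> 's"
    by (auto simp: le_less)
  have iff1: "f (s n) = x n \<longleftrightarrow> map f ([] @ [s n]) = [] @ [x n]" for f :: "real \<Rightarrow> 's"
    by simp
  interpret prob_space path_law by (rule prob_space_path_law)
  \<comment> \<open>Conditioning on the last state alone also needs positive probability; this event
    contains the whole history.\<close>
  have "\<P>(f in path_law. \<forall>m\<le>n. f (s m) = x m) \<le> \<P>(f in path_law. map f ([] @ [s n]) = [] @ [x n])"
    by (intro finite_measure_mono sets_path_law_map) auto
  then have pos1: "0 < \<P>(f in path_law. map f ([] @ [s n]) = [] @ [x n])"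
    using pos by linarith
  have "\<P>(f in path_law. f (s (Suc n)) = y \<bar> \<forall>m\<le>n. f (s m) = x m) =
     (if y \<in> e ` E then pmf (K (s (Suc n) - s n) (inv_into E e (x n))) (inv_into E e y) else 0)"
    using sd pos nonneg unfolding iff by (intro path_law_cond) auto
  also have "\<dots> = \<P>(f in path_law. f (s (Suc n)) = y \<bar> f (s n) = x n)"
    using pos1 nonneg mono[of n "Suc n"] unfolding iff1 by (intro path_law_cond[symmetric]) auto
  finally show "\<P>(f in path_law. f (s (Suc n)) = y \<bar> \<forall>m\<le>n. f (s m) = x m) =
     \<P>(f in path_law. f (s (Suc n)) = y \<bar> f (s n) = x n)" .
qed

lemma path_law_transition:
  assumes "0 \<le> s" "0 \<le> t" "0 < \<P>(f in path_law. f s = w)"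
  shows "\<P>(f in path_law. f (s + t) = z \<bar> f s = w) =
    (if z \<in> e ` E then pmf (K t (inv_into E e w)) (inv_into E e z) else 0)"
\<comment> \<open>\<open>path_law_cond\<close> needs distinct times, so equal times are treated by
  hand.\<close>
proof (cases "t = 0")
  case True
  have "\<P>(f in path_law. map f [s] = [w]) > 0" using assms by simp
  then obtain ys where "[w] = map e ys" "set ys \<subseteq> E" by (rule path_law_positive)
  then have w: "w \<in> e ` E" by auto
  have "{f\<in>space path_law. f s = z \<and> f s = w} = (if z = w then {f\<in>space path_law. f s = w} else {})"
    by auto
  then show ?thesis
    using assms True w inj_on_eq_iff[OF inj]
    by (auto simp: cond_prob_def K_zero inv_into_f_f[OF inj] indicator_def)
next
  case False
  have iff: "f s = w \<longleftrightarrow> map f ([] @ [s]) = [] @ [w]" for f :: "real \<Rightarrow> 's" by simp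
  have "\<P>(f in path_law. f (s + t) = z \<bar> map f ([] @ [s]) = [] @ [w]) =
    (if z \<in> e ` E then pmf (K (s + t - s) (inv_into E e w)) (inv_into E e z) else 0)"
    using assms False by (intro path_law_cond) auto
  then show ?thesis by simp
qed

lemma path_law_initial:
  assumes "x \<in> E"
  shows "0 < \<P>(f in path_law. f 0 = e x)"
proof -
  have "\<P>(f in path_law. map f [0] = map e [x]) = pmf \<nu> x"
    using assms initial_prob[of x] by (subst path_law_cylinder) auto
  then show ?thesis using assms init by (simp add: pmf_positive)
qed

lemma trans_prob_path_law:
  assumes "0 \<le> t" "x \<in> E" "y \<in> E"
  shows "trans_prob path_law (\<lambda>t f. f t) t (e x) (e y) = pmf (K t x) y"
  using path_law_transition[of 0 t "e x" "e y"] path_law_initial[of x] assms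
  by (simp add: trans_prob_def inv_into_f_f[OF inj])

lemma markov_chain_path_law: "markov_chain path_law (\<lambda>t f. f t) (e ` E)"
proof -
  have "\<P>(f in path_law. f (s + t) = y \<bar> f s = x) = trans_prob path_law (\<lambda>t f. f t) t x y"
    if st: "0 \<le> s" "0 \<le> t" and pos: "0 < \<P>(f in path_law. f s = x)" for s t x y
  proof -
    have "\<P>(f in path_law. map f [s] = [x]) > 0" using pos by simp
    then obtain ys where "[x] = map e ys" "set ys \<subseteq> E" by (rule path_law_positive)
    then obtain x' where "x' \<in> E" "x = e x'" by auto
    then have "0 < \<P>(f in path_law. f 0 = x)" using path_law_initial by blast
    then show ?thesis
      using path_law_transition[OF st pos, of y] path_law_transition[of 0 t x y] st
      by (simp add: trans_prob_def)
  qed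
  then show ?thesis
    unfolding markov_chain_def time_homogeneous_def
    using prob_space_path_law measurable_path_law_eval path_law_initial markov_property_path_law
    by (auto simp: space_path_law paths_def)
qed

end

end

section \<open>Matrix exponentials by uniformization\<close>

primrec mat_pow :: "'a set \<Rightarrow> ('a \<Rightarrow> 'a \<Rightarrow> real) \<Rightarrow> nat \<Rightarrow> 'a \<Rightarrow> 'a \<Rightarrow> real" where
  "mat_pow I K 0 x y = (if x = y then 1 else 0)"
| "mat_pow I K (Suc n) x y = (\<Sum>z\<in>I. K x z * mat_pow I K n z y)"

lemma mat_pow_Suc_right:
  assumes "finite I" "x \<in> I" "y \<in> I"
  shows "mat_pow I K (Suc n) x y = (\<Sum>z\<in>I. mat_pow I K n x z * K z y)"
  using assms(2)
proof (induction n arbitrary: x)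
  case 0
  then show ?case using assms by (simp add: if_distrib if_distribR cong: if_cong)
next
  case (Suc n)
  have "mat_pow I K (Suc (Suc n)) x y = (\<Sum>z\<in>I. K x z * (\<Sum>w\<in>I. mat_pow I K n z w * K w y))"
    by (subst mat_pow.simps) (use Suc.IH in \<open>simp del: mat_pow.simps\<close>)
  also have "\<dots> = (\<Sum>w\<in>I. \<Sum>z\<in>I. K x z * mat_pow I K n z w * K w y)"
    by (subst sum.swap) (simp add: sum_distrib_left mult.assoc)
  also have "\<dots> = (\<Sum>w\<in>I. mat_pow I K (Suc n) x w * K w y)"
    by (simp add: sum_distrib_right)
  finally show ?case .
qed

text \<open>The matrix exponential of \<open>t c (K - 1)\<close>, written so that all terms are nonnegative when \<open>K\<close> is
  stochastic (uniformization).\<close>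

definition unif_semigroup :: "'a set \<Rightarrow> ('a \<Rightarrow> 'a \<Rightarrow> real) \<Rightarrow> real \<Rightarrow> real \<Rightarrow> 'a \<Rightarrow> 'a \<Rightarrow> real" where
  "unif_semigroup I K c t x y = exp (- (c * t)) * (\<Sum>n. mat_pow I K n x y * c ^ n / fact n * t ^ n)"

locale stochastic_matrix =
  fixes I :: "'a set" and K :: "'a \<Rightarrow> 'a \<Rightarrow> real" and c :: real
  assumes finite_I: "finite I"
    and K_nonneg: "x \<in> I \<Longrightarrow> y \<in> I \<Longrightarrow> 0 \<le> K x y"
    and K_row: "x \<in> I \<Longrightarrow> (\<Sum>y\<in>I. K x y) = 1"
    and c_nonneg: "0 \<le> c"
begin

abbreviation "P \<equiv> unif_semigroup I K c"

lemma mat_pow_bounds: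
  assumes "x \<in> I" "y \<in> I"
  shows "0 \<le> mat_pow I K n x y" "mat_pow I K n x y \<le> 1"
proof -
  have "0 \<le> mat_pow I K n x y \<and> mat_pow I K n x y \<le> 1"
    using assms(1)
  proof (induction n arbitrary: x)
    case (Suc n)
    have "(\<Sum>z\<in>I. K x z * mat_pow I K n z y) \<le> (\<Sum>z\<in>I. K x z * 1)"
      using Suc K_nonneg by (intro sum_mono mult_left_mono) auto
    then show ?case
      using Suc K_row K_nonneg by (auto intro!: sum_nonneg mult_nonneg_nonneg)
  qed simp
  then show "0 \<le> mat_pow I K n x y" "mat_pow I K n x y \<le> 1" by auto
qed

lemma norm_term_le:
  assumes "x \<in> I" "y \<in> I"
  shows "norm (mat_pow I K n x y * c ^ n / fact n * t ^ n) \<le> (c * \<bar>t\<bar>) ^ n / fact n"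
proof -
  have "norm (mat_pow I K n x y * c ^ n / fact n * t ^ n) = mat_pow I K n x y * ((c * \<bar>t\<bar>) ^ n / fact n)"
    using mat_pow_bounds[OF assms, of n] c_nonneg
    by (simp add: abs_mult power_mult_distrib power_abs)
  also have "\<dots> \<le> 1 * ((c * \<bar>t\<bar>) ^ n / fact n)"
    using mat_pow_bounds[OF assms, of n] c_nonneg by (intro mult_right_mono) auto
  finally show ?thesis by simp
qed

lemma summable_exp_terms: "summable (\<lambda>n. (a::real) ^ n / fact n)"
  using summable_exp[of a] by (simp add: divide_inverse mult.commute)

lemma summable_terms:
  assumes "x \<in> I" "y \<in> I"
  shows "summable (\<lambda>n. mat_pow I K n x y * c ^ n / fact n * t ^ n)"
  by (rule summable_comparison_test'[OF summable_exp_terms, of 0]) (rule norm_term_le[OF assms])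

lemma unif_nonneg: "x \<in> I \<Longrightarrow> y \<in> I \<Longrightarrow> 0 \<le> t \<Longrightarrow> 0 \<le> P t x y"
  unfolding unif_semigroup_def using mat_pow_bounds c_nonneg
  by (intro mult_nonneg_nonneg suminf_nonneg summable_terms) auto

lemma unif_zero: "P 0 x y = (if x = y then 1 else 0)"
proof -
  have "(\<Sum>n. mat_pow I K n x y * c ^ n / fact n * 0 ^ n) = mat_pow I K 0 x y"
    using powser_zero[of "\<lambda>n. mat_pow I K n x y * c ^ n / fact n"] by simp
  then show ?thesis by (simp add: unif_semigroup_def)
qed

text \<open>Differentiation shifts the power of \<open>K\<close> by one. Splitting the extra factor
  off on the left gives the backward equation, on the right the forward equation.\<close>

lemma unif_deriv_series:
  assumes "x \<in> I" "y \<in> I"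
  shows "((\<lambda>t. P t x y) has_real_derivative
    c * (exp (- (c * t)) * (\<Sum>n. mat_pow I K (Suc n) x y * c ^ n / fact n * t ^ n) - P t x y)) (at t)"
proof -
  let ?a = "\<lambda>n. mat_pow I K n x y * c ^ n / fact n"
  have "diffs ?a n = c * (mat_pow I K (Suc n) x y * c ^ n / fact n)" for n
    by (simp add: diffs_def field_simps del: mat_pow.simps of_nat_Suc)
  then have "(\<Sum>n. diffs ?a n * t ^ n) = (\<Sum>n. c * (mat_pow I K (Suc n) x y * c ^ n / fact n * t ^ n))"
    by (simp add: mult.assoc del: mat_pow.simps)
  also have "\<dots> = c * (\<Sum>n. mat_pow I K (Suc n) x y * c ^ n / fact n * t ^ n)"
  proof (rule suminf_mult)
    have "norm (mat_pow I K (Suc n) x y * c ^ n / fact n * t ^ n) \<le> (c * \<bar>t\<bar>) ^ n / fact n" for n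
    proof -
      have "norm (mat_pow I K (Suc n) x y * c ^ n / fact n * t ^ n) =
          mat_pow I K (Suc n) x y * ((c * \<bar>t\<bar>) ^ n / fact n)"
        using mat_pow_bounds[OF assms, of "Suc n"] c_nonneg
        by (simp add: abs_mult power_mult_distrib power_abs del: mat_pow.simps)
      also have "\<dots> \<le> 1 * ((c * \<bar>t\<bar>) ^ n / fact n)"
        using mat_pow_bounds[OF assms, of "Suc n"] c_nonneg by (intro mult_right_mono) auto
      finally show ?thesis by simp
    qed
    then show "summable (\<lambda>n. mat_pow I K (Suc n) x y * c ^ n / fact n * t ^ n)"
      by (intro summable_comparison_test'[OF summable_exp_terms, of 0])
  qed
  finally have "((\<lambda>t. \<Sum>n. ?a n * t ^ n) has_real_derivative
      c * (\<Sum>n. mat_pow I K (Suc n) x y * c ^ n / fact n * t ^ n)) (at t)"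
    using termdiffs_strong_converges_everywhere[of ?a t] summable_terms[OF assms] by (simp del: mat_pow.simps)
  moreover have "((\<lambda>t. exp (- (c * t))) has_real_derivative - c * exp (- (c * t))) (at t)"
    by (auto intro!: derivative_eq_intros)
  ultimately have "((\<lambda>t. P t x y) has_real_derivative
      - c * exp (- (c * t)) * (\<Sum>n. ?a n * t ^ n) +
      c * (\<Sum>n. mat_pow I K (Suc n) x y * c ^ n / fact n * t ^ n) * exp (- (c * t))) (at t)"
    unfolding unif_semigroup_def by (rule DERIV_mult[rotated])
  moreover have "- c * exp (- (c * t)) * (\<Sum>n. ?a n * t ^ n) +
      c * (\<Sum>n. mat_pow I K (Suc n) x y * c ^ n / fact n * t ^ n) * exp (- (c * t)) =
      c * (exp (- (c * t)) * (\<Sum>n. mat_pow I K (Suc n) x y * c ^ n / fact n * t ^ n) - P t x y)"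
    unfolding unif_semigroup_def by (simp add: right_diff_distrib mult_ac del: mat_pow.simps)
  ultimately show ?thesis by simp
qed

lemma unif_backward:
  assumes "x \<in> I" "y \<in> I"
  shows "((\<lambda>t. P t x y) has_real_derivative c * ((\<Sum>z\<in>I. K x z * P t z y) - P t x y)) (at t)"
proof -
  have "(\<Sum>n. mat_pow I K (Suc n) x y * c ^ n / fact n * t ^ n) =
    (\<Sum>n. \<Sum>z\<in>I. K x z * (mat_pow I K n z y * c ^ n / fact n * t ^ n))"
    by (simp add: sum_distrib_right sum_divide_distrib mult.assoc)
  also have "\<dots> = (\<Sum>z\<in>I. K x z * (\<Sum>n. mat_pow I K n z y * c ^ n / fact n * t ^ n))"
    using summable_terms assms by (subst suminf_sum) (auto intro!: summable_mult sum.cong suminf_mult simp del: times_divide_eq_right times_divide_eq_left)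
  finally have "exp (- (c * t)) * (\<Sum>n. mat_pow I K (Suc n) x y * c ^ n / fact n * t ^ n) =
    (\<Sum>z\<in>I. K x z * P t z y)"
    by (simp add: unif_semigroup_def sum_distrib_left mult.left_commute)
  then show ?thesis using unif_deriv_series[OF assms, of t] by simp
qed

lemma unif_forward:
  assumes "x \<in> I" "y \<in> I"
  shows "((\<lambda>t. P t x y) has_real_derivative c * ((\<Sum>z\<in>I. P t x z * K z y) - P t x y)) (at t)"
proof -
  have "(\<Sum>n. mat_pow I K (Suc n) x y * c ^ n / fact n * t ^ n) =
    (\<Sum>n. \<Sum>z\<in>I. (mat_pow I K n x z * c ^ n / fact n * t ^ n) * K z y)"
    unfolding mat_pow_Suc_right[OF finite_I assms]
    by (simp add: sum_distrib_left sum_distrib_right sum_divide_distrib mult_ac)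
  also have "\<dots> = (\<Sum>z\<in>I. (\<Sum>n. mat_pow I K n x z * c ^ n / fact n * t ^ n) * K z y)"
    using summable_terms assms by (subst suminf_sum) (auto intro!: summable_mult2 sum.cong suminf_mult2[symmetric] simp del: times_divide_eq_right times_divide_eq_left)
  finally have "exp (- (c * t)) * (\<Sum>n. mat_pow I K (Suc n) x y * c ^ n / fact n * t ^ n) =
    (\<Sum>z\<in>I. P t x z * K z y)"
    by (simp add: unif_semigroup_def sum_distrib_left mult.assoc)
  then show ?thesis using unif_deriv_series[OF assms, of t] by simp
qed

lemma unif_row_sum:
  assumes "x \<in> I"
  shows "(\<Sum>y\<in>I. P t x y) = 1"
proof -
  have "((\<lambda>t. \<Sum>y\<in>I. P t x y) has_real_derivative
      (\<Sum>y\<in>I. c * ((\<Sum>z\<in>I. P t x z * K z y) - P t x y))) (at t)" for t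
    using assms by (intro DERIV_sum unif_forward)
  moreover have "(\<Sum>y\<in>I. c * ((\<Sum>z\<in>I. P t x z * K z y) - P t x y)) = 0" for t
  proof -
    have "(\<Sum>y\<in>I. \<Sum>z\<in>I. P t x z * K z y) = (\<Sum>z\<in>I. P t x z * (\<Sum>y\<in>I. K z y))"
      by (subst sum.swap) (simp add: sum_distrib_left)
    then show ?thesis by (simp add: sum_distrib_left[symmetric] sum_subtractf K_row)
  qed
  ultimately have "(\<Sum>y\<in>I. P t x y) = (\<Sum>y\<in>I. P 0 x y)"
    using DERIV_isconst_all[of "\<lambda>t. \<Sum>y\<in>I. P t x y" t 0] by simp
  then show ?thesis using assms finite_I by (simp add: unif_zero)
qed

text \<open>Run the first factor up to time r and the second for the remaining s + t - r. The
  forward equation in the first and the backward equation in the second cancel, so r = 0 and r = s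
  give the same value.\<close>

lemma unif_add:
  assumes "x \<in> I" "y \<in> I"
  shows "P (s + t) x y = (\<Sum>z\<in>I. P s x z * P t z y)"
proof -
  let ?F = "\<lambda>r. \<Sum>z\<in>I. P r x z * P (s + t - r) z y"
  have "(?F has_real_derivative 0) (at r)" for r
  proof -
    let ?B = "\<lambda>z. c * ((\<Sum>w\<in>I. K z w * P (s + t - r) w y) - P (s + t - r) z y)"
    let ?A = "\<lambda>z. c * ((\<Sum>w\<in>I. P r x w * K w z) - P r x z)"
    have "((\<lambda>r. s + t - r) has_real_derivative - 1) (at r)"
      by (auto intro!: derivative_eq_intros)
    then have "((\<lambda>r. P (s + t - r) z y) has_real_derivative - ?B z) (at r)" if "z \<in> I" for z
      using DERIV_chain2[of "\<lambda>q. P q z y" "?B z" "\<lambda>r. s + t - r" r "- 1" UNIV, OF unif_backward[OF that assms(2)]]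
      by simp
    then have "(?F has_real_derivative (\<Sum>z\<in>I. ?A z * P (s + t - r) z y + - ?B z * P r x z)) (at r)"
      using assms by (intro DERIV_sum DERIV_mult unif_forward) auto
    moreover have "(\<Sum>z\<in>I. ?A z * P (s + t - r) z y + - ?B z * P r x z) =
      c * ((\<Sum>z\<in>I. \<Sum>w\<in>I. P r x w * K w z * P (s + t - r) z y) - (\<Sum>z\<in>I. \<Sum>w\<in>I. P r x z * K z w * P (s + t - r) w y))"
      by (simp add: sum_distrib_left sum_distrib_right sum_subtractf sum.distrib algebra_simps)
    moreover have "(\<Sum>z\<in>I. \<Sum>w\<in>I. P r x w * K w z * P (s + t - r) z y) = (\<Sum>z\<in>I. \<Sum>w\<in>I. P r x z * K z w * P (s + t - r) w y)"
      by (rule sum.swap)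
    ultimately show ?thesis by simp
  qed
  then have "?F 0 = ?F s"
    by (intro DERIV_isconst_all) auto
  moreover have "?F 0 = P (s + t) x y"
    using assms finite_I by (simp add: unif_zero if_distrib if_distribR cong: if_cong)
  ultimately show ?thesis by simp
qed

text \<open>The term n = 0 alone contributes exp (- c t), the probability that the uniformizing
  Poisson clock has not rung. This supplies \<open>K_rate\<close> in
  \<open>jump_semigroup\<close>.\<close>

lemma unif_diag_ge:
  assumes "x \<in> I" "0 \<le> t"
  shows "1 - P t x x \<le> c * t"
proof -
  have "mat_pow I K 0 x x * c ^ 0 / fact 0 * t ^ 0 \<le> (\<Sum>n. mat_pow I K n x x * c ^ n / fact n * t ^ n)"
    using sum_le_suminf[OF summable_terms[OF assms(1,1)], of "{0}" t] mat_pow_bounds[OF assms(1,1)] c_nonneg assms(2)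
    by simp
  then have "exp (- (c * t)) \<le> P t x x"
    unfolding unif_semigroup_def by simp
  moreover have "1 + - (c * t) \<le> exp (- (c * t))" by (rule exp_ge_add_one_self)
  ultimately show ?thesis by simp
qed

end

text \<open>Tannery's theorem: with a common c the terms are dominated uniformly in m. Continuity of
  the law in the rates rests on this.\<close>

lemma unif_semigroup_tendsto:
  assumes "\<And>m. stochastic_matrix I (K m) c" "stochastic_matrix I L c"
    and lim: "\<And>x y. x \<in> I \<Longrightarrow> y \<in> I \<Longrightarrow> (\<lambda>m. K m x y) \<longlonglongrightarrow> L x y"
    and xy: "x \<in> I" "y \<in> I"
  shows "(\<lambda>m. unif_semigroup I (K m) c t x y) \<longlonglongrightarrow> unif_semigroup I L c t x y"
proof -
  interpret L: stochastic_matrix I L c by fact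
  have pow: "(\<lambda>m. mat_pow I (K m) n x y) \<longlonglongrightarrow> mat_pow I L n x y" for n
    using xy(1)
  proof (induction n arbitrary: x)
    case (Suc n)
    then show ?case by (auto intro!: tendsto_intros lim)
  qed simp
  have "(\<lambda>m. \<Sum>n. mat_pow I (K m) n x y * c ^ n / fact n * t ^ n) \<longlonglongrightarrow>
    (\<Sum>n. mat_pow I L n x y * c ^ n / fact n * t ^ n)"
  proof (rule tannerys_theorem[THEN conjunct2, THEN conjunct2])
    show "(\<lambda>m. mat_pow I (K m) n x y * c ^ n / fact n * t ^ n) \<longlonglongrightarrow> mat_pow I L n x y * c ^ n / fact n * t ^ n" for n
      by (intro tendsto_intros pow) simp
    show "\<forall>\<^sub>F (n, m) in sequentially \<times>\<^sub>F sequentially.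
        norm (mat_pow I (K m) n x y * c ^ n / fact n * t ^ n) \<le> (c * \<bar>t\<bar>) ^ n / fact n"
      using stochastic_matrix.norm_term_le[OF assms(1) xy] by (intro always_eventually) auto
  qed (simp_all add: L.summable_exp_terms)
  then show ?thesis unfolding unif_semigroup_def by (intro tendsto_intros)
qed

section \<open>A complementarity problem on a box\<close>

text \<open>The function type has infinitely many coordinates of which only n are controlled, so
  compactness is used one coordinate at a time.\<close>

lemma finite_coordinates_convergent_subsequence:
  fixes z :: "nat \<Rightarrow> nat \<Rightarrow> real"
  assumes "\<And>m j. j < n \<Longrightarrow> z m j \<in> {a..b}"
  shows "\<exists>\<phi> x. strict_mono \<phi> \<and> (\<forall>j<n. x j \<in> {a..b} \<and> (\<lambda>m. z (\<phi> m) j) \<longlonglongrightarrow> x j)"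
  using assms
proof (induction n)
  case 0
  show ?case by (rule exI[of _ "\<lambda>m. m"]) (simp add: strict_mono_def)
next
  case (Suc n)
  have "z m j \<in> {a..b}" if "j < n" for m j using Suc.prems that by simp
  from Suc.IH[OF this] obtain \<phi> x where \<phi>: "strict_mono \<phi>" "\<forall>j<n. x j \<in> {a..b} \<and> (\<lambda>m. z (\<phi> m) j) \<longlonglongrightarrow> x j"
    by blast
  have "seq_compact {a..b}" by (simp add: compact_imp_seq_compact)
  moreover have "\<forall>m. z (\<phi> m) n \<in> {a..b}" using Suc.prems by auto
  ultimately obtain y \<psi> where \<psi>: "y \<in> {a..b}" "strict_mono \<psi>" "((\<lambda>m. z (\<phi> m) n) \<circ> \<psi>) \<longlonglongrightarrow> y"
    unfolding seq_compact_def by metis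
  have "(\<lambda>m. z ((\<phi> \<circ> \<psi>) m) j) \<longlonglongrightarrow> x j" if "j < n" for j
    using LIMSEQ_subseq_LIMSEQ[of "\<lambda>m. z (\<phi> m) j" "x j" \<psi>] \<phi>(2) \<psi>(2) that by (simp add: o_def)
  then have "strict_mono (\<phi> \<circ> \<psi>) \<and>
      (\<forall>j<Suc n. (x(n := y)) j \<in> {a..b} \<and> (\<lambda>m. z ((\<phi> \<circ> \<psi>) m) j) \<longlonglongrightarrow> (x(n := y)) j)"
    using \<phi> \<psi> by (auto simp: less_Suc_eq o_def intro: strict_mono_compose)
  then show ?case by blast
qed

text \<open>The solutions are the fixed points of x \<mapsto> clip (x + F x), where clip projects
  onto the box, so this is a form of Brouwer's theorem. It is obtained from Kuhn's lemma on finer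
  and finer grids.\<close>

lemma box_complementarity:
  fixes F :: "(nat \<Rightarrow> real) \<Rightarrow> nat \<Rightarrow> real"
  assumes R: "0 < R"
    and cont: "\<And>X x i. (\<And>m j. j < n \<Longrightarrow> X m j \<in> {0..R}) \<Longrightarrow> (\<And>j. j < n \<Longrightarrow> x j \<in> {0..R}) \<Longrightarrow>
      (\<And>j. j < n \<Longrightarrow> (\<lambda>m. X m j) \<longlonglongrightarrow> x j) \<Longrightarrow> i < n \<Longrightarrow> (\<lambda>m. F (X m) i) \<longlonglongrightarrow> F x i"
  shows "\<exists>x. \<forall>i<n. x i \<in> {0..R} \<and> (x i = 0 \<or> 0 \<le> F x i) \<and> (x i = R \<or> F x i \<le> 0)"
proof -
  define sc where "sc p q j = R * real (q j) / real (Suc p)" for p and q :: "nat \<Rightarrow> nat" and j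
  \<comment> \<open>The first two clauses are the boundary conditions of Kuhn's lemma. A vertex with
    label 0 thus has coordinate 0 or F \<ge> 0, and one with label 1 lies on the opposite face or
    has F < 0.\<close>
  define lab where "lab p q i = (if q i = 0 then 0 else if q i = Suc p then 1
    else if 0 \<le> F (sc p q) i then 0 else 1 :: nat)" for p q i
  define cell where "cell q r \<longleftrightarrow> (\<forall>j<n. q j \<le> r j \<and> r j \<le> q j + 1)" for q r :: "nat \<Rightarrow> nat"
  define kuhn where "kuhn p q \<longleftrightarrow> (\<forall>i<n. q i < Suc p) \<and>
    (\<forall>i<n. \<exists>r s. cell q r \<and> cell q s \<and> lab p r i \<noteq> lab p s i)" for p q
  have ex: "\<exists>q. kuhn p q" for p
  proof -
    have "0 < Suc p" "\<forall>x. (\<forall>i<n. x i \<le> Suc p) \<longrightarrow> (\<forall>i<n. lab p x i = 0 \<or> lab p x i = 1)"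
      "\<forall>x. (\<forall>i<n. x i \<le> Suc p) \<longrightarrow> (\<forall>i<n. x i = 0 \<longrightarrow> lab p x i = 0)"
      "\<forall>x. (\<forall>i<n. x i \<le> Suc p) \<longrightarrow> (\<forall>i<n. x i = Suc p \<longrightarrow> lab p x i = 1)"
      by (simp_all add: lab_def)
    then obtain q where q: "\<forall>i<n. q i < Suc p"
      "\<forall>i<n. \<exists>r s. (\<forall>j<n. q j \<le> r j \<and> r j \<le> q j + 1) \<and> (\<forall>j<n. q j \<le> s j \<and> s j \<le> q j + 1) \<and> lab p r i \<noteq> lab p s i"
      by (rule kuhn_lemma)
    show ?thesis unfolding kuhn_def cell_def by (rule exI[of _ q], rule conjI[OF q])
  qed
  define q where "q p = (SOME q. kuhn p q)" for p
  have kuhn_q: "kuhn p (q p)" for p unfolding q_def by (rule someI_ex[OF ex])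
  have q: "q p i < Suc p" if "i < n" for p i using kuhn_q[of p] that by (simp add: kuhn_def)
  \<comment> \<open>For each coordinate and each label, a vertex of Kuhn's cell that carries it; all
    of them converge to the same point x.\<close>
  define r where "r v p i = (SOME r. cell (q p) r \<and> lab p r i = v)" for v p i
  have r_spec: "cell (q p) (r v p i) \<and> lab p (r v p i) i = v" if "i < n" "v = 0 \<or> v = 1" for v p i
  proof -
    have two: "lab p r i = 0 \<or> lab p r i = 1" for r by (simp add: lab_def)
    obtain r s where "cell (q p) r" "cell (q p) s" "lab p r i \<noteq> lab p s i"
      using kuhn_q[of p] \<open>i < n\<close> unfolding kuhn_def by blast
    then have "\<exists>r. cell (q p) r \<and> lab p r i = v"
      using two[of r] two[of s] that(2) by metis
    then show ?thesis unfolding r_def by (rule someI_ex)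
  qed
  have r: "q p j \<le> r v p i j \<and> r v p i j \<le> q p j + 1" if "i < n" "v = 0 \<or> v = 1" "j < n" for v p i j
    using r_spec[OF that(1,2), of p] that(3) by (simp add: cell_def)
  have lab_r: "lab p (r v p i) i = v" if "i < n" "v = 0 \<or> v = 1" for v p i
    using r_spec[OF that] by blast
  have box: "sc p q' j \<in> {0..R}" if "q' j \<le> Suc p" for p q' j
  proof -
    have "R * real (q' j) \<le> R * real (Suc p)"
      using R that by (intro mult_left_mono) auto
    then show ?thesis using R by (simp add: sc_def divide_le_eq)
  qed
  obtain \<phi> x where \<phi>: "strict_mono \<phi>" and x: "\<And>j. j < n \<Longrightarrow> x j \<in> {0..R}"
    and lim: "\<And>j. j < n \<Longrightarrow> (\<lambda>m. sc (\<phi> m) (q (\<phi> m)) j) \<longlonglongrightarrow> x j"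
  proof -
    have "sc p (q p) j \<in> {0..R}" if "j < n" for p j
      using q[OF that, of p] by (intro box) simp
    from finite_coordinates_convergent_subsequence[of n "\<lambda>p. sc p (q p)" 0 R, OF this] that show ?thesis
      by blast
  qed
  define X where "X v i m = sc (\<phi> m) (r v (\<phi> m) i)" for v i m
  have X_box: "X v i m j \<in> {0..R}" if "i < n" "v = 0 \<or> v = 1" "j < n" for v i m j
    unfolding X_def
    by (rule box) (use r[OF that(1,2,3), of "\<phi> m"] q[OF that(3), of "\<phi> m"] in linarith)
  have X_lim: "(\<lambda>m. X v i m j) \<longlonglongrightarrow> x j" if "i < n" "v = 0 \<or> v = 1" "j < n" for v i j
  proof -
    have null: "(\<lambda>m. R / real (Suc (\<phi> m))) \<longlonglongrightarrow> 0"
      using LIMSEQ_subseq_LIMSEQ[OF LIMSEQ_Suc[OF lim_const_over_n[of R]] \<phi>] by (simp add: o_def)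
    have bound: "norm (X v i m j - sc (\<phi> m) (q (\<phi> m)) j) \<le> R / real (Suc (\<phi> m))" for m
    proof -
      have eq: "X v i m j - sc (\<phi> m) (q (\<phi> m)) j = (R / real (Suc (\<phi> m))) * (real (r v (\<phi> m) i j) - real (q (\<phi> m) j))"
        unfolding X_def sc_def by (simp add: right_diff_distrib diff_divide_distrib del: of_nat_Suc)
      have aux: "norm (a * b) \<le> a" if "0 \<le> a" "0 \<le> b" "b \<le> 1" for a b :: real
        using that by (simp add: mult_left_le)
      show ?thesis
        unfolding eq by (rule aux) (use R r[OF that, of "\<phi> m"] in auto)
    qed
    have "(\<lambda>m. X v i m j - sc (\<phi> m) (q (\<phi> m)) j) \<longlonglongrightarrow> 0"
      by (rule Lim_null_comparison[OF always_eventually null]) (rule allI, rule bound)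
    from tendsto_add[OF this lim[OF that(3)]] show ?thesis by simp
  qed
  have F_lim: "(\<lambda>m. F (X v i m) i) \<longlonglongrightarrow> F x i" if "i < n" "v = 0 \<or> v = 1" for v i
    using that by (intro cont X_box X_lim x)
  show ?thesis
  proof (intro exI[of _ x] allI impI conjI)
    fix i assume i: "i < n"
    then show "x i \<in> {0..R}" by (rule x)
    show "x i = 0 \<or> 0 \<le> F x i"
    proof (rule disjCI)
      \<comment> \<open>By continuity F is then negative at the nearby vertices with label 0, which
        forces them onto the face 0, and x i is a limit of zeros.\<close>
      assume "\<not> 0 \<le> F x i"
      then have "\<forall>\<^sub>F m in sequentially. F (X 0 i m) i < 0"
        using order_tendstoD(2)[OF F_lim[OF i, of 0], of 0] by auto
      then have "\<forall>\<^sub>F m in sequentially. X 0 i m i = 0"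
      proof eventually_elim
        case (elim m)
        define \<rho> where "\<rho> = r 0 (\<phi> m) i"
        have X: "X 0 i m = sc (\<phi> m) \<rho>" by (simp only: X_def \<rho>_def)
        have "lab (\<phi> m) \<rho> i = 0" unfolding \<rho>_def by (rule lab_r[OF i]) simp
        then have "\<rho> i = 0"
          using elim unfolding lab_def X by (simp split: if_splits)
        then show ?case unfolding X sc_def by simp
      qed
      then have "(\<lambda>m. X 0 i m i) \<longlonglongrightarrow> 0" by (rule tendsto_eventually)
      with X_lim[OF i _ i, of 0] show "x i = 0" using LIMSEQ_unique by blast
    qed
    show "x i = R \<or> F x i \<le> 0"
    proof (rule disjCI)
      assume "\<not> F x i \<le> 0"
      then have "\<forall>\<^sub>F m in sequentially. 0 < F (X 1 i m) i"
        using order_tendstoD(1)[OF F_lim[OF i, of 1], of 0] by auto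
      then have "\<forall>\<^sub>F m in sequentially. X 1 i m i = R"
      proof eventually_elim
        case (elim m)
        define \<rho> where "\<rho> = r 1 (\<phi> m) i"
        have X: "X 1 i m = sc (\<phi> m) \<rho>" by (simp only: X_def \<rho>_def)
        have "lab (\<phi> m) \<rho> i = 1" unfolding \<rho>_def by (rule lab_r[OF i]) simp
        then have "\<rho> i = Suc (\<phi> m)"
          using elim unfolding lab_def X by (simp split: if_splits)
        then show ?case unfolding X sc_def by simp
      qed
      then have "(\<lambda>m. X 1 i m i) \<longlonglongrightarrow> R" by (rule tendsto_eventually)
      with X_lim[OF i _ i, of 1] show "x i = R" using LIMSEQ_unique by blast
    qed
  qed
qed

section \<open>From the matrix semigroup to a Markov chain\<close>

context stochastic_matrix
begin

lemma markov_chain_unif: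
  fixes e :: "'a \<Rightarrow> 's"
  assumes ne: "I \<noteq> {}" and inj: "inj_on e I"
  shows "\<exists>\<Omega> :: (real \<Rightarrow> 's) measure. markov_chain \<Omega> (\<lambda>t f. f t) (e ` I) \<and>
    (\<forall>t\<ge>0. \<forall>x\<in>I. \<forall>y\<in>I. trans_prob \<Omega> (\<lambda>t f. f t) t (e x) (e y) = P t x y)"
proof -
  obtain code' :: "'a \<Rightarrow> nat" where "inj_on code' I"
    using finite_imp_inj_to_nat_seg[OF finite_I] by blast
  define code where "code x = real (code' x)" for x
  have code: "inj_on code I"
    using \<open>inj_on code' I\<close> by (auto simp: code_def inj_on_def)
  define row where "row t x = embed_pmf (\<lambda>y. if y \<in> I then P t x y else 0)" for t x
  have pmf_row: "pmf (row t x) y = (if y \<in> I then P t x y else 0)" if "0 \<le> t" "x \<in> I" for t x y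
    unfolding row_def
  proof (rule pmf_embed_pmf)
    have "(\<integral>\<^sup>+y. ennreal (if y \<in> I then P t x y else 0) \<partial>count_space UNIV) = (\<Sum>y\<in>I. ennreal (P t x y))"
      using finite_I by (subst nn_integral_count_space'[of I]) auto
    also have "\<dots> = 1"
      using unif_nonneg that unif_row_sum by (simp add: sum_ennreal)
    finally show "(\<integral>\<^sup>+y. ennreal (if y \<in> I then P t x y else 0) \<partial>count_space UNIV) = 1" .
  qed (use unif_nonneg that in auto)
  have set_row: "set_pmf (row t x) \<subseteq> I" if "0 \<le> t" "x \<in> I" for t x
    using pmf_row[OF that] by (auto simp: set_pmf_eq)
  have row_zero: "row 0 x = return_pmf x" if "x \<in> I" for x
    by (rule pmf_eqI) (use that in \<open>auto simp: pmf_row unif_zero indicator_def\<close>)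
  have row_add: "bind_pmf (row s x) (row t) = row (s + t) x" if "0 \<le> s" "0 \<le> t" "x \<in> I" for s t x
  proof (rule pmf_eqI)
    fix y
    have "pmf (bind_pmf (row s x) (row t)) y = (\<Sum>z\<in>I. pmf (row t z) y * pmf (row s x) z)"
      unfolding pmf_bind using finite_I set_row[OF that(1,3)] by (intro integral_measure_pmf_real) auto
    also have "\<dots> = pmf (row (s + t) x) y"
      using that by (simp add: pmf_row unif_add mult.commute)
    finally show "pmf (bind_pmf (row s x) (row t)) y = pmf (row (s + t) x) y" .
  qed
  \<comment> \<open>\<open>jump_semigroup\<close> asks for a kernel on all reals, so reals that code
    no state are absorbing.\<close>
  define ker where "ker t r = (if r \<in> code ` I then map_pmf code (row t (inv_into I code r)) else return_pmf r)" for t r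
  have ker_code: "ker t (code x) = map_pmf code (row t x)" if "x \<in> I" for t x
    using that code by (simp add: ker_def)
  \<comment> \<open>The uniform initial law charges every state, as \<open>markov_chain\<close>
    demands.\<close>
  interpret js: jump_semigroup ker "pmf_of_set (code ` I)" "code ` I" c
  proof
    show "ker 0 r = return_pmf r" for r
      by (cases "r \<in> code ` I") (auto simp: ker_code row_zero, simp add: ker_def)
    show "bind_pmf (ker s r) (ker t) = ker (s + t) r" if st: "0 \<le> s" "0 \<le> t" for s t r
    proof (cases "r \<in> code ` I")
      case True
      then obtain x where x: "x \<in> I" "r = code x" by auto
      have "bind_pmf (ker s r) (ker t) = bind_pmf (row s x) (\<lambda>y. ker t (code y))"
        using x by (simp add: ker_code bind_map_pmf)
      also have "\<dots> = bind_pmf (row s x) (\<lambda>y. map_pmf code (row t y))"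
        using set_row[OF st(1) x(1)] by (intro bind_pmf_cong refl ker_code) auto
      also have "\<dots> = map_pmf code (bind_pmf (row s x) (row t))"
        by (simp add: map_bind_pmf)
      finally show ?thesis using x st by (simp add: row_add ker_code)
    next
      case False
      then show ?thesis by (simp add: ker_def bind_return_pmf)
    qed
    show "measure (ker t r) (- {r}) \<le> c * t" if t: "0 \<le> t" for t r
    proof (cases "r \<in> code ` I")
      case True
      then obtain x where x: "x \<in> I" "r = code x" by auto
      have "measure (ker t r) (- {r}) = 1 - pmf (ker t r) r"
        using measure_pmf.prob_compl[of "{r}" "ker t r"] by (simp add: Compl_eq_Diff_UNIV measure_pmf_single)
      also have "pmf (ker t r) r = pmf (row t x) x"
      proof -
        have "pmf (ker t r) r = measure (row t x) (code -` {r})"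
          using x by (simp add: ker_code pmf_map)
        also have "\<dots> = measure (row t x) {x}"
          using set_row[OF t x(1)] x code
          by (intro measure_pmf.finite_measure_eq_AE) (auto simp: AE_measure_pmf_iff inj_on_eq_iff)
        finally show ?thesis by (simp add: measure_pmf_single)
      qed
      finally show ?thesis using unif_diag_ge[OF x(1) t] x t by (simp add: pmf_row)
    next
      case False
      then show ?thesis using c_nonneg t by (simp add: ker_def measure_return_pmf)
    qed
    show "set_pmf (ker t r) \<subseteq> code ` I" if "0 \<le> t" "r \<in> code ` I" for t r
      using that set_row[OF that(1)] by (fastforce simp: ker_code)
    show "set_pmf (pmf_of_set (code ` I)) = code ` I"
      using ne finite_I by simp
  qed
  define e' where "e' r = e (inv_into I code r)" for r
  have e': "e' (code x) = e x" if "x \<in> I" for x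
    using that code by (simp add: e'_def)
  have inj': "inj_on e' (code ` I)"
    using inj by (auto simp: inj_on_def e')
  have img: "e' ` code ` I = e ` I"
    by (auto simp: image_image e' cong: image_cong_simp)
  show ?thesis
  proof (intro exI[of _ "js.path_law e'"] conjI allI impI ballI)
    show "markov_chain (js.path_law e') (\<lambda>t f. f t) (e ` I)"
      using js.markov_chain_path_law[OF inj'] img by simp
    fix t :: real and x y assume t: "0 \<le> t" and xy: "x \<in> I" "y \<in> I"
    have "pmf (map_pmf code (row t x)) (code y) = measure (row t x) {y}"
      unfolding pmf_map using set_row[OF t xy(1)] xy code
      by (intro measure_pmf.finite_measure_eq_AE) (auto simp: AE_measure_pmf_iff inj_on_eq_iff)
    then show "trans_prob (js.path_law e') (\<lambda>t f. f t) t (e x) (e y) = P t x y"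
      using js.trans_prob_path_law[OF inj' t, of "code x" "code y"] xy t
      by (simp add: e' ker_code measure_pmf_single pmf_row)
  qed
qed

end

section \<open>Killed walks on a grid\<close>

locale killed_walk =
  fixes M :: nat and up dn \<kappa> :: "nat \<Rightarrow> real"
  assumes M: "3 \<le> M"
    and up_pos: "j \<in> {2..M - 1} \<Longrightarrow> 0 < up j"
    and dn_pos: "j \<in> {2..M - 1} \<Longrightarrow> 0 < dn j"
    and up_dn: "j \<in> {2..M - 1} \<Longrightarrow> up j + dn j = 1"
    and kill_nonneg: "j \<in> {2..M - 1} \<Longrightarrow> 0 \<le> \<kappa> j"
begin

text \<open>The generator at unit rate without the gain at the cemetery; a row of \<open>gen\<close>
  is its rate times this plus the cemetery term (\<open>sum_gen\<close>).\<close>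

definition Q :: "(nat \<Rightarrow> real) \<Rightarrow> nat \<Rightarrow> real" where
  "Q f j = up j * f (j + 1) + dn j * f (j - 1) - (1 + \<kappa> j) * f j"

text \<open>A sum of indicators rather than nested cases, so that row sums split term by
  term.\<close>

definition gen :: "(nat \<Rightarrow> real) \<Rightarrow> nat \<Rightarrow> nat \<Rightarrow> real" where
  "gen lam r c = (if r \<in> {2..M - 1} then lam r *
     ((if c = r + 1 then up r else 0) + (if c = r - 1 then dn r else 0)
      - (if c = r then 1 + \<kappa> r else 0) + (if c = M + 1 then \<kappa> r else 0)) else 0)"

lemma sum_gen:
  "(\<Sum>c\<in>{1..M + 1}. gen lam r c * f c) =
    (if r \<in> {2..M - 1} then lam r * (Q f r + \<kappa> r * f (M + 1)) else 0)"
proof (cases "r \<in> {2..M - 1}")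
  case True
  have if_mult: "(if b then a * x else 0) = (if b then a else 0) * x" for b and a x :: real
    by simp
  have "(\<Sum>c\<in>{1..M + 1}. gen lam r c * f c) = lam r *
    ((\<Sum>c\<in>{1..M + 1}. if c = r + 1 then up r * f c else 0) + (\<Sum>c\<in>{1..M + 1}. if c = r - 1 then dn r * f c else 0)
      - (\<Sum>c\<in>{1..M + 1}. if c = r then (1 + \<kappa> r) * f c else 0) + (\<Sum>c\<in>{1..M + 1}. if c = M + 1 then \<kappa> r * f c else 0))"
    unfolding sum.distrib[symmetric] sum_subtractf[symmetric] sum_distrib_left
    by (intro sum.cong refl)
       (simp only: gen_def if_P[OF True] if_mult, simp only: distrib_right left_diff_distrib mult.assoc)
  also have "\<dots> = lam r * (Q f r + \<kappa> r * f (M + 1))"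
  proof -
    have "r + 1 \<in> {1..M + 1}" "r - 1 \<in> {1..M + 1}" "r \<in> {1..M + 1}" "M + 1 \<in> {1..M + 1}"
      using True by auto
    then show ?thesis
      unfolding Q_def by (simp only: sum.delta finite_atLeastAtMost if_True)
  qed
  finally show ?thesis using True by simp
qed (auto simp: gen_def)

lemma Q_const_one: "j \<in> {2..M - 1} \<Longrightarrow> Q (\<lambda>_. 1) j = - \<kappa> j"
  using up_dn[of j] by (simp add: Q_def)

text \<open>Uniformization: with constant C the semigroup of this matrix has generator
  \<open>gen lam\<close>, and it is stochastic once C dominates the total rates.\<close>

definition jump_mat :: "(nat \<Rightarrow> real) \<Rightarrow> real \<Rightarrow> nat \<Rightarrow> nat \<Rightarrow> real" where
  "jump_mat lam C x y = (if x = y then 1 else 0) + gen lam x y / C"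

lemma stochastic_jump_mat:
  assumes C: "0 < C" and lam: "\<And>j. j \<in> {2..M - 1} \<Longrightarrow> 0 \<le> lam j"
    and rate: "\<And>j. j \<in> {2..M - 1} \<Longrightarrow> lam j * (1 + \<kappa> j) \<le> C"
  shows "stochastic_matrix {1..M + 1} (jump_mat lam C) C"
proof
  show "0 \<le> jump_mat lam C x y" for x y
  proof (cases "x \<in> {2..M - 1}")
    case True
    then have ne: "x \<noteq> M + 1" "x \<noteq> x - 1" by auto
    show ?thesis
    proof (cases "y = x")
      case y: True
      have "gen lam x x = - (lam x * (1 + \<kappa> x))"
        unfolding gen_def if_P[OF True] using ne by (simp add: algebra_simps)
      then show ?thesis
        using C rate[OF True] by (simp add: jump_mat_def y)
    next
      case False
      have "0 \<le> lam x * ((if y = x + 1 then up x else 0) + (if y = x - 1 then dn x else 0)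
          + (if y = M + 1 then \<kappa> x else 0))"
        using lam[OF True] up_pos[OF True] dn_pos[OF True] kill_nonneg[OF True]
        by (intro mult_nonneg_nonneg add_nonneg_nonneg) simp_all
      then have "0 \<le> gen lam x y"
        by (simp only: gen_def if_P[OF True] if_not_P[OF False] diff_zero)
      then show ?thesis using C by (simp add: jump_mat_def)
    qed
  next
    case False
    have "gen lam x y = 0" by (simp only: gen_def if_not_P[OF False])
    then show ?thesis by (simp add: jump_mat_def)
  qed
  show "(\<Sum>y\<in>{1..M + 1}. jump_mat lam C x y) = 1" if "x \<in> {1..M + 1}" for x
  proof -
    have "(\<Sum>y\<in>{1..M + 1}. gen lam x y) = 0"
      using sum_gen[of lam x "\<lambda>_. 1"] by (simp add: Q_const_one)
    then have "(\<Sum>y\<in>{1..M + 1}. gen lam x y / C) = 0"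
      by (simp only: sum_divide_distrib[symmetric] div_0)
    then show ?thesis using that by (simp add: jump_mat_def sum.distrib del: sum.cl_ivl_Suc)
  qed
qed (use C in auto)

section \<open>Harmonic and superharmonic functions\<close>

lemma recursion_solution:
  obtains f :: "nat \<Rightarrow> real" where "f 1 = 0" "f 2 = a"
    "\<And>j. j \<in> {2..M - 1} \<Longrightarrow> up j * (f (j + 1) - f j) = h j (f j) + dn j * (f j - f (j - 1))"
proof -
  \<comment> \<open>The recursion is of second order: \<open>g n\<close> carries the values at n + 1
    and n + 2, and positivity of \<open>up\<close> allows solving for the next one.\<close>
  define step where "step n xy = (snd xy, snd xy +
      (h (n + 2) (snd xy) + dn (n + 2) * (snd xy - fst xy)) / up (n + 2))" for n and xy :: "real \<times> real"
  define g where "g = rec_nat (0, a) step"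
  define f where "f n = fst (g (n - 1))" for n
  have g: "g 0 = (0, a)" "g (Suc n) = step n (g n)" for n
    by (simp_all add: g_def)
  have snd_g: "snd (g n) = fst (g (Suc n))" for n
    by (simp add: g step_def)
  have "up j * (f (j + 1) - f j) = h j (f j) + dn j * (f j - f (j - 1))" if j: "j \<in> {2..M - 1}" for j
  proof -
    obtain n where n: "j = n + 2" using j by (metis add.commute atLeastAtMost_iff le_Suc_ex)
    have fs: "f j = snd (g n)" "f (j - 1) = fst (g n)" "f (j + 1) = snd (g (Suc n))"
      by (simp_all add: n f_def snd_g)
    show ?thesis
      using up_pos[OF j] unfolding fs by (simp add: g step_def n)
  qed
  moreover have "f 1 = 0" "f 2 = a"
    using snd_g[of 0] by (simp_all add: f_def g numeral_2_eq_2)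
  ultimately show ?thesis using that by blast
qed

text \<open>In increments, harmonicity says that \<open>up\<close> times the right increment is
  \<open>\<kappa> * f\<close> plus \<open>dn\<close> times the left increment, so positivity and
  growth propagate to the right. The value 0 at the cemetery makes the mean conserved.\<close>

lemma increasing_harmonic:
  obtains f where "f 1 = 0" "f (M + 1) = 0" "\<And>j. j \<in> {2..M - 1} \<Longrightarrow> Q f j = 0" "strict_mono_on {1..M} f"
proof -
  obtain f where f: "f 1 = 0" "f 2 = 1"
    "\<And>j. j \<in> {2..M - 1} \<Longrightarrow> up j * (f (j + 1) - f j) = \<kappa> j * f j + dn j * (f j - f (j - 1))"
    using recursion_solution[of 1 "\<lambda>j x. \<kappa> j * x"] by blast
  have inc: "0 \<le> f j \<and> f j < f (Suc j)" if "1 \<le> j" "j < M" for j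
    using that
  proof (induction j rule: dec_induct)
    case base
    then show ?case using f by (simp add: numeral_2_eq_2)
  next
    case (step n)
    then have IH: "0 \<le> f n" "f n < f (Suc n)" by auto
    have n: "Suc n \<in> {2..M - 1}" using step by auto
    have "0 < dn (Suc n) * (f (Suc n) - f n)" "0 \<le> \<kappa> (Suc n) * f (Suc n)"
      using dn_pos[OF n] kill_nonneg[OF n] IH by auto
    then have "0 < up (Suc n) * (f (Suc n + 1) - f (Suc n))"
      unfolding f(3)[OF n] by simp
    then have "f (Suc n) < f (Suc (Suc n))"
      using up_pos[OF n] by (simp add: zero_less_mult_iff)
    then show ?case using IH by auto
  qed
  \<comment> \<open>The recursion leaves an arbitrary value at M + 1, which no interior equation
    reaches.\<close>
  define g where "g j = (if j = M + 1 then 0 else f j)" for j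
  have "f i < f j" if "1 \<le> i" "i < j" "j \<le> M" for i j
    using that(2,3)
  proof (induction j)
    case (Suc j)
    then show ?case using inc[of j] that(1) by (cases "i = j") auto
  qed simp
  then have "strict_mono_on {1..M} g"
    by (auto simp: strict_mono_on_def g_def)
  moreover have "Q g j = 0" if j: "j \<in> {2..M - 1}" for j
  proof -
    have "2 \<le> j" "j < M" using j by auto
    then have "Q g j = up j * (f (j + 1) - f j) - dn j * (f j - f (j - 1)) + (up j + dn j - 1) * f j - \<kappa> j * f j"
      by (simp add: Q_def g_def algebra_simps)
    then show ?thesis using f(3)[OF j] up_dn[OF j] by simp
  qed
  ultimately show ?thesis using that[of g] f M by (simp add: g_def)
qed

text \<open>The increasing function of the grid reflected by j \<mapsto> M + 1 - j, which exchanges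
  up and down.\<close>

lemma decreasing_harmonic:
  obtains f where "f M = 0" "f (M + 1) = 0" "\<And>j. j \<in> {2..M - 1} \<Longrightarrow> Q f j = 0"
    "\<And>i j. 1 \<le> i \<Longrightarrow> i < j \<Longrightarrow> j \<le> M \<Longrightarrow> f j < f i"
proof -
  interpret rev: killed_walk M "\<lambda>j. dn (M + 1 - j)" "\<lambda>j. up (M + 1 - j)" "\<lambda>j. \<kappa> (M + 1 - j)"
  proof
    fix j assume "j \<in> {2..M - 1}"
    then have "M + 1 - j \<in> {2..M - 1}" by auto
    then show "0 < dn (M + 1 - j)" "0 < up (M + 1 - j)" "dn (M + 1 - j) + up (M + 1 - j) = 1" "0 \<le> \<kappa> (M + 1 - j)"
      using up_pos dn_pos up_dn kill_nonneg by (auto simp: add.commute)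
  qed (rule M)
  obtain g where g: "g 1 = 0" "\<And>j. j \<in> {2..M - 1} \<Longrightarrow> rev.Q g j = 0" "strict_mono_on {1..M} g"
    using rev.increasing_harmonic by blast
  define f where "f j = (if j = M + 1 then 0 else g (M + 1 - j))" for j
  have "Q f j = 0" if j: "j \<in> {2..M - 1}" for j
  proof -
    have "M + 1 - j \<in> {2..M - 1}" using j by auto
    moreover have "M + 1 - (M + 1 - j) = j" "M + 1 - j + 1 = M + 1 - (j - 1)" "M + 1 - j - 1 = M + 1 - (j + 1)"
      "j \<noteq> M + 1" "j - 1 \<noteq> M + 1" "j + 1 \<noteq> M + 1"
      using j by auto
    ultimately have "Q f j = rev.Q g (M + 1 - j)"
      unfolding rev.Q_def Q_def f_def by (simp only: if_False)
    then show ?thesis using g(2)[OF \<open>M + 1 - j \<in> {2..M - 1}\<close>] by simp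
  qed
  moreover have "f j < f i" if "1 \<le> i" "i < j" "j \<le> M" for i j
    using strict_mono_onD[OF g(3), of "M + 1 - j" "M + 1 - i"] that by (auto simp: f_def)
  ultimately show ?thesis using that[of f] g M by (simp add: f_def)
qed

text \<open>v bounds the expected number of moves within the grid, whatever the rates. Solving the
  equation without killing suffices, because the term \<open>\<kappa> j * v j\<close> only lowers
  \<open>Q v\<close>.\<close>

lemma superharmonic:
  obtains v where "v (M + 1) = 0" "\<And>j. 0 \<le> v j" "\<And>j. j \<in> {2..M - 1} \<Longrightarrow> Q v j \<le> - 1"
proof -
  obtain f where f: "f 1 = 0" "f 2 = 0"
    "\<And>j. j \<in> {2..M - 1} \<Longrightarrow> up j * (f (j + 1) - f j) = 1 + dn j * (f j - f (j - 1))"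
    using recursion_solution[of 0 "\<lambda>j x. 1"] by blast
  have inc: "f j \<le> f (Suc j)" if "1 \<le> j" "j < M" for j
    using that
  proof (induction j rule: dec_induct)
    case base
    then show ?case using f by (simp add: numeral_2_eq_2)
  next
    case (step n)
    have n: "Suc n \<in> {2..M - 1}" using step by auto
    have "0 \<le> dn (Suc n) * (f (Suc n) - f n)"
      using dn_pos[OF n] step by auto
    then have "0 < up (Suc n) * (f (Suc n + 1) - f (Suc n))"
      unfolding f(3)[OF n] by simp
    then show ?case
      using up_pos[OF n] by (simp add: zero_less_mult_iff)
  qed
  have le: "f j \<le> f M" if "1 \<le> j" "j \<le> M" for j
    using that(2,1)
  proof (induction j rule: inc_induct)
    case (step n)
    then show ?case using inc[of n] by auto
  qed simp
  define v where "v j = (if j \<in> {1..M} then f M - f j else 0)" for j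
  have v: "0 \<le> v j" for j using le by (simp add: v_def)
  have "Q v j \<le> - 1" if j: "j \<in> {2..M - 1}" for j
  proof -
    have "2 \<le> j" "j < M" "1 \<le> j - 1" "j - 1 \<le> M" using j by auto
    then have "Q v j = (up j + dn j - 1) * (f M - f j) - (up j * (f (j + 1) - f j) - dn j * (f j - f (j - 1))) - \<kappa> j * v j"
      by (simp add: Q_def v_def algebra_simps)
    then show ?thesis using f(3)[OF j] up_dn[OF j] mult_nonneg_nonneg[OF kill_nonneg[OF j] v[of j]] by simp
  qed
  then show ?thesis using that[of v] v by (simp add: v_def)
qed

end

section \<open>The law at time s and the means of test functions\<close>

locale killed_chain = killed_walk +
  fixes lam :: "nat \<Rightarrow> real" and C :: real and \<mu> :: "nat \<Rightarrow> real"
  assumes C_pos: "0 < C"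
    and lam_nonneg: "j \<in> {2..M - 1} \<Longrightarrow> 0 \<le> lam j"
    and rate_le: "j \<in> {2..M - 1} \<Longrightarrow> lam j * (1 + \<kappa> j) \<le> C"
    and init_nonneg: "j \<in> {1..M + 1} \<Longrightarrow> 0 \<le> \<mu> j"
    and init_sum: "(\<Sum>j\<in>{1..M + 1}. \<mu> j) = 1"
    and init_alive: "\<mu> (M + 1) = 0"
begin

sublocale sm: stochastic_matrix "{1..M + 1}" "jump_mat lam C" C
  using C_pos lam_nonneg rate_le by (rule stochastic_jump_mat)

abbreviation P where "P \<equiv> unif_semigroup {1..M + 1} (jump_mat lam C) C"

lemma interior_subset: "{2..M - 1} \<subseteq> {1..M + 1}"
  by auto

lemma P_backward:
  assumes "x \<in> {1..M + 1}" "y \<in> {1..M + 1}"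
  shows "((\<lambda>t. P t x y) has_real_derivative (\<Sum>z\<in>{1..M + 1}. gen lam x z * P t z y)) (at t)"
proof -
  have "(\<Sum>z\<in>{1..M + 1}. jump_mat lam C x z * P t z y) =
    (\<Sum>z\<in>{1..M + 1}. (if x = z then P t z y else 0) + gen lam x z * P t z y / C)"
    by (intro sum.cong refl) (simp add: jump_mat_def algebra_simps)
  also have "\<dots> = P t x y + (\<Sum>z\<in>{1..M + 1}. gen lam x z * P t z y) / C"
    unfolding sum.distrib sum_divide_distrib[symmetric] using assms by (simp only: sum.delta' finite_atLeastAtMost if_True)
  finally have "C * ((\<Sum>z\<in>{1..M + 1}. jump_mat lam C x z * P t z y) - P t x y) = (\<Sum>z\<in>{1..M + 1}. gen lam x z * P t z y)"
    using C_pos by simp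
  then show ?thesis using sm.unif_backward[OF assms, of t] by (simp only:)
qed

lemma P_forward:
  assumes "x \<in> {1..M + 1}" "y \<in> {1..M + 1}"
  shows "((\<lambda>t. P t x y) has_real_derivative (\<Sum>z\<in>{1..M + 1}. P t x z * gen lam z y)) (at t)"
proof -
  have "(\<Sum>z\<in>{1..M + 1}. P t x z * jump_mat lam C z y) =
    (\<Sum>z\<in>{1..M + 1}. (if y = z then P t x z else 0) + P t x z * gen lam z y / C)"
    by (intro sum.cong refl) (auto simp: jump_mat_def algebra_simps)
  also have "\<dots> = P t x y + (\<Sum>z\<in>{1..M + 1}. P t x z * gen lam z y) / C"
    unfolding sum.distrib sum_divide_distrib[symmetric] using assms by (simp only: sum.delta' finite_atLeastAtMost if_True)
  finally have "C * ((\<Sum>z\<in>{1..M + 1}. P t x z * jump_mat lam C z y) - P t x y) = (\<Sum>z\<in>{1..M + 1}. P t x z * gen lam z y)"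
    using C_pos by simp
  then show ?thesis using sm.unif_forward[OF assms, of t] by (simp only:)
qed

lemma P_cemetery:
  assumes "j \<in> {1..M}"
  shows "P t (M + 1) j = 0"
proof -
  have "M + 1 \<in> {1..M + 1}" "j \<in> {1..M + 1}" "M + 1 \<notin> {2..M - 1}" using assms by auto
  then have "((\<lambda>t. P t (M + 1) j) has_real_derivative 0) (at t)" for t
    using P_backward[of "M + 1" j t] unfolding sum_gen by (simp only: if_False)
  then have "P t (M + 1) j = P 0 (M + 1) j"
    by (intro DERIV_isconst_all) blast
  also have "\<dots> = 0" unfolding sm.unif_zero using assms by simp
  finally show ?thesis .
qed

definition u :: "real \<Rightarrow> nat \<Rightarrow> real" where
  "u s j = (\<Sum>m\<in>{1..M + 1}. \<mu> m * P s m j)"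

definition drift :: "real \<Rightarrow> nat \<Rightarrow> real" where
  "drift s j = (\<Sum>z\<in>{1..M + 1}. u s z * gen lam z j)"

definition mean :: "(nat \<Rightarrow> real) \<Rightarrow> real \<Rightarrow> real" where
  "mean f s = (\<Sum>j\<in>{1..M + 1}. u s j * f j)"

lemma u_nonneg: "j \<in> {1..M + 1} \<Longrightarrow> 0 \<le> s \<Longrightarrow> 0 \<le> u s j"
  unfolding u_def by (intro sum_nonneg mult_nonneg_nonneg init_nonneg sm.unif_nonneg)

lemma u_sum: "(\<Sum>j\<in>{1..M + 1}. u s j) = 1"
proof -
  have "(\<Sum>j\<in>{1..M + 1}. u s j) = (\<Sum>m\<in>{1..M + 1}. \<mu> m * (\<Sum>j\<in>{1..M + 1}. P s m j))"
    unfolding u_def sum_distrib_left by (rule sum.swap)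
  also have "\<dots> = (\<Sum>m\<in>{1..M + 1}. \<mu> m)"
    using sm.unif_row_sum by (intro sum.cong refl) (simp only: mult_1_right)
  finally show ?thesis by (simp only: init_sum)
qed

lemma u_zero: "j \<in> {1..M + 1} \<Longrightarrow> u 0 j = \<mu> j"
proof -
  assume j: "j \<in> {1..M + 1}"
  have "u 0 j = (\<Sum>m\<in>{1..M + 1}. if m = j then \<mu> m else 0)"
    unfolding u_def sm.unif_zero by (intro sum.cong refl) simp
  then show ?thesis using j by (simp only: sum.delta finite_atLeastAtMost if_True)
qed

lemma u_deriv:
  assumes "j \<in> {1..M + 1}"
  shows "((\<lambda>s. u s j) has_real_derivative drift s j) (at s)"
proof -
  have "((\<lambda>s. u s j) has_real_derivative
      (\<Sum>m\<in>{1..M + 1}. \<mu> m * (\<Sum>z\<in>{1..M + 1}. P s m z * gen lam z j))) (at s)"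
    unfolding u_def using assms by (intro DERIV_sum DERIV_cmult P_forward)
  moreover have "(\<Sum>m\<in>{1..M + 1}. \<mu> m * (\<Sum>z\<in>{1..M + 1}. P s m z * gen lam z j)) = drift s j"
    unfolding drift_def u_def sum_distrib_left sum_distrib_right by (subst sum.swap) (simp only: mult.assoc)
  ultimately show ?thesis by (simp only:)
qed

lemma sum_interior:
  "(\<Sum>m\<in>{1..M + 1}. w m * (if m \<in> {2..M - 1} then h m else 0)) = (\<Sum>m\<in>{2..M - 1}. w m * (h m :: real))"
  using interior_subset by (intro sum.mono_neutral_cong_right) auto

text \<open>Dynkin's formula in differential form; the value 0 at the cemetery removes the gain from
  killing.\<close>

lemma mean_deriv:
  assumes "f (M + 1) = 0"
  shows "(mean f has_real_derivative (\<Sum>m\<in>{2..M - 1}. u s m * (lam m * Q f m))) (at s)"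
proof -
  have "(mean f has_real_derivative (\<Sum>j\<in>{1..M + 1}. drift s j * f j)) (at s)"
    unfolding mean_def by (intro DERIV_sum DERIV_cmult_right u_deriv)
  moreover have "(\<Sum>j\<in>{1..M + 1}. drift s j * f j) = (\<Sum>z\<in>{1..M + 1}. u s z * (\<Sum>j\<in>{1..M + 1}. gen lam z j * f j))"
    unfolding drift_def sum_distrib_left sum_distrib_right by (subst sum.swap) (simp only: mult.assoc)
  ultimately show ?thesis
    unfolding sum_gen sum_interior assms by (simp only: mult_zero_right add_0_right)
qed

text \<open>\<open>Q f m\<close> may be nonzero where the rate vanishes. In this way the mean of the
  Green function of a site with rate 0 is conserved.\<close>

lemma mean_const:
  assumes "f (M + 1) = 0" "\<And>m. m \<in> {2..M - 1} \<Longrightarrow> lam m * Q f m = 0"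
  shows "mean f s = mean f 0"
proof -
  have "(mean f has_real_derivative 0) (at r)" for r
  proof -
    have "(\<Sum>m\<in>{2..M - 1}. u r m * (lam m * Q f m)) = 0"
      by (intro sum.neutral ballI) (simp only: assms(2) mult_zero_right)
    then show ?thesis
      using mean_deriv[of f r, OF assms(1)] by (simp only:)
  qed
  then show ?thesis using DERIV_isconst_all[of "mean f" s 0] by blast
qed

lemma mean_zero: "mean f 0 = (\<Sum>j\<in>{1..M + 1}. \<mu> j * f j)"
  unfolding mean_def by (intro sum.cong refl) (simp only: u_zero)

text \<open>Differentiates u (r + \<tau>) in \<tau> by the backward equation. The left side depends
  on the sum only, so a fixed time may be split at any r.\<close>

lemma drift_shift:
  assumes j: "j \<in> {1..M}"
  shows "drift (r + \<tau>) j = (\<Sum>m\<in>{2..M - 1}. u r m * (lam m * Q (\<lambda>x. P \<tau> x j) m))"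
proof -
  have j': "j \<in> {1..M + 1}" using j by auto
  have "u (r + \<sigma>) j = (\<Sum>z\<in>{1..M + 1}. u r z * P \<sigma> z j)" for \<sigma>
  proof -
    have "u (r + \<sigma>) j = (\<Sum>m\<in>{1..M + 1}. \<mu> m * (\<Sum>z\<in>{1..M + 1}. P r m z * P \<sigma> z j))"
      unfolding u_def using sm.unif_add[OF _ j'] by (intro sum.cong refl) (simp only:)
    also have "\<dots> = (\<Sum>z\<in>{1..M + 1}. u r z * P \<sigma> z j)"
      unfolding u_def sum_distrib_left sum_distrib_right by (subst sum.swap) (simp only: mult.assoc)
    finally show ?thesis .
  qed
  then have eq: "(\<lambda>\<sigma>. u (r + \<sigma>) j) = (\<lambda>\<sigma>. \<Sum>z\<in>{1..M + 1}. u r z * P \<sigma> z j)" by blast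
  have "((\<lambda>\<sigma>. u (r + \<sigma>) j) has_real_derivative drift (r + \<tau>) j) (at \<tau>)"
    using u_deriv[OF j', of "r + \<tau>"] by (simp only: DERIV_shift add.commute[of r])
  moreover have "((\<lambda>\<sigma>. u (r + \<sigma>) j) has_real_derivative
      (\<Sum>z\<in>{1..M + 1}. u r z * (\<Sum>w\<in>{1..M + 1}. gen lam z w * P \<tau> w j))) (at \<tau>)"
    unfolding eq using j' by (intro DERIV_sum DERIV_cmult P_backward)
  ultimately have "drift (r + \<tau>) j = (\<Sum>z\<in>{1..M + 1}. u r z * (\<Sum>w\<in>{1..M + 1}. gen lam z w * P \<tau> w j))"
    by (rule DERIV_unique)
  then show ?thesis
    unfolding sum_gen sum_interior P_cemetery[OF j] by (simp only: mult_zero_right add_0_right)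
qed

text \<open>The two neighbours contribute at most up + dn = 1. The constant is the one that
  \<open>Q v \<le> - 1\<close> compensates.\<close>

lemma Q_transition_le_one:
  assumes "m \<in> {2..M - 1}" "j \<in> {1..M}" "0 \<le> \<tau>"
  shows "Q (\<lambda>x. P \<tau> x j) m \<le> 1"
proof -
  have le1: "P \<tau> x j \<le> 1" and ge0: "0 \<le> P \<tau> x j" if "x \<in> {1..M + 1}" for x
  proof -
    have j: "j \<in> {1..M + 1}" using assms by auto
    show "0 \<le> P \<tau> x j" using that j assms(3) by (rule sm.unif_nonneg)
    have "P \<tau> x j \<le> (\<Sum>y\<in>{1..M + 1}. P \<tau> x y)"
      using j sm.unif_nonneg[OF that _ assms(3)] by (intro member_le_sum) auto
    then show "P \<tau> x j \<le> 1" by (simp only: sm.unif_row_sum[OF that])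
  qed
  have in_I: "m + 1 \<in> {1..M + 1}" "m - 1 \<in> {1..M + 1}" "m \<in> {1..M + 1}" using assms(1) by auto
  have "up m * P \<tau> (m + 1) j \<le> up m * 1" "dn m * P \<tau> (m - 1) j \<le> dn m * 1"
    using up_pos[OF assms(1)] dn_pos[OF assms(1)] le1[OF in_I(1)] le1[OF in_I(2)]
    by (auto intro!: mult_left_mono)
  moreover have "0 \<le> (1 + \<kappa> m) * P \<tau> m j"
    using kill_nonneg[OF assms(1)] ge0[OF in_I(3)] by simp
  ultimately show ?thesis
    using up_dn[OF assms(1)] unfolding Q_def by linarith
qed

text \<open>The semigroup commutes with its generator, so \<open>s * drift s j\<close> is an integral over \<open>[0, s]\<close> of terms
  bounded by the current jump rate; hence it is at most the expected number of jumps, which \<open>v\<close> bounds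
  uniformly in the rates.\<close>

lemma drift_bound:
  assumes v: "v (M + 1) = 0" "\<And>j. 0 \<le> v j" "\<And>j. j \<in> {2..M - 1} \<Longrightarrow> Q v j \<le> - 1"
    and j: "j \<in> {1..M}" and s: "0 \<le> s"
  shows "mean v s + s * drift s j \<le> mean v 0"
proof -
  let ?F = "\<lambda>r. mean v r + r * drift s j"
  have "?F s \<le> ?F 0"
  proof (rule DERIV_nonpos_imp_nonincreasing[OF s])
    fix r assume r: "0 \<le> r" "r \<le> s"
    have "(?F has_real_derivative (\<Sum>m\<in>{2..M - 1}. u r m * (lam m * Q v m)) + 1 * drift s j) (at r)"
      by (intro DERIV_add mean_deriv v(1) DERIV_cmult_right DERIV_ident)
    moreover have "(\<Sum>m\<in>{2..M - 1}. u r m * (lam m * Q v m)) + 1 * drift s j \<le> 0"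
    proof -
      \<comment> \<open>Splitting s at r puts the constant \<open>drift s j\<close> over the same
        weights \<open>u r m * lam m\<close> as the derivative of \<open>mean v\<close>.\<close>
      have "drift s j = (\<Sum>m\<in>{2..M - 1}. u r m * (lam m * Q (\<lambda>x. P (s - r) x j) m))"
        using drift_shift[OF j, of r "s - r"] by simp
      then have "(\<Sum>m\<in>{2..M - 1}. u r m * (lam m * Q v m)) + 1 * drift s j =
        (\<Sum>m\<in>{2..M - 1}. u r m * (lam m * (Q v m + Q (\<lambda>x. P (s - r) x j) m)))"
        by (simp only: mult_1_left sum.distrib[symmetric] distrib_left)
      also have "\<dots> \<le> 0"
      proof (rule sum_nonpos)
        fix m assume m: "m \<in> {2..M - 1}"
        have "Q v m + Q (\<lambda>x. P (s - r) x j) m \<le> 0"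
          using v(3)[OF m] Q_transition_le_one[OF m j, of "s - r"] r by linarith
        moreover have "0 \<le> u r m" "0 \<le> lam m"
          using u_nonneg[of m r] interior_subset m r lam_nonneg by blast+
        ultimately show "u r m * (lam m * (Q v m + Q (\<lambda>x. P (s - r) x j) m)) \<le> 0"
          by (simp add: mult_nonneg_nonpos)
      qed
      finally show ?thesis .
    qed
    ultimately show "\<exists>y. (?F has_real_derivative y) (at r) \<and> y \<le> 0" by blast
  qed
  then show ?thesis by simp
qed

lemma mean_bounds:
  assumes "\<And>j. 0 \<le> v j" "\<And>j. j \<in> {1..M + 1} \<Longrightarrow> v j \<le> V" "0 \<le> s"
  shows "0 \<le> mean v s" "mean v s \<le> V"
proof -
  show "0 \<le> mean v s"
    unfolding mean_def using assms u_nonneg by (intro sum_nonneg mult_nonneg_nonneg) auto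
  have "mean v s \<le> (\<Sum>j\<in>{1..M + 1}. u s j * V)"
    unfolding mean_def using assms u_nonneg by (intro sum_mono mult_left_mono) auto
  also have "\<dots> = V"
    by (simp only: sum_distrib_right[symmetric] u_sum mult_1_left)
  finally show "mean v s \<le> V" .
qed

text \<open>The mean of v lies between 0 and V, so it drops by at most V. Mass c at time t forces
  mass c / 2 at j throughout a preceding stretch, on which the mean drops at speed at least
  \<open>lam j * (c / 2)\<close>.\<close>

lemma rate_bound:
  assumes v: "v (M + 1) = 0" "\<And>j. 0 \<le> v j" "\<And>j. j \<in> {2..M - 1} \<Longrightarrow> Q v j \<le> - 1"
    "\<And>j. j \<in> {1..M + 1} \<Longrightarrow> v j \<le> V"
    and V: "0 < V" and t: "0 < t" and c: "0 < c" and j: "j \<in> {2..M - 1}" and large: "c \<le> u t j"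
  shows "lam j * (c / 2) * min (t / 2) (c * t / (4 * V)) \<le> V"
proof -
  \<comment> \<open>The first bound keeps the stretch after t / 2, where the drift is at most 2 V /
    t; the second limits the growth over the stretch to c / 2.\<close>
  define d where "d = min (t / 2) (c * t / (4 * V))"
  have d: "0 < d" "d \<le> t / 2" "2 * V / t * d \<le> c / 2"
  proof -
    show "0 < d" "d \<le> t / 2" using V t c by (simp_all add: d_def)
    have "2 * V / t * d \<le> 2 * V / t * (c * t / (4 * V))"
      using V t by (intro mult_left_mono) (simp_all add: d_def)
    also have "\<dots> = c / 2" using V t by (simp add: field_simps)
    finally show "2 * V / t * d \<le> c / 2" .
  qed
  have jM: "j \<in> {1..M}" "j \<in> {1..M + 1}" using j by auto
  have drift_le: "drift x j \<le> 2 * V / t" if x: "t / 2 \<le> x" for x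
  proof -
    have x0: "0 \<le> x" using x t by linarith
    have "mean v x + x * drift x j \<le> mean v 0"
      using v(1-3) jM(1) x0 by (rule drift_bound)
    then have "x * drift x j \<le> V"
      using mean_bounds(1)[of v V x, OF v(2) v(4) x0] mean_bounds(2)[of v V 0, OF v(2) v(4)] by simp
    then have "drift x j \<le> V / x" using x t by (simp add: le_divide_eq mult.commute)
    also have "\<dots> \<le> V / (t / 2)" using x t V by (intro divide_left_mono) auto
    finally show ?thesis by (simp add: mult.commute)
  qed
  have low: "c / 2 \<le> u s j" if s: "t - d \<le> s" "s \<le> t" for s
  proof -
    have "u t j - 2 * V / t * t \<le> u s j - 2 * V / t * s"
    proof (rule DERIV_nonpos_imp_nonincreasing[OF s(2)])
      fix x assume x: "s \<le> x" "x \<le> t"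
      have "((\<lambda>x. u x j - 2 * V / t * x) has_real_derivative drift x j - 2 * V / t * 1) (at x)"
        by (intro DERIV_diff u_deriv jM(2) DERIV_cmult DERIV_ident)
      moreover have "drift x j - 2 * V / t * 1 \<le> 0"
        using drift_le[of x] x s d by simp
      ultimately show "\<exists>y. ((\<lambda>x. u x j - 2 * V / t * x) has_real_derivative y) (at x) \<and> y \<le> 0" by blast
    qed
    moreover have "2 * V / t * t - 2 * V / t * s \<le> 2 * V / t * d"
    proof -
      have "2 * V / t * (t - s) \<le> 2 * V / t * d"
        using s V t by (intro mult_left_mono) auto
      then show ?thesis by (simp only: right_diff_distrib)
    qed
    ultimately show ?thesis using d(3) large by linarith
  qed
  have "mean v t + lam j * (c / 2) * t \<le> mean v (t - d) + lam j * (c / 2) * (t - d)"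
  proof (rule DERIV_nonpos_imp_nonincreasing[of "t - d" t "\<lambda>x. mean v x + lam j * (c / 2) * x"])
    show "t - d \<le> t" using d by simp
  next
    fix x assume x: "t - d \<le> x" "x \<le> t"
    have x0: "0 \<le> x" using x d t by linarith
    have "((\<lambda>x. mean v x + lam j * (c / 2) * x) has_real_derivative
        (\<Sum>m\<in>{2..M - 1}. u x m * (lam m * Q v m)) + lam j * (c / 2) * 1) (at x)"
      by (intro DERIV_add mean_deriv v(1) DERIV_cmult DERIV_ident)
    moreover have "(\<Sum>m\<in>{2..M - 1}. u x m * (lam m * Q v m)) + lam j * (c / 2) * 1 \<le> 0"
    proof -
      have neg: "u x m * (lam m * Q v m) \<le> - (u x m * lam m)" "0 \<le> u x m * lam m" if m: "m \<in> {2..M - 1}" for m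
      proof -
        have um: "0 \<le> u x m" "0 \<le> lam m"
          using u_nonneg[of m x] interior_subset m x0 lam_nonneg by blast+
        then have "lam m * Q v m \<le> lam m * (- 1)" using v(3)[OF m] by (intro mult_left_mono)
        then have "u x m * (lam m * Q v m) \<le> u x m * (lam m * (- 1))" using um(1) by (rule mult_left_mono)
        then show "u x m * (lam m * Q v m) \<le> - (u x m * lam m)" by simp
        show "0 \<le> u x m * lam m" using um by simp
      qed
      have "(\<Sum>m\<in>{2..M - 1}. u x m * (lam m * Q v m)) \<le> (\<Sum>m\<in>{2..M - 1}. - (u x m * lam m))"
        by (intro sum_mono neg(1))
      also have "\<dots> = - (\<Sum>m\<in>{2..M - 1}. u x m * lam m)" by (simp only: sum_negf)
      also have "\<dots> \<le> - (u x j * lam j)"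
        using j neg(2) by (simp only: neg_le_iff_le) (intro member_le_sum, auto)
      also have "\<dots> \<le> - (c / 2 * lam j)"
        by (simp only: neg_le_iff_le) (rule mult_right_mono[OF low[OF x] lam_nonneg[OF j]])
      finally show ?thesis by (simp add: mult.commute)
    qed
    ultimately show "\<exists>y. ((\<lambda>x. mean v x + lam j * (c / 2) * x) has_real_derivative y) (at x) \<and> y \<le> 0" by blast
  qed
  moreover have "0 \<le> mean v t" "mean v (t - d) \<le> V"
    using mean_bounds(1)[of v V t, OF v(2) v(4)] mean_bounds(2)[of v V "t - d", OF v(2) v(4)] t d by simp_all
  moreover have "lam j * (c / 2) * (t - d) = lam j * (c / 2) * t - lam j * (c / 2) * d"
    by (simp only: right_diff_distrib)
  ultimately show ?thesis unfolding d_def[symmetric] by linarith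
qed

text \<open>No living site is killed at a rate above K, so exp (K s) times the living mass does not
  decrease; f below is the indicator of being alive.\<close>

lemma survival_bound:
  assumes K: "\<And>j. j \<in> {2..M - 1} \<Longrightarrow> lam j * \<kappa> j \<le> K" and t: "0 \<le> t" and K0: "0 \<le> K"
  shows "exp (- t * K) \<le> (\<Sum>j\<in>{1..M}. u t j)"
proof -
  define f :: "nat \<Rightarrow> real" where "f j = (if j = M + 1 then 0 else 1)" for j
  have mean_f: "mean f s = (\<Sum>j\<in>{1..M}. u s j)" for s
  proof -
    have "mean f s = (\<Sum>j\<in>insert (M + 1) {1..M}. u s j * f j)"
      unfolding mean_def by (intro sum.cong refl) auto
    also have "\<dots> = (\<Sum>j\<in>{1..M}. u s j)"
      by (subst sum.insert) (auto simp: f_def intro!: sum.cong)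
    finally show ?thesis .
  qed
  have Qf: "Q f m = - \<kappa> m" if "m \<in> {2..M - 1}" for m
  proof -
    have "m + 1 \<noteq> M + 1" "m - 1 \<noteq> M + 1" "m \<noteq> M + 1" using that by auto
    then show ?thesis using up_dn[OF that] by (simp add: Q_def f_def)
  qed
  have "exp (K * 0) * mean f 0 \<le> exp (K * t) * mean f t"
  proof (rule DERIV_nonneg_imp_nondecreasing[OF t])
    fix x assume x: "0 \<le> x" "x \<le> t"
    have E: "((\<lambda>x. exp (K * x)) has_real_derivative exp (K * x) * K) (at x)"
      by (auto intro!: derivative_eq_intros)
    have "f (M + 1) = 0" by (simp add: f_def)
    from DERIV_mult[OF E mean_deriv[of f x, OF this]]
    have "((\<lambda>x. exp (K * x) * mean f x) has_real_derivative
      exp (K * x) * K * mean f x + (\<Sum>m\<in>{2..M - 1}. u x m * (lam m * Q f m)) * exp (K * x)) (at x)" .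
    moreover have "0 \<le> exp (K * x) * K * mean f x + (\<Sum>m\<in>{2..M - 1}. u x m * (lam m * Q f m)) * exp (K * x)"
    proof -
      have "- (\<Sum>m\<in>{2..M - 1}. u x m * (lam m * Q f m)) = (\<Sum>m\<in>{2..M - 1}. u x m * (lam m * \<kappa> m))"
        unfolding sum_negf[symmetric] by (intro sum.cong refl) (simp only: Qf mult_minus_right minus_minus)
      also have "\<dots> \<le> (\<Sum>m\<in>{2..M - 1}. u x m * K)"
        using u_nonneg x K interior_subset by (intro sum_mono mult_left_mono) auto
      also have "\<dots> \<le> (\<Sum>m\<in>{1..M}. u x m * K)"
        using u_nonneg x K0 by (intro sum_mono2) auto
      also have "\<dots> = K * mean f x"
        unfolding mean_f by (simp only: sum_distrib_left mult.commute)
      finally have "0 \<le> K * mean f x + (\<Sum>m\<in>{2..M - 1}. u x m * (lam m * Q f m))" by linarith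
      then have "0 \<le> exp (K * x) * (K * mean f x + (\<Sum>m\<in>{2..M - 1}. u x m * (lam m * Q f m)))"
        by (intro mult_nonneg_nonneg) auto
      then show ?thesis by (simp only: distrib_left mult_ac)
    qed
    ultimately show "\<exists>y. ((\<lambda>x. exp (K * x) * mean f x) has_real_derivative y) (at x) \<and> 0 \<le> y" by blast
  qed
  moreover have "mean f 0 = 1"
  proof -
    have "mean f 0 = (\<Sum>j\<in>{1..M + 1}. \<mu> j)"
      unfolding mean_zero using init_alive by (intro sum.cong refl) (simp add: f_def)
    then show ?thesis by (simp only: init_sum)
  qed
  ultimately have "1 \<le> exp (K * t) * mean f t" by simp
  then have "exp (- t * K) * 1 \<le> exp (- t * K) * (exp (K * t) * mean f t)"
    by (intro mult_left_mono) auto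
  also have "\<dots> = mean f t"
    by (simp add: mult.assoc[symmetric] exp_add[symmetric] mult.commute)
  finally show ?thesis unfolding mean_f by simp
qed

end

section \<open>The starting mixture, the Green functions and the choice of rates\<close>

context killed_walk
begin

lemma sum_grid: "(\<Sum>j\<in>{1..M}. h j) = h 1 + (\<Sum>j\<in>{2..M - 1}. h j) + (h M :: real)"
proof -
  have "{1..M} = insert 1 (insert M {2..M - 1})" using M by auto
  then have "(\<Sum>j\<in>{1..M}. h j) = (\<Sum>j\<in>insert 1 (insert M {2..M - 1}). h j)" by (simp only:)
  also have "\<dots> = h 1 + (h M + (\<Sum>j\<in>{2..M - 1}. h j))"
    using M by (subst sum.insert, simp, simp, subst sum.insert) auto
  finally show ?thesis by simp
qed

lemma sum_with_cemetery: "(\<Sum>j\<in>{1..M + 1}. h j) = (\<Sum>j\<in>{1..M}. h j) + (h (M + 1) :: real)"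
  by simp

text \<open>The conservation laws of the two harmonic functions fix the starting point and the surviving
  mass before the rates are chosen.\<close>

lemma balanced_start:
  assumes p: "\<And>j. j \<in> {1..M} \<Longrightarrow> 0 < p j"
    and \<psi>: "\<psi> 1 = 0" "strict_mono_on {1..M} \<psi>"
    and \<phi>: "\<phi> M = 0" "\<And>i j. 1 \<le> i \<Longrightarrow> i < j \<Longrightarrow> j \<le> M \<Longrightarrow> \<phi> j < \<phi> i"
  obtains l \<alpha> \<beta> where "l \<in> {2..M}" "0 < \<beta>" "\<beta> \<le> (1::real)" "0 < \<alpha>"
    "\<beta> * \<psi> l + (1 - \<beta>) * \<psi> (l - 1) = \<alpha> * (\<Sum>j\<in>{1..M}. p j * \<psi> j)"
    "\<beta> * \<phi> l + (1 - \<beta>) * \<phi> (l - 1) = \<alpha> * (\<Sum>j\<in>{1..M}. p j * \<phi> j)"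
proof -
  have \<psi>_less: "\<psi> i < \<psi> j" if "1 \<le> i" "i < j" "j \<le> M" for i j
    using strict_mono_onD[OF \<psi>(2), of i j] that by auto
  have \<psi>_nonneg: "0 \<le> \<psi> j" if "1 \<le> j" "j \<le> M" for j
    using \<psi>_less[of 1 j] \<psi>(1) that by (cases "j = 1") auto
  have \<phi>_nonneg: "0 \<le> \<phi> j" if "1 \<le> j" "j \<le> M" for j
    using \<phi>(2)[of j M] \<phi>(1) that by (cases "j = M") auto
  define A B where "A = (\<Sum>j\<in>{1..M}. p j * \<psi> j)" and "B = (\<Sum>j\<in>{1..M}. p j * \<phi> j)"
  have A: "0 < A"
    unfolding A_def
  proof (rule sum_pos2[of _ M])
    show "0 < p M * \<psi> M" using p[of M] \<psi>_less[of 1 M] \<psi>(1) M by auto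
    show "0 \<le> p j * \<psi> j" if "j \<in> {1..M}" for j using p[OF that] \<psi>_nonneg[of j] that by simp
  qed (use M in auto)
  have B: "0 < B"
    unfolding B_def
  proof (rule sum_pos2[of _ 1])
    show "0 < p 1 * \<phi> 1" using p[of 1] \<phi>(2)[of 1 M] \<phi>(1) M by auto
    show "0 \<le> p j * \<phi> j" if "j \<in> {1..M}" for j using p[OF that] \<phi>_nonneg[of j] that by simp
  qed (use M in auto)
  \<comment> \<open>This eliminates \<alpha>: a start satisfies both laws with a common \<alpha>
    exactly when its mean of \<theta> vanishes.\<close>
  define \<theta> where "\<theta> j = B * \<psi> j - A * \<phi> j" for j
  have \<theta>_less: "\<theta> i < \<theta> j" if "1 \<le> i" "i < j" "j \<le> M" for i j
  proof -
    have "B * \<psi> i < B * \<psi> j" "A * \<phi> j < A * \<phi> i"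
      using \<psi>_less[OF that] \<phi>(2)[OF that] A B by simp_all
    then show ?thesis unfolding \<theta>_def by linarith
  qed
  have \<theta>1: "\<theta> 1 < 0"
    using \<phi>(2)[of 1 M] \<phi>(1) \<psi>(1) M A by (simp add: \<theta>_def)
  have \<theta>M: "0 < \<theta> M"
    using \<psi>_less[of 1 M] \<phi>(1) \<psi>(1) M B by (simp add: \<theta>_def)
  \<comment> \<open>By minimality \<theta> is strictly negative at l - 1, which makes the
    interpolation weight \<beta> positive.\<close>
  define l where "l = (LEAST l. 1 \<le> l \<and> 0 \<le> \<theta> l)"
  have l: "1 \<le> l \<and> 0 \<le> \<theta> l" unfolding l_def by (rule LeastI[of _ M]) (use M \<theta>M in auto)
  have lM: "l \<le> M" unfolding l_def by (rule Least_le) (use M \<theta>M in auto)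
  have l2: "2 \<le> l"
  proof (rule ccontr)
    assume "\<not> 2 \<le> l"
    then have "l = 1" using l by linarith
    then show False using l \<theta>1 by simp
  qed
  have prev: "\<theta> (l - 1) < 0"
  proof (rule ccontr)
    assume "\<not> \<theta> (l - 1) < 0"
    then have "l \<le> l - 1" unfolding l_def[symmetric] using l2
      by (subst l_def) (rule Least_le, auto)
    then show False using l2 by simp
  qed
  define \<beta> where "\<beta> = - \<theta> (l - 1) / (\<theta> l - \<theta> (l - 1))"
  have den: "0 < \<theta> l - \<theta> (l - 1)" using prev l by linarith
  have \<beta>: "0 < \<beta>" "\<beta> \<le> 1"
  proof -
    show "0 < \<beta>" unfolding \<beta>_def by (rule divide_pos_pos[OF _ den]) (use prev in linarith)
    show "\<beta> \<le> 1" unfolding \<beta>_def divide_le_eq_1_pos[OF den] using l by linarith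
  qed
  have bal: "\<beta> * \<theta> l + (1 - \<beta>) * \<theta> (l - 1) = 0"
  proof -
    have "\<beta> * (\<theta> l - \<theta> (l - 1)) = - \<theta> (l - 1)" using den by (simp add: \<beta>_def)
    then show ?thesis by (simp add: algebra_simps)
  qed
  define \<alpha> where "\<alpha> = (\<beta> * \<psi> l + (1 - \<beta>) * \<psi> (l - 1)) / A"
  have "0 < \<beta> * \<psi> l" using \<beta> \<psi>_less[of 1 l] \<psi>(1) l2 lM by simp
  moreover have "0 \<le> (1 - \<beta>) * \<psi> (l - 1)" using \<beta> \<psi>_nonneg[of "l - 1"] l2 lM by simp
  ultimately have \<alpha>: "0 < \<alpha>" using A by (simp add: \<alpha>_def)
  have 1: "\<beta> * \<psi> l + (1 - \<beta>) * \<psi> (l - 1) = \<alpha> * A" using A by (simp add: \<alpha>_def)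
  have "A * (\<beta> * \<phi> l + (1 - \<beta>) * \<phi> (l - 1)) = B * (\<beta> * \<psi> l + (1 - \<beta>) * \<psi> (l - 1))"
    using bal by (simp add: \<theta>_def algebra_simps)
  then have "A * (\<beta> * \<phi> l + (1 - \<beta>) * \<phi> (l - 1)) = A * (\<alpha> * B)"
    unfolding 1 by (simp add: mult_ac)
  then have 2: "\<beta> * \<phi> l + (1 - \<beta>) * \<phi> (l - 1) = \<alpha> * B" using A by simp
  show ?thesis
    using that[of l \<beta> \<alpha>] l2 lM \<beta> \<alpha> 1 2 unfolding A_def B_def by simp
qed

text \<open>\<open>g\<close> is the Green function of \<open>j\<close> up to a factor. \<open>g / \<phi>\<close> is piecewise linear in \<open>\<psi> / \<phi>\<close>
  with its only kink at \<open>j\<close>, and a start on two neighbouring points does not see the kink, so Jensen's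
  inequality is strict.\<close>

lemma kink_function:
  assumes p: "\<And>j. j \<in> {1..M} \<Longrightarrow> 0 < p j"
    and \<psi>: "\<psi> 1 = 0" "strict_mono_on {1..M} \<psi>" "\<And>j. j \<in> {2..M - 1} \<Longrightarrow> Q \<psi> j = 0"
    and \<phi>: "\<phi> M = 0" "\<phi> (M + 1) = 0" "\<And>i j. 1 \<le> i \<Longrightarrow> i < j \<Longrightarrow> j \<le> M \<Longrightarrow> \<phi> j < \<phi> i"
      "\<And>j. j \<in> {2..M - 1} \<Longrightarrow> Q \<phi> j = 0"
    and l: "l \<in> {2..M}" and \<alpha>: "0 < \<alpha>"
    and bal: "\<beta> * \<psi> l + (1 - \<beta>) * \<psi> (l - 1) = \<alpha> * (\<Sum>j\<in>{1..M}. p j * \<psi> j)"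
      "\<beta> * \<phi> l + (1 - \<beta>) * \<phi> (l - 1) = \<alpha> * (\<Sum>j\<in>{1..M}. p j * \<phi> j)"
    and j: "j \<in> {2..M - 1}"
  obtains g where "g 1 = 0" "g M = 0" "g (M + 1) = 0" "\<And>m. m \<in> {1..M} \<Longrightarrow> 0 \<le> g m"
    "\<And>m. m \<in> {2..M - 1} \<Longrightarrow> m \<noteq> j \<Longrightarrow> Q g m = 0"
    "(\<Sum>m\<in>{1..M}. \<alpha> * p m * g m) < \<beta> * g l + (1 - \<beta>) * g (l - 1)"
proof -
  have jb: "2 \<le> j" "j < M" using j by auto
  have lb: "2 \<le> l" "l \<le> M" using l by auto
  have \<psi>_less: "\<psi> i < \<psi> j" if "1 \<le> i" "i < j" "j \<le> M" for i j
    using strict_mono_onD[OF \<psi>(2), of i j] that by auto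
  have \<psi>_le: "\<psi> i \<le> \<psi> j" if "1 \<le> i" "i \<le> j" "j \<le> M" for i j
    using \<psi>_less[of i j] that by (cases "i = j") auto
  have \<phi>_le: "\<phi> j \<le> \<phi> i" if "1 \<le> i" "i \<le> j" "j \<le> M" for i j
    using \<phi>(3)[of i j] that by (cases "i = j") auto
  have \<psi>_nonneg: "0 \<le> \<psi> m" if "m \<in> {1..M}" for m using \<psi>_le[of 1 m] \<psi>(1) that by auto
  have \<phi>_nonneg: "0 \<le> \<phi> m" if "m \<in> {1..M}" for m using \<phi>_le[of m M] \<phi>(1) that by auto
  have pos: "0 < \<psi> j" "0 < \<phi> j" "0 < \<psi> M" "0 < \<phi> 1"
    using \<psi>_less[of 1 j] \<psi>_less[of 1 M] \<phi>(3)[of j M] \<phi>(3)[of 1 M] \<psi>(1) \<phi>(1) jb by auto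
  \<comment> \<open>Two multiples glued at j, where they agree. By monotonicity g is the smaller of
    the two on the whole grid.\<close>
  define g where "g m = (if m \<le> j then \<phi> j * \<psi> m else \<psi> j * \<phi> m)" for m
  have g_alt: "g m = \<psi> j * \<phi> m" if "j \<le> m" for m
    using that by (cases "m = j") (simp_all add: g_def mult.commute)
  have g_le_\<psi>: "g m \<le> \<phi> j * \<psi> m" if "m \<in> {1..M}" for m
  proof (cases "m \<le> j")
    case False
    then have "\<psi> j * \<phi> m \<le> \<psi> m * \<phi> j"
      using that jb \<psi>_le[of j m] \<phi>_le[of j m] \<psi>_nonneg[of m] \<phi>_nonneg[of m] by (intro mult_mono) auto
    then show ?thesis using False by (simp add: g_def mult.commute)
  qed (simp add: g_def)
  have g_le_\<phi>: "g m \<le> \<psi> j * \<phi> m" if "m \<in> {1..M}" for m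
  proof (cases "m \<le> j")
    case True
    then have "\<phi> j * \<psi> m \<le> \<phi> m * \<psi> j"
      using that jb \<psi>_le[of m j] \<phi>_le[of m j] \<psi>_nonneg[of m] \<phi>_nonneg[of m] by (intro mult_mono) auto
    then show ?thesis using True by (simp add: g_def mult.commute)
  qed (simp add: g_def)
  have g1: "g 1 = 0" using jb \<psi>(1) by (simp add: g_def)
  have gM: "g M = 0" using jb by (simp add: g_def \<phi>(1))
  have gD: "g (M + 1) = 0" using jb \<phi>(2) by (simp add: g_def)
  have g_nonneg: "0 \<le> g m" if "m \<in> {1..M}" for m
    using \<psi>_nonneg[OF that] \<phi>_nonneg[OF that] pos by (simp add: g_def)
  have harmonic: "Q g m = 0" if m: "m \<in> {2..M - 1}" "m \<noteq> j" for m
  proof (cases "m < j")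
    case True
    then have "m - 1 \<le> j" "m \<le> j" "m + 1 \<le> j" by auto
    then have "Q g m = \<phi> j * Q \<psi> m"
      unfolding Q_def by (simp only: g_def if_True) (simp add: algebra_simps)
    then show ?thesis using \<psi>(3)[OF m(1)] by simp
  next
    case False
    then have "j \<le> m - 1" "j \<le> m" "j \<le> m + 1" using m by auto
    then have "Q g m = \<psi> j * Q \<phi> m"
      unfolding Q_def by (simp only: g_alt) (simp add: algebra_simps)
    then show ?thesis using \<phi>(4)[OF m(1)] by simp
  qed
  \<comment> \<open>The points l - 1 and l lie in the same branch of g. Strictness comes from the
    end point where g vanishes and the continuation of that branch does not.\<close>
  have strict: "(\<Sum>m\<in>{1..M}. \<alpha> * p m * g m) < \<beta> * g l + (1 - \<beta>) * g (l - 1)"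
  proof (cases "l \<le> j")
    case True
    have "(\<Sum>m\<in>{1..M}. \<alpha> * p m * g m) < (\<Sum>m\<in>{1..M}. \<alpha> * p m * (\<phi> j * \<psi> m))"
    proof (rule sum_strict_mono_ex1)
      show "\<forall>m\<in>{1..M}. \<alpha> * p m * g m \<le> \<alpha> * p m * (\<phi> j * \<psi> m)"
        using g_le_\<psi> p \<alpha> by (intro ballI mult_left_mono) (auto simp: less_imp_le)
      show "\<exists>m\<in>{1..M}. \<alpha> * p m * g m < \<alpha> * p m * (\<phi> j * \<psi> m)"
        using gM pos p[of M] \<alpha> jb by (intro bexI[of _ M]) auto
    qed simp
    also have "\<dots> = \<phi> j * (\<alpha> * (\<Sum>m\<in>{1..M}. p m * \<psi> m))"
      unfolding sum_distrib_left by (intro sum.cong refl) (simp only: mult_ac)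
    also have "\<dots> = \<phi> j * (\<beta> * \<psi> l + (1 - \<beta>) * \<psi> (l - 1))" by (simp only: bal(1))
    also have "\<dots> = \<beta> * g l + (1 - \<beta>) * g (l - 1)"
    proof -
      have "l - 1 \<le> j" using True by auto
      then show ?thesis using True by (simp only: g_def if_True) (simp add: algebra_simps)
    qed
    finally show ?thesis .
  next
    case False
    have "(\<Sum>m\<in>{1..M}. \<alpha> * p m * g m) < (\<Sum>m\<in>{1..M}. \<alpha> * p m * (\<psi> j * \<phi> m))"
    proof (rule sum_strict_mono_ex1)
      show "\<forall>m\<in>{1..M}. \<alpha> * p m * g m \<le> \<alpha> * p m * (\<psi> j * \<phi> m)"
        using g_le_\<phi> p \<alpha> by (intro ballI mult_left_mono) (auto simp: less_imp_le)
      show "\<exists>m\<in>{1..M}. \<alpha> * p m * g m < \<alpha> * p m * (\<psi> j * \<phi> m)"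
        using g1 pos p[of 1] \<alpha> jb by (intro bexI[of _ 1]) auto
    qed simp
    also have "\<dots> = \<psi> j * (\<alpha> * (\<Sum>m\<in>{1..M}. p m * \<phi> m))"
      unfolding sum_distrib_left by (intro sum.cong refl) (simp only: mult_ac)
    also have "\<dots> = \<psi> j * (\<beta> * \<phi> l + (1 - \<beta>) * \<phi> (l - 1))" by (simp only: bal(2))
    also have "\<dots> = \<beta> * g l + (1 - \<beta>) * g (l - 1)"
    proof -
      have "j \<le> l" "j \<le> l - 1" using False by auto
      then show ?thesis by (simp only: g_alt) (simp add: algebra_simps)
    qed
    finally show ?thesis .
  qed
  show ?thesis using that[of g] g1 gM gD g_nonneg harmonic strict by blast
qed

lemma exists_rates:
  assumes p: "\<And>j. j \<in> {1..M} \<Longrightarrow> 0 < p j" and p_sum: "(\<Sum>j\<in>{1..M}. p j) = 1" and t: "0 < t"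
  obtains lam \<alpha> l \<beta> C where "\<And>j. j \<in> {2..M - 1} \<Longrightarrow> 0 \<le> lam j"
    "\<alpha> \<in> {exp (- t * (MAX j\<in>{2..M - 1}. lam j * \<kappa> j))..1}" "l \<in> {2..M}" "\<beta> \<in> {0<..1}"
    "0 < C" "stochastic_matrix {1..M + 1} (jump_mat lam C) C"
    "\<And>j. j \<in> {1..M} \<Longrightarrow> \<beta> * unif_semigroup {1..M + 1} (jump_mat lam C) C t l j +
      (1 - \<beta>) * unif_semigroup {1..M + 1} (jump_mat lam C) C t (l - 1) j = \<alpha> * p j"
proof -
  obtain \<psi> where \<psi>: "\<psi> 1 = 0" "\<psi> (M + 1) = 0" "\<And>j. j \<in> {2..M - 1} \<Longrightarrow> Q \<psi> j = 0" "strict_mono_on {1..M} \<psi>"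
    using increasing_harmonic by blast
  obtain \<phi> where \<phi>: "\<phi> M = 0" "\<phi> (M + 1) = 0" "\<And>j. j \<in> {2..M - 1} \<Longrightarrow> Q \<phi> j = 0"
    "\<And>i j. 1 \<le> i \<Longrightarrow> i < j \<Longrightarrow> j \<le> M \<Longrightarrow> \<phi> j < \<phi> i"
    using decreasing_harmonic by blast
  obtain v where v: "v (M + 1) = 0" "\<And>j. 0 \<le> v j" "\<And>j. j \<in> {2..M - 1} \<Longrightarrow> Q v j \<le> - 1"
    using superharmonic by blast
  obtain l \<alpha> \<beta> where l: "l \<in> {2..M}" and \<beta>: "0 < \<beta>" "\<beta> \<le> 1" and \<alpha>: "0 < \<alpha>"
    and bal_\<psi>: "\<beta> * \<psi> l + (1 - \<beta>) * \<psi> (l - 1) = \<alpha> * (\<Sum>j\<in>{1..M}. p j * \<psi> j)"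
    and bal_\<phi>: "\<beta> * \<phi> l + (1 - \<beta>) * \<phi> (l - 1) = \<alpha> * (\<Sum>j\<in>{1..M}. p j * \<phi> j)"
    using balanced_start[of p \<psi> \<phi>, OF p \<psi>(1,4) \<phi>(1,4)] by blast
  define \<mu> where "\<mu> j = (if j = l then \<beta> else 0) + (if j = l - 1 then 1 - \<beta> else 0)" for j
  have l_in: "l \<in> {1..M + 1}" "l - 1 \<in> {1..M + 1}" using l by auto
  have \<mu>_sum: "(\<Sum>j\<in>{1..M + 1}. \<mu> j * f j) = \<beta> * f l + (1 - \<beta>) * f (l - 1)" for f :: "nat \<Rightarrow> real"
  proof -
    have "(\<Sum>j\<in>{1..M + 1}. \<mu> j * f j) =
      (\<Sum>j\<in>{1..M + 1}. (if j = l then \<beta> * f j else 0) + (if j = l - 1 then (1 - \<beta>) * f j else 0))"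
      by (intro sum.cong refl) (simp add: \<mu>_def distrib_right)
    then show ?thesis
      using l_in by (simp only: sum.distrib sum.delta finite_atLeastAtMost if_True)
  qed

  define V where "V = 1 + (\<Sum>j\<in>{1..M + 1}. v j)"
  have V: "0 < V" "\<And>j. j \<in> {1..M + 1} \<Longrightarrow> v j \<le> V"
  proof -
    show "0 < V" unfolding V_def using v(2) by (intro add_pos_nonneg sum_nonneg) auto
    show "v j \<le> V" if "j \<in> {1..M + 1}" for j
    proof -
      have "v j \<le> (\<Sum>j\<in>{1..M + 1}. v j)" using that v(2) by (intro member_le_sum) simp_all
      then show ?thesis unfolding V_def by linarith
    qed
  qed
  have int_ne: "{2..M - 1} \<noteq> {}" using M by auto
  have int_sub: "j \<in> {1..M}" if "j \<in> {2..M - 1}" for j using that by auto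
  \<comment> \<open>The smallest interior target. As c, V and d depend only on p, t and the walk, R
    can be fixed before the rates.\<close>
  define c where "c = Min ((\<lambda>j. \<alpha> * p j) ` {2..M - 1})"
  have c_le: "c \<le> \<alpha> * p j" if "j \<in> {2..M - 1}" for j
    unfolding c_def using that by (intro Min_le finite_imageI imageI) simp_all
  have c: "0 < c"
    unfolding c_def using int_ne \<alpha> p int_sub by (subst Min_gr_iff) auto
  define d where "d = min (t / 2) (c * t / (4 * V))"
  have d: "0 < d" using t c V(1) by (simp add: d_def)
  \<comment> \<open>Chosen to violate the conclusion of \<open>rate_bound\<close>, so that no site
    with rate R can carry mass c at time t.\<close>
  define R where "R = V / (c / 2 * d) + 1"
  have R: "0 < R" "V < R * (c / 2) * d"
  proof -
    show "0 < R" unfolding R_def using V(1) c d by (intro add_pos_pos divide_pos_pos) auto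
    have "R * (c / 2) * d = V + c / 2 * d" unfolding R_def using c d by (simp add: field_simps)
    then show "V < R * (c / 2) * d" using c d by simp
  qed
  \<comment> \<open>Dominates every total rate in the box, so that all its points share one
    uniformization constant.\<close>
  define C where "C = R * (1 + (\<Sum>j\<in>{2..M - 1}. \<kappa> j))"
  have C: "0 < C"
    unfolding C_def using R(1) kill_nonneg by (intro mult_pos_pos add_pos_nonneg sum_nonneg) auto
  have rate: "x * (1 + \<kappa> j) \<le> C" if "j \<in> {2..M - 1}" "0 \<le> x" "x \<le> R" for x j
    unfolding C_def
    using that kill_nonneg R(1) member_le_sum[OF that(1), of \<kappa>]
    by (intro mult_mono add_left_mono add_nonneg_nonneg) auto

  \<comment> \<open>\<open>box_complementarity\<close> counts coordinates from 0, the interior sites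
    start at 2.\<close>
  define n where "n = M - 2"
  define rates where "rates x j = x (j - 2)" for x :: "nat \<Rightarrow> real" and j
  have idx: "j - 2 < n" if "j \<in> {2..M - 1}" for j using that M unfolding n_def by auto
  define S where "S x = unif_semigroup {1..M + 1} (jump_mat (rates x) C) C t" for x
  define F where "F x i = \<beta> * S x l (i + 2) + (1 - \<beta>) * S x (l - 1) (i + 2) - \<alpha> * p (i + 2)" for x i
  have stoch: "stochastic_matrix {1..M + 1} (jump_mat (rates x) C) C" if "\<And>j. j < n \<Longrightarrow> x j \<in> {0..R}" for x
  proof (rule stochastic_jump_mat[OF C])
    fix j assume j: "j \<in> {2..M - 1}"
    show "0 \<le> rates x j" "rates x j * (1 + \<kappa> j) \<le> C"
      using that[OF idx[OF j]] rate[OF j] by (simp_all add: rates_def)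
  qed
  have F_cont: "(\<lambda>m. F (X m) i) \<longlonglongrightarrow> F y i"
    if X: "\<And>m j. j < n \<Longrightarrow> X m j \<in> {0..R}" and y: "\<And>j. j < n \<Longrightarrow> y j \<in> {0..R}"
      and lim: "\<And>j. j < n \<Longrightarrow> (\<lambda>m. X m j) \<longlonglongrightarrow> y j" and i: "i < n" for X y i
  proof -
    have K: "(\<lambda>m. jump_mat (rates (X m)) C r s) \<longlonglongrightarrow> jump_mat (rates y) C r s" for r s
    proof (cases "r \<in> {2..M - 1}")
      case True
      have "(\<lambda>m. rates (X m) r) \<longlonglongrightarrow> rates y r"
        unfolding rates_def by (rule lim[OF idx[OF True]])
      then show ?thesis
        unfolding jump_mat_def gen_def if_P[OF True] using C by (intro tendsto_intros) auto
    next
      case False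
      then show ?thesis unfolding jump_mat_def gen_def if_not_P[OF False] by simp
    qed
    have "i + 2 \<in> {1..M + 1}" using i by (simp add: n_def)
    then have "(\<lambda>m. S (X m) r (i + 2)) \<longlonglongrightarrow> S y r (i + 2)" if "r \<in> {1..M + 1}" for r
      unfolding S_def using that by (intro unif_semigroup_tendsto stoch X y K)
    then show "(\<lambda>m. F (X m) i) \<longlonglongrightarrow> F y i"
      unfolding F_def using l_in by (intro tendsto_intros)
  qed
  have "\<exists>x. \<forall>i<n. x i \<in> {0..R} \<and> (x i = 0 \<or> 0 \<le> F x i) \<and> (x i = R \<or> F x i \<le> 0)"
    using R(1) F_cont by (rule box_complementarity)
  then obtain x where sol: "\<forall>i<n. x i \<in> {0..R} \<and> (x i = 0 \<or> 0 \<le> F x i) \<and> (x i = R \<or> F x i \<le> 0)" ..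
  have x: "x i \<in> {0..R}" and x0: "x i = 0 \<or> 0 \<le> F x i" and xR: "x i = R \<or> F x i \<le> 0" if "i < n" for i
    using sol that by simp_all
  define lam where "lam = rates x"
  have lam: "lam j \<in> {0..R}" if "j \<in> {2..M - 1}" for j
    unfolding lam_def rates_def by (rule x[OF idx[OF that]])
  interpret kc: killed_chain M up dn \<kappa> lam C \<mu>
  proof
    show "0 < C" by (rule C)
    fix j
    show "0 \<le> lam j" "lam j * (1 + \<kappa> j) \<le> C" if "j \<in> {2..M - 1}"
      using lam[OF that] rate[OF that] by simp_all
    show "0 \<le> \<mu> j" using \<beta> by (simp add: \<mu>_def)
    show "(\<Sum>j\<in>{1..M + 1}. \<mu> j) = 1" using \<mu>_sum[of "\<lambda>_. 1"] by simp
    show "\<mu> (M + 1) = 0" using l by (auto simp: \<mu>_def)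
  qed
  have u: "kc.u t j = \<beta> * kc.P t l j + (1 - \<beta>) * kc.P t (l - 1) j" for j
    unfolding kc.u_def by (rule \<mu>_sum)
  have F_eq: "F x (j - 2) = kc.u t j - \<alpha> * p j" if "j \<in> {2..M - 1}" for j
  proof -
    have "j - 2 + 2 = j" using that by auto
    then show ?thesis unfolding F_def S_def lam_def[symmetric] u by (simp only:)
  qed
  have ge: "lam j = 0 \<or> \<alpha> * p j \<le> kc.u t j" and le': "lam j = R \<or> kc.u t j \<le> \<alpha> * p j"
    if "j \<in> {2..M - 1}" for j
    using x0[OF idx[OF that]] xR[OF idx[OF that]] F_eq[OF that] unfolding lam_def rates_def by auto
  have le: "kc.u t j \<le> \<alpha> * p j" if j: "j \<in> {2..M - 1}" for j
  proof (rule ccontr)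
    assume "\<not> ?thesis"
    then have "lam j = R" using le'[OF j] by blast
    then have "c \<le> kc.u t j" using ge[OF j] R(1) c_le[OF j] by auto
    from kc.rate_bound[OF v V(2,1) t c j this] have "R * (c / 2) * d \<le> V"
      unfolding \<open>lam j = R\<close> d_def .
    then show False using R(2) by linarith
  qed
  have mean_grid: "kc.mean f s = (\<Sum>j\<in>{1..M}. kc.u s j * f j)" if "f (M + 1) = 0" for f s
    unfolding kc.mean_def sum_with_cemetery using that by (simp only: mult_zero_right add_0_right)
  have pos: "lam j \<noteq> 0" if j: "j \<in> {2..M - 1}" for j
  proof
    assume zero: "lam j = 0"
    obtain g where g: "g 1 = 0" "g M = 0" "g (M + 1) = 0" "\<And>m. m \<in> {1..M} \<Longrightarrow> 0 \<le> g m"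
      "\<And>m. m \<in> {2..M - 1} \<Longrightarrow> m \<noteq> j \<Longrightarrow> Q g m = 0"
      "(\<Sum>m\<in>{1..M}. \<alpha> * p m * g m) < \<beta> * g l + (1 - \<beta>) * g (l - 1)"
      using kink_function[of p \<psi> \<phi> l \<alpha> \<beta> j, OF p \<psi>(1,4,3) \<phi>(1,2,4,3) l \<alpha> bal_\<psi> bal_\<phi> j] by blast
    have "lam m * Q g m = 0" if "m \<in> {2..M - 1}" for m
      using zero g(5)[OF that] by (cases "m = j") auto
    then have const: "kc.mean g t = kc.mean g 0" using g(3) by (intro kc.mean_const)
    have "\<beta> * g l + (1 - \<beta>) * g (l - 1) = kc.mean g t"
      unfolding const kc.mean_zero by (rule \<mu>_sum[symmetric])
    \<comment> \<open>g vanishes at 1 and M, where the law at time t is not yet known, so the bound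
      \<open>le\<close> covers all remaining terms.\<close>
    also have "kc.mean g t = (\<Sum>m\<in>{2..M - 1}. kc.u t m * g m)"
      unfolding mean_grid[of g, OF g(3)] sum_grid g(1,2) by simp
    also have "\<dots> \<le> (\<Sum>m\<in>{2..M - 1}. \<alpha> * p m * g m)"
      using le g(4) int_sub by (intro sum_mono mult_right_mono) auto
    also have "\<dots> = (\<Sum>m\<in>{1..M}. \<alpha> * p m * g m)"
      unfolding sum_grid g(1,2) by simp
    finally show False using g(6) by linarith
  qed
  have eq_int: "kc.u t j = \<alpha> * p j" if "j \<in> {2..M - 1}" for j
    using ge[OF that] le[OF that] pos[OF that] by auto
  have conserve: "(\<Sum>j\<in>{1..M}. kc.u t j * f j) = (\<Sum>j\<in>{1..M}. \<alpha> * p j * f j)"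
    if "f (M + 1) = 0" "\<And>j. j \<in> {2..M - 1} \<Longrightarrow> Q f j = 0"
      "\<beta> * f l + (1 - \<beta>) * f (l - 1) = \<alpha> * (\<Sum>j\<in>{1..M}. p j * f j)" for f
  proof -
    have "(\<Sum>j\<in>{1..M}. kc.u t j * f j) = kc.mean f 0"
      unfolding mean_grid[of f, OF that(1), symmetric]
      by (rule kc.mean_const[of f, OF that(1)]) (simp only: that(2) mult_zero_right)
    also have "\<dots> = \<alpha> * (\<Sum>j\<in>{1..M}. p j * f j)"
      unfolding kc.mean_zero \<mu>_sum by (rule that(3))
    finally show ?thesis by (simp only: sum_distrib_left mult.assoc)
  qed
  have int_cong: "(\<Sum>j\<in>{2..M - 1}. kc.u t j * f j) = (\<Sum>j\<in>{2..M - 1}. \<alpha> * p j * f j)" for f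
    by (intro sum.cong refl) (simp only: eq_int)
  have "kc.u t M * \<psi> M = \<alpha> * p M * \<psi> M"
    using conserve[of \<psi>, OF \<psi>(2,3) bal_\<psi>] unfolding sum_grid int_cong \<psi>(1) by simp
  moreover have "\<psi> M \<noteq> 0" using strict_mono_onD[OF \<psi>(4), of 1 M] \<psi>(1) M by auto
  ultimately have eq_M: "kc.u t M = \<alpha> * p M" by simp
  have "kc.u t 1 * \<phi> 1 = \<alpha> * p 1 * \<phi> 1"
    using conserve[of \<phi>, OF \<phi>(2,3) bal_\<phi>] unfolding sum_grid int_cong \<phi>(1) by simp
  moreover have "\<phi> 1 \<noteq> 0" using \<phi>(4)[of 1 M] \<phi>(1) M by auto
  ultimately have eq_1: "kc.u t 1 = \<alpha> * p 1" by simp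
  have eq: "kc.u t j = \<alpha> * p j" if "j \<in> {1..M}" for j
  proof -
    have "j = 1 \<or> j = M \<or> j \<in> {2..M - 1}" using that by auto
    then show ?thesis using eq_1 eq_M eq_int by blast
  qed
  have mass: "(\<Sum>j\<in>{1..M}. kc.u t j) = \<alpha>"
  proof -
    have "(\<Sum>j\<in>{1..M}. kc.u t j) = (\<Sum>j\<in>{1..M}. \<alpha> * p j)" by (intro sum.cong refl eq)
    then show ?thesis by (simp only: sum_distrib_left[symmetric] p_sum mult_1_right)
  qed
  \<comment> \<open>By \<open>mass\<close>, \<alpha> is the living mass at time t, so both bounds on
    it are statements about survival.\<close>
  have "\<alpha> \<le> 1"
    using kc.u_sum[of t] kc.u_nonneg[of "M + 1" t] t unfolding sum_with_cemetery mass by simp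
  moreover have "exp (- t * (MAX j\<in>{2..M - 1}. lam j * \<kappa> j)) \<le> (\<Sum>j\<in>{1..M}. kc.u t j)"
  proof (rule kc.survival_bound)
    show bound: "lam j * \<kappa> j \<le> (MAX j\<in>{2..M - 1}. lam j * \<kappa> j)" if "j \<in> {2..M - 1}" for j
      using that by (intro Max_ge finite_imageI imageI) simp_all
    have two: "2 \<in> {2..M - 1}" using M by auto
    have "0 \<le> lam 2 * \<kappa> 2" using lam[OF two] kill_nonneg[OF two] by simp
    then show "0 \<le> (MAX j\<in>{2..M - 1}. lam j * \<kappa> j)" using bound[OF two] by linarith
  qed (use t in simp)
  ultimately have \<alpha>_range: "\<alpha> \<in> {exp (- t * (MAX j\<in>{2..M - 1}. lam j * \<kappa> j))..1}"
    unfolding mass by simp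
  show ?thesis
  proof (rule that)
    show "0 \<le> lam j" if "j \<in> {2..M - 1}" for j using lam[OF that] by simp
    show "\<alpha> \<in> {exp (- t * (MAX j\<in>{2..M - 1}. lam j * \<kappa> j))..1}" by (rule \<alpha>_range)
    show "l \<in> {2..M}" by (rule l)
    show "\<beta> \<in> {0<..1}" using \<beta> by simp
    show "0 < C" by (rule C)
    show "stochastic_matrix {1..M + 1} (jump_mat lam C) C" unfolding lam_def by (rule stoch[OF x])
    show "\<beta> * kc.P t l j + (1 - \<beta>) * kc.P t (l - 1) j = \<alpha> * p j" if "j \<in> {1..M}" for j
      using eq[OF that] unfolding u .
  qed
qed

end

section \<open>The prescribed law at a fixed time\<close>

text \<open>For interior r the nested cases exclude each other: r + 1 \<le> M keeps the right
  neighbour apart from the cemetery M + 1.\<close>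

lemma Theta_eq_gen:
  assumes "killed_walk M (q_up i b) (q_down i b) (ktilde M i k)"
  shows "Theta M i b k lam r c = killed_walk.gen M (q_up i b) (q_down i b) (ktilde M i k) lam r c"
proof (cases "r \<in> {2..M - 1}")
  case True
  then have ne: "r + 1 \<noteq> r - 1" "r + 1 \<noteq> r" "r - 1 \<noteq> r" "r + 1 \<noteq> M + 1" "r - 1 \<noteq> M + 1" "r \<noteq> M + 1" by auto
  consider "c = r + 1" | "c = r - 1" | "c = r" | "c = M + 1" | "c \<notin> {r + 1, r - 1, r, M + 1}" by blast
  then show ?thesis
    unfolding Theta_def killed_walk.gen_def[OF assms] if_P[OF True] using ne by cases (simp_all add: algebra_simps)
next
  case False
  then show ?thesis unfolding Theta_def killed_walk.gen_def[OF assms] by (simp only: if_False)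
qed

text \<open>With A and B the spacings to the right and left of \<open>i j\<close>, the weights are B
  / (A + B) + A B b / (A + B) and A / (A + B) - A B b / (A + B). The first parts give the second
  difference, the others the term with \<open>Nabla\<close>, and the factor A B of
  \<open>a_coeff\<close> turns \<open>k\<close> into \<open>ktilde\<close>.\<close>

lemma generator_eq_Q:
  assumes "killed_walk M (q_up i b) (q_down i b) (ktilde M i k)"
    and inc: "strict_mono_on {1..M} i" and j: "j \<in> {2..M - 1}"
  shows "a_coeff M i lam j * (1 / 2 * Laplace M i f j + b j * Nabla M i f j - k j * f (i j)) =
    lam j * (q_up i b j * f (i (j + 1)) + q_down i b j * f (i (j - 1)) - (1 + ktilde M i k j) * f (i j))"
proof -
  have "i j < i (j + 1)" "i (j - 1) < i j"
    using strict_mono_onD[OF inc] j by auto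
  then obtain A B where AB: "i (j + 1) - i j = A" "i j - i (j - 1) = B" "0 < A" "0 < B"
    by simp
  then have sum: "i (j + 1) - i (j - 1) = A + B" "A + B \<noteq> 0" by simp_all
  show ?thesis
    unfolding a_coeff_def Laplace_def Nabla_def q_up_def q_down_def ktilde_def if_P[OF j] AB(1,2) sum(1)
    using AB(3,4) sum(2) by (simp add: divide_simps) (simp add: algebra_simps)
qed

theorem theorem5p3:
  fixes M :: nat and i p b k :: "nat \<Rightarrow> real" and t :: real
  assumes "M \<ge> 3"
    and "strict_mono_on {1..M} i"
    and "\<forall>j\<in>{1..M}. 0 < p j \<and> p j < 1"
    and "(\<Sum>j=1..M. p j) = 1"
    and "\<forall>j\<in>{2..M - 1}. - 1 / (i (j + 1) - i j) < b j \<and> b j < 1 / (i j - i (j - 1))"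
    and "\<forall>j\<in>{2..M - 1}. 0 \<le> k j"
    and "t > 0"
  shows "\<exists>(lam :: nat \<Rightarrow> real) (\<alpha> :: real) (l :: nat) (\<beta> :: real).
    (\<forall>j\<in>{2..M - 1}. 0 \<le> lam j) \<and>
    \<alpha> \<in> {exp (- t * (MAX j\<in>{2..M - 1}. lam j * ktilde M i k j))..1} \<and>
    l \<in> {2..M} \<and>
    \<beta> \<in> {0<..1} \<and>
    (\<exists>(\<Omega> :: (real \<Rightarrow> real option) measure) (X :: real \<Rightarrow> (real \<Rightarrow> real option) \<Rightarrow> real option).
      markov_chain \<Omega> X (states M i) \<and>
      is_intensity_matrix \<Omega> X (M + 1) (state M i) (Theta M i b k lam) \<and>
      (\<forall>j\<in>{1..M}.
        \<beta> * \<P>(\<omega> in \<Omega>. X t \<omega> = Some (i j) \<bar> X 0 \<omega> = Some (i l)) +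
        (1 - \<beta>) * \<P>(\<omega> in \<Omega>. X t \<omega> = Some (i j) \<bar> X 0 \<omega> = Some (i (l - 1))) = \<alpha> * p j) \<and>
      (\<forall>f :: real \<Rightarrow> real.
        (\<forall>j\<in>{1..M}. has_generator_at \<Omega> X (states M i) (extend_zero f) (Some (i j))
          (a_coeff M i lam j *
            (1 / 2 * Laplace M i f j + b j * Nabla M i f j - k j * f (i j)))) \<and>
        has_generator_at \<Omega> X (states M i) (extend_zero f) None 0))"
proof -
  interpret w: killed_walk M "q_up i b" "q_down i b" "ktilde M i k"
  proof
    show "3 \<le> M" by fact
    fix j assume j: "j \<in> {2..M - 1}"
    have less: "i j < i (j + 1)" "i (j - 1) < i j"
      using strict_mono_onD[OF assms(2)] j by auto
    \<comment> \<open>These bounds say exactly that both jump weights are positive.\<close>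
    have b: "- 1 / (i (j + 1) - i j) < b j" "b j < 1 / (i j - i (j - 1))"
      using assms(5) j by blast+
    have "0 < 1 + (i (j + 1) - i j) * b j"
      using pos_divide_less_eq[of "i (j + 1) - i j" "- 1" "b j"] b(1) less(1) by (simp add: mult.commute)
    then show "0 < q_up i b j"
      unfolding q_up_def using less by (intro mult_pos_pos divide_pos_pos) auto
    have "0 < 1 - (i j - i (j - 1)) * b j"
      using pos_less_divide_eq[of "i j - i (j - 1)" "b j" 1] b(2) less(2) by (simp add: mult.commute)
    then show "0 < q_down i b j"
      unfolding q_down_def using less by (intro mult_pos_pos divide_pos_pos) auto
    have "q_up i b j + q_down i b j =
        ((i j - i (j - 1)) * (1 + (i (j + 1) - i j) * b j) + (i (j + 1) - i j) * (1 - (i j - i (j - 1)) * b j)) /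
        (i (j + 1) - i (j - 1))"
      unfolding q_up_def q_down_def by (simp add: add_divide_distrib)
    also have "(i j - i (j - 1)) * (1 + (i (j + 1) - i j) * b j) + (i (j + 1) - i j) * (1 - (i j - i (j - 1)) * b j) =
        i (j + 1) - i (j - 1)"
      by (simp only: ring_distribs) (simp add: algebra_simps)
    finally show "q_up i b j + q_down i b j = 1" using less by simp
    show "0 \<le> ktilde M i k j"
      using less assms(6) j unfolding ktilde_def if_P[OF j] by (intro mult_nonneg_nonneg) auto
  qed
  obtain lam \<alpha> l \<beta> C where lam: "\<And>j. j \<in> {2..M - 1} \<Longrightarrow> 0 \<le> lam j"
    and \<alpha>: "\<alpha> \<in> {exp (- t * (MAX j\<in>{2..M - 1}. lam j * ktilde M i k j))..1}"
    and l: "l \<in> {2..M}" and \<beta>: "\<beta> \<in> {0<..1}"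
    and C: "0 < C" and stoch: "stochastic_matrix {1..M + 1} (w.jump_mat lam C) C"
    and target: "\<And>j. j \<in> {1..M} \<Longrightarrow> \<beta> * unif_semigroup {1..M + 1} (w.jump_mat lam C) C t l j +
      (1 - \<beta>) * unif_semigroup {1..M + 1} (w.jump_mat lam C) C t (l - 1) j = \<alpha> * p j"
    using w.exists_rates[of p t] assms(3,4,7) by blast
  interpret sm: stochastic_matrix "{1..M + 1}" "w.jump_mat lam C" C by (rule stoch)
  have inj_i: "inj_on i {1..M}" using assms(2) by (rule strict_mono_on_imp_inj_on)
  have inj: "inj_on (state M i) {1..M + 1}"
  proof (rule inj_onI)
    fix x y assume "x \<in> {1..M + 1}" "y \<in> {1..M + 1}" "state M i x = state M i y"
    then show "x = y"
      using inj_onD[OF inj_i, of x y] by (auto simp: state_def split: if_splits)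
  qed
  have range: "state M i ` {1..M + 1} = states M i"
  proof -
    have "{1..M + 1} = insert (M + 1) {1..M}" by auto
    then have "state M i ` {1..M + 1} = insert (state M i (M + 1)) (state M i ` {1..M})"
      by (simp only: image_insert)
    also have "state M i (M + 1) = None" by (simp add: state_def)
    also have "state M i ` {1..M} = Some ` i ` {1..M}"
      unfolding image_image by (intro image_cong refl) (simp add: state_def)
    finally show ?thesis unfolding states_def .
  qed
  have "{1..M + 1} \<noteq> {}" by simp
  from sm.markov_chain_unif[OF this inj] obtain \<Omega> :: "(real \<Rightarrow> real option) measure"
    where \<Omega>: "markov_chain \<Omega> (\<lambda>t f. f t) (states M i) \<and>
      (\<forall>t\<ge>0. \<forall>x\<in>{1..M + 1}. \<forall>y\<in>{1..M + 1}.
        trans_prob \<Omega> (\<lambda>t f. f t) t (state M i x) (state M i y) = sm.P t x y)"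
    unfolding range ..
  then have chain: "markov_chain \<Omega> (\<lambda>t f. f t) (states M i)" ..
  have trans: "trans_prob \<Omega> (\<lambda>t f. f t) t (state M i x) (state M i y) = sm.P t x y"
    if "0 \<le> t" "x \<in> {1..M + 1}" "y \<in> {1..M + 1}" for t x y
    using \<Omega> that by blast
  have deriv: "((\<lambda>t. sm.P t x y) has_real_derivative w.gen lam x y) (at 0)"
    if "x \<in> {1..M + 1}" "y \<in> {1..M + 1}" for x y
  proof -
    have "(\<Sum>z\<in>{1..M + 1}. w.jump_mat lam C x z * sm.P 0 z y) = w.jump_mat lam C x y"
      unfolding sm.unif_zero using that(2) by (simp add: if_distrib cong: if_cong del: sum.cl_ivl_Suc)
    then have "C * ((\<Sum>z\<in>{1..M + 1}. w.jump_mat lam C x z * sm.P 0 z y) - sm.P 0 x y) = w.gen lam x y"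
      unfolding sm.unif_zero[of x y] using C by (simp add: w.jump_mat_def)
    then show ?thesis using sm.unif_backward[OF that, of 0] by simp
  qed
  have intensity: "is_intensity_matrix \<Omega> (\<lambda>t f. f t) (M + 1) (state M i) (Theta M i b k lam)"
    unfolding is_intensity_matrix_def
  proof (intro ballI)
    fix r c assume rc: "r \<in> {1..M + 1}" "c \<in> {1..M + 1}"
    have "((\<lambda>h. sm.P h r c) has_real_derivative Theta M i b k lam r c) (at_right 0)"
      unfolding Theta_eq_gen[OF w.killed_walk_axioms]
      using deriv[OF rc] by (rule has_field_derivative_at_within)
    \<comment> \<open>\<open>trans\<close> covers h \<ge> 0 only, so the quotients are compared to
      the right of 0.\<close>
    moreover have "\<forall>\<^sub>F h in at_right 0. (trans_prob \<Omega> (\<lambda>t f. f t) h (state M i r) (state M i c) -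
        trans_prob \<Omega> (\<lambda>t f. f t) 0 (state M i r) (state M i c)) / (h - 0) = (sm.P h r c - sm.P 0 r c) / (h - 0)"
      using eventually_at_right_less[of 0]
      by eventually_elim (simp add: trans[OF _ rc])
    ultimately show "((\<lambda>h. trans_prob \<Omega> (\<lambda>t f. f t) h (state M i r) (state M i c)) has_real_derivative
        Theta M i b k lam r c) (at_right 0)"
      unfolding has_field_derivative_iff by (subst tendsto_cong)
  qed
  have generator: "has_generator_at \<Omega> (\<lambda>t f. f t) (states M i) (extend_zero f) (state M i r)
      (if r \<in> {2..M - 1} then lam r * w.Q (\<lambda>c. extend_zero f (state M i c)) r else 0)"
    if r: "r \<in> {1..M + 1}" for f r
  proof -
    define F where "F c = extend_zero f (state M i c)" for c
    \<comment> \<open>Extension by 0 removes the cemetery term in \<open>sum_gen\<close> and leaves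
      the rate times \<open>Q\<close>.\<close>
    have cemetery: "F (M + 1) = 0" by (simp add: F_def state_def extend_zero_def)
    have semi: "transition_semigroup \<Omega> (\<lambda>t f. f t) (states M i) h (extend_zero f) (state M i r) =
        (\<Sum>c\<in>{1..M + 1}. sm.P h r c * F c)" if "0 \<le> h" for h
      unfolding transition_semigroup_def range[symmetric] F_def
      using trans[OF that r] by (subst sum.reindex[OF inj]) simp
    have start: "extend_zero f (state M i r) = (\<Sum>c\<in>{1..M + 1}. sm.P 0 r c * F c)"
    proof -
      have "(\<Sum>c\<in>{1..M + 1}. sm.P 0 r c * F c) = (\<Sum>c\<in>{1..M + 1}. if r = c then F c else 0)"
        unfolding sm.unif_zero by (intro sum.cong refl) simp
      then show ?thesis using r by (simp only: sum.delta' finite_atLeastAtMost if_True F_def)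
    qed
    have "((\<lambda>h. \<Sum>c\<in>{1..M + 1}. sm.P h r c * F c) has_real_derivative (\<Sum>c\<in>{1..M + 1}. w.gen lam r c * F c)) (at 0)"
      using r by (intro DERIV_sum DERIV_cmult_right deriv)
    then have "((\<lambda>h. \<Sum>c\<in>{1..M + 1}. sm.P h r c * F c) has_real_derivative (\<Sum>c\<in>{1..M + 1}. w.gen lam r c * F c)) (at_right 0)"
      by (rule has_field_derivative_at_within)
    then have "((\<lambda>h. ((\<Sum>c\<in>{1..M + 1}. sm.P h r c * F c) - (\<Sum>c\<in>{1..M + 1}. sm.P 0 r c * F c)) / (h - 0)) \<longlongrightarrow>
        (\<Sum>c\<in>{1..M + 1}. w.gen lam r c * F c)) (at_right 0)"
      by (rule has_field_derivative_iff[THEN iffD1])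
    moreover have "\<forall>\<^sub>F h in at_right 0.
        (transition_semigroup \<Omega> (\<lambda>t f. f t) (states M i) h (extend_zero f) (state M i r) - extend_zero f (state M i r)) / h =
        ((\<Sum>c\<in>{1..M + 1}. sm.P h r c * F c) - (\<Sum>c\<in>{1..M + 1}. sm.P 0 r c * F c)) / (h - 0)"
      using eventually_at_right_less[of 0]
      by eventually_elim (simp only: semi[OF less_imp_le] start diff_zero)
    ultimately have "has_generator_at \<Omega> (\<lambda>t f. f t) (states M i) (extend_zero f) (state M i r)
        (\<Sum>c\<in>{1..M + 1}. w.gen lam r c * F c)"
      unfolding has_generator_at_def by (subst tendsto_cong)
    then show ?thesis
      unfolding w.sum_gen F_def using cemetery[unfolded F_def]
      by (simp only: mult_zero_right add_0_right)
  qed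
  have alive: "has_generator_at \<Omega> (\<lambda>t f. f t) (states M i) (extend_zero f) (Some (i j))
      (a_coeff M i lam j * (1 / 2 * Laplace M i f j + b j * Nabla M i f j - k j * f (i j)))"
    if j: "j \<in> {1..M}" for f j
  proof -
    have st: "state M i m = Some (i m)" if "m \<le> M" for m using that by (simp add: state_def)
    have "a_coeff M i lam j * (1 / 2 * Laplace M i f j + b j * Nabla M i f j - k j * f (i j)) =
      (if j \<in> {2..M - 1} then lam j * w.Q (\<lambda>c. extend_zero f (state M i c)) j else 0)"
    proof (cases "j \<in> {2..M - 1}")
      case True
      then have "j + 1 \<le> M" "j - 1 \<le> M" "j \<le> M" by auto
      then show ?thesis
        unfolding generator_eq_Q[OF w.killed_walk_axioms assms(2) True] if_P[OF True] w.Q_def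
        by (simp only: st extend_zero_def option.case)
    next
      case False
      then show ?thesis unfolding a_coeff_def by (simp only: if_False mult_zero_left)
    qed
    moreover have "j \<in> {1..M + 1}" "j \<le> M" using j by auto
    ultimately show ?thesis using generator[of j f] by (simp only: st)
  qed
  have dead: "has_generator_at \<Omega> (\<lambda>t f. f t) (states M i) (extend_zero f) None 0" for f
  proof -
    have "M + 1 \<notin> {2..M - 1}" "M + 1 \<in> {1..M + 1}" "state M i (M + 1) = None" by (auto simp: state_def)
    then show ?thesis using generator[of "M + 1" f] by (simp only: if_False)
  qed
  have hit: "\<beta> * \<P>(\<omega> in \<Omega>. \<omega> t = Some (i j) \<bar> \<omega> 0 = Some (i l)) +
      (1 - \<beta>) * \<P>(\<omega> in \<Omega>. \<omega> t = Some (i j) \<bar> \<omega> 0 = Some (i (l - 1))) = \<alpha> * p j"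
    if j: "j \<in> {1..M}" for j
  proof -
    have "state M i j = Some (i j)" "state M i l = Some (i l)" "state M i (l - 1) = Some (i (l - 1))"
      "j \<in> {1..M + 1}" "l \<in> {1..M + 1}" "l - 1 \<in> {1..M + 1}"
      using j l by (auto simp: state_def)
    then show ?thesis
      using target[OF j] trans[of t l j] trans[of t "l - 1" j] assms(7) unfolding trans_prob_def by simp
  qed
  show ?thesis
    by (intro exI[of _ lam] exI[of _ \<alpha>] exI[of _ l] exI[of _ \<beta>] exI[of _ \<Omega>] exI[of _ "\<lambda>t f. f t"]
        conjI ballI allI lam \<alpha> l \<beta> chain intensity hit alive dead)
qed



end
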